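(* The decision problem MCCSP-D is NP-complete, where MCCSP-D is: given a graph $G$ and a positive integer $\alpha$, is there a shortest path between two vertices in $G$ whose closeness centrality $C_c^{\max}$ is less than $\alpha$?
   Context: $G=(V,E)$ is an unweighted, possibly directed, graph, assumed connected if undirected and weakly connected if directed; in a directed graph an undirected edge is understood as a pair of oppositely directed edges. A path is a finite sequence of distinct vertices in which consecutive vertices are adjacent (a single vertex is allowed); its length is its number of edges. For vertices $u,v$, $d_{uv}$ is the length of a shortest path from $u$ to $v$ ($+\infty$ if there is none). For a path $P$ and a vertex $u$, $d(u,P)=\min\{d_{uv}: v\in P\}$, and the path closeness centrality (an inverse measure: larger values mean less central) is $C_c^{\max}(P)=\max\{d(u,P): u\in V\}$. *)

theory Defs
  imports
    "Graph_Theory.Graph_Theory"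
    "HOL-Library.Extended_Nat"
    "HOL-Computational_Algebra.Polynomial"
begin

section \<open>Deterministic multi-tape Turing machines\<close>

text \<open>
  A machine has \<open>tm_tapes\<close> two-way infinite tapes, tape symbols \<open>{..<tm_syms}\<close>, working states
  \<open>{..<tm_states}\<close>, start state \<open>0\<close> and halting state \<open>tm_states\<close>. Symbol 0 is the blank;
  symbols 1 and 2 stand for the bits \<open>False\<close> and \<open>True\<close>. The transition function maps a state and
  the list of scanned symbols to the next state and, for each tape, the symbol written and the
  head movement.
\<close>

datatype move = Move_Left | Stay | Move_Right

record tm =
  tm_tapes :: nat
  tm_syms :: nat
  tm_states :: nat
  tm_trans :: "nat \<Rightarrow> nat list \<Rightarrow> nat \<times> (nat \<times> move) list"

definition wf_tm :: "tm \<Rightarrow> bool" where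
  "wf_tm M \<longleftrightarrow> 1 \<le> tm_tapes M \<and> 3 \<le> tm_syms M \<and>
     (\<forall>q < tm_states M. \<forall>ss. length ss = tm_tapes M \<and> set ss \<subseteq> {..<tm_syms M} \<longrightarrow>
        (case tm_trans M q ss of (q', as) \<Rightarrow>
           q' \<le> tm_states M \<and> length as = tm_tapes M \<and> (\<forall>(w, d) \<in> set as. w < tm_syms M)))"

text \<open>A tape is its head position together with the contents of its cells.\<close>

type_synonym tape = "int \<times> (int \<Rightarrow> nat)"

type_synonym tm_config = "nat \<times> tape list"

fun read_tape :: "tape \<Rightarrow> nat" where
  "read_tape (h, c) = c h"

fun shift_head :: "move \<Rightarrow> int \<Rightarrow> int" where
  "shift_head Move_Left h = h - 1"
| "shift_head Stay h = h"
| "shift_head Move_Right h = h + 1"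

fun act_tape :: "nat \<times> move \<Rightarrow> tape \<Rightarrow> tape" where
  "act_tape (w, d) (h, c) = (shift_head d h, c(h := w))"

fun tm_step :: "tm \<Rightarrow> tm_config \<Rightarrow> tm_config" where
  "tm_step M (q, ts) =
     (if q < tm_states M
      then (case tm_trans M q (map read_tape ts) of (q', as) \<Rightarrow> (q', map2 act_tape as ts))
      else (q, ts))"

definition cells_of :: "bool list \<Rightarrow> int \<Rightarrow> nat" where
  "cells_of x = (\<lambda>i. if 0 \<le> i \<and> i < int (length x) then (if x ! nat i then 2 else 1) else 0)"

text \<open>The input is on the first tape, and all other tapes are blank.\<close>

definition tm_start :: "tm \<Rightarrow> bool list \<Rightarrow> tm_config" where
  "tm_start M x = (0, (0, cells_of x) # replicate (tm_tapes M - 1) (0, cells_of []))"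

text \<open>
  The output is the contents of the last tape when the machine halts. Halting configurations are
  fixed points of \<^const>\<open>tm_step\<close>.
\<close>

definition tm_computes_within ::
  "tm \<Rightarrow> (bool list \<Rightarrow> bool list) \<Rightarrow> (nat \<Rightarrow> nat) \<Rightarrow> bool" where
  "tm_computes_within M f T \<longleftrightarrow>
     (\<forall>x. \<exists>t \<le> T (length x). case (tm_step M ^^ t) (tm_start M x) of (q, ts) \<Rightarrow>
        q = tm_states M \<and> snd (last ts) = cells_of (f x))"


section \<open>NP-completeness\<close>

definition polytime_computable :: "(bool list \<Rightarrow> bool list) \<Rightarrow> bool" where
  "polytime_computable f \<longleftrightarrow>
     (\<exists>M (p :: nat poly). wf_tm M \<and> tm_computes_within M f (\<lambda>n. poly p n))"

definition class_P :: "bool list set set" where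
  "class_P = {L. polytime_computable (\<lambda>x. [x \<in> L])}"

text \<open>Self-delimiting pairing: the bits of \<open>x\<close> are doubled, and 01 marks the end of \<open>x\<close>.\<close>

definition pair_enc :: "bool list \<Rightarrow> bool list \<Rightarrow> bool list" where
  "pair_enc x u = concat (map (\<lambda>b. [b, b]) x) @ [False, True] @ u"

definition class_NP :: "bool list set set" where
  "class_NP = {L. \<exists>R \<in> class_P. \<exists>p :: nat poly. \<forall>x.
     x \<in> L \<longleftrightarrow> (\<exists>u. length u \<le> poly p (length x) \<and> pair_enc x u \<in> R)}"

definition polytime_reducible :: "bool list set \<Rightarrow> bool list set \<Rightarrow> bool" where
  "polytime_reducible L' L \<longleftrightarrow>
     (\<exists>f. polytime_computable f \<and> (\<forall>x. x \<in> L' \<longleftrightarrow> f x \<in> L))"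

definition NP_complete :: "bool list set \<Rightarrow> bool" where
  "NP_complete L \<longleftrightarrow> L \<in> class_NP \<and> (\<forall>L' \<in> class_NP. polytime_reducible L' L)"


section \<open>Closeness-central shortest paths\<close>

text \<open>
  The infimum of the empty set is \<open>\<infinity>\<close>, the distance to an unreachable vertex.
  Note that \<^term>\<open>vpath p G\<close> includes \<^term>\<open>p \<noteq> []\<close>, and that \<^const>\<open>vwalk_length\<close>
  counts edges.
\<close>

definition vdist :: "'a pair_pre_digraph \<Rightarrow> 'a \<Rightarrow> 'a \<Rightarrow> enat" where
  "vdist G u v =
     (INF p \<in> {p. vpath p (with_proj G) \<and> hd p = u \<and> last p = v}. enat (vwalk_length p))"

definition shortest_vpath :: "'a pair_pre_digraph \<Rightarrow> 'a list \<Rightarrow> bool" where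
  "shortest_vpath G p \<longleftrightarrow>
     vpath p (with_proj G) \<and> enat (vwalk_length p) = vdist G (hd p) (last p)"

definition vdist_to_path :: "'a pair_pre_digraph \<Rightarrow> 'a \<Rightarrow> 'a list \<Rightarrow> enat" where
  "vdist_to_path G u p = Min ((\<lambda>v. vdist G u v) ` set p)"

definition closeness_max :: "'a pair_pre_digraph \<Rightarrow> 'a list \<Rightarrow> enat" where
  "closeness_max G p = Max ((\<lambda>u. vdist_to_path G u p) ` pverts G)"

text \<open>
  \<^const>\<open>pair_digraph\<close> is a finite loop-free digraph; undirected graphs are the symmetric ones.
  \<^const>\<open>Digraph_Component.connected\<close> is connectedness of the underlying symmetric graph, that is,
  weak connectedness, and implies that there is a vertex.
\<close>

definition MCCSP_instance :: "nat pair_pre_digraph \<Rightarrow> nat \<Rightarrow> bool" where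
  "MCCSP_instance G \<alpha> \<longleftrightarrow>
     pair_digraph G \<and> pverts G = {..<card (pverts G)} \<and>
     Digraph_Component.connected (with_proj G) \<and> 0 < \<alpha>"

definition MCCSP_yes :: "nat pair_pre_digraph \<Rightarrow> nat \<Rightarrow> bool" where
  "MCCSP_yes G \<alpha> \<longleftrightarrow> (\<exists>p. shortest_vpath G p \<and> closeness_max G p < enat \<alpha>)"

text \<open>Binary representation, least significant bit first.\<close>

fun nat_bits :: "nat \<Rightarrow> bool list" where
  "nat_bits n = (if n = 0 then [] else odd n # nat_bits (n div 2))"

declare nat_bits.simps [simp del]

text \<open>
  The number of vertices in unary, terminated by 0, then the adjacency matrix row by row, then
  \<open>\<alpha>\<close> in binary.
\<close>

definition MCCSP_encode :: "nat pair_pre_digraph \<Rightarrow> nat \<Rightarrow> bool list" where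
  "MCCSP_encode G \<alpha> = (let n = card (pverts G) in
     replicate n True @ [False] @
     map (\<lambda>e. e \<in> parcs G) (List.product [0..<n] [0..<n]) @
     nat_bits \<alpha>)"

definition MCCSP_D :: "bool list set" where
  "MCCSP_D = {MCCSP_encode G \<alpha> | G \<alpha>. MCCSP_instance G \<alpha> \<and> MCCSP_yes G \<alpha>}"

end

theory Submission
  imports Defs
begin

text \<open>
  Both halves rest on one fact about Turing machines. Values of arithmetic expressions over a
  binary string, built from its length, its bits, addition, truncated subtraction and bounded
  summation, are polynomially bounded, and such expressions can be evaluated in unary by counter
  machines in polynomial time. Bounded quantifiers, division and case distinctions are expressible,
  so it suffices to define the verifier and the reduction in this language.

  Hardness: a run of an NP verifier is a constraint satisfaction problem with polynomially many
  variables, polynomially large domains, and clauses that are disjunctions of equations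
  \<open>variable = value\<close>. The graph has a layer of vertices for each variable, one per value, with all
  arcs from each layer to the next, a sink after the last layer, and a vertex for each clause with
  arcs to the equations in it. For \<open>\<alpha> = 2\<close>, the path has to contain the sink, it chooses at most one
  value per variable, and the vertex of a clause is close to it iff the choice satisfies the clause.

  Membership: a certificate lists the path, upper bounds for the distances to it and for the
  distances to a root in the underlying undirected graph, and a superset of the vertices that are
  reachable from the start of the path in exactly \<open>k\<close> steps, for each \<open>k\<close>, which witnesses that the
  path is shortest. The latter sets have to be closed under taking steps, so all conditions are
  local.
\<close>

section \<open>Counter programs on Turing machines\<close>

text \<open>The expression language has bounded sums but no recursion, and only polynomially bounded
  values. Hence everything that is naturally computed by iteration (reachability, distances,
  comparison with \<alpha>, which can be exponential in the number of its digits) is guessed as a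
  matrix whose rows are checked against neighbouring rows. Errors are tolerated on one side only:
  the certificate may claim too little closeness and too much reachability, and still proves what it
  is meant to prove. In the graph of a constraint problem, arcs between layers raise the layer by
  exactly one. So all walks between two such vertices have the same length, every path through the
  layers is shortest, and none visits a layer twice. The bound 2 reduces centrality to having an arc
  into the path. The sink has no outgoing arcs and is therefore close only to itself. Variables with
  many values, instead of Boolean ones, can hold a row of the transition table or a head position,
  so that a machine step is described by clauses about at most three variables.\<close>

datatype cond = Pos nat | Nonblank

datatype com = Inc nat | Dec nat | In_Right | In_Left | Inc_Bit nat | Out nat
  | Seq com com (infixr ";;" 60) | While cond com

type_synonym state = "nat \<times> (nat \<Rightarrow> nat) \<times> bool list"

definition bit_at :: "bool list \<Rightarrow> nat \<Rightarrow> bool" where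
  "bit_at x j \<longleftrightarrow> j < length x \<and> x ! j"

fun holds :: "bool list \<Rightarrow> cond \<Rightarrow> state \<Rightarrow> bool" where
  "holds x (Pos r) (h, R, out) \<longleftrightarrow> R r > 0"
| "holds x Nonblank (h, R, out) \<longleftrightarrow> h < length x"

text \<open>The counts are exactly the steps of the machine: one per instruction, and for each round
  of a loop one test and one jump back, hence the 2. \<open>In_Left\<close> has no rule at position
  0, so the input head never gets to the left of the input.\<close>

inductive run :: "bool list \<Rightarrow> com \<Rightarrow> state \<Rightarrow> nat \<Rightarrow> state \<Rightarrow> bool" for x where
  run_Inc: "run x (Inc r) (h, R, out) 1 (h, R(r := R r + 1), out)"
| run_Dec: "run x (Dec r) (h, R, out) 1 (h, R(r := R r - 1), out)"
| run_In_Right: "run x In_Right (h, R, out) 1 (Suc h, R, out)"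
| run_In_Left: "run x In_Left (Suc h, R, out) 1 (h, R, out)"
| run_Inc_Bit: "run x (Inc_Bit r) (h, R, out) 1 (h, R(r := R r + of_bool (bit_at x h)), out)"
| run_Out: "run x (Out r) (h, R, out) 1 (h, R, out @ [R r > 0])"
| run_Seq: "run x c s m s' \<Longrightarrow> run x d s' n s'' \<Longrightarrow> run x (c ;; d) s (m + n) s''"
| run_While_False: "\<not> holds x b s \<Longrightarrow> run x (While b c) s 1 s"
| run_While_True: "holds x b s \<Longrightarrow> run x c s m s' \<Longrightarrow> run x (While b c) s' n s'' \<Longrightarrow>
    run x (While b c) s (m + n + 2) s''"

section \<open>Translation of programs into transition tables, and its correctness\<close>

type_synonym instr = "nat list \<Rightarrow> nat \<times> (nat \<times> move) list"

definition stay :: "nat list \<Rightarrow> (nat \<times> move) list" where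
  "stay ss = map (\<lambda>s. (s, Stay)) ss"

fun com_size :: "com \<Rightarrow> nat" where
  "com_size (c ;; d) = com_size c + com_size d"
| "com_size (While b c) = com_size c + 2"
| "com_size _ = 1"

fun scan_holds :: "cond \<Rightarrow> nat list \<Rightarrow> bool" where
  "scan_holds (Pos r) ss \<longleftrightarrow> ss ! Suc r \<noteq> 1"
| "scan_holds Nonblank ss \<longleftrightarrow> ss ! 0 \<noteq> 0"

text \<open>
  Tape 0 is the input, tape \<open>r + 1\<close> is register \<open>r\<close>, and tape \<open>k + 1\<close> is the output. The value of
  a register is the head position on a tape that contains a single 1, in cell 0.
\<close>

fun code :: "nat \<Rightarrow> com \<Rightarrow> nat \<Rightarrow> instr list" where
  "code k (Inc r) q = [\<lambda>ss. (q + 1, (stay ss)[Suc r := (ss ! Suc r, Move_Right)])]"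
| "code k (Dec r) q =
    [\<lambda>ss. (q + 1, (stay ss)[Suc r := (ss ! Suc r, if ss ! Suc r = 1 then Stay else Move_Left)])]"
| "code k In_Right q = [\<lambda>ss. (q + 1, (stay ss)[0 := (ss ! 0, Move_Right)])]"
| "code k In_Left q = [\<lambda>ss. (q + 1, (stay ss)[0 := (ss ! 0, Move_Left)])]"
| "code k (Inc_Bit r) q =
    [\<lambda>ss. (q + 1, (stay ss)[Suc r := (ss ! Suc r, if ss ! 0 = 2 then Move_Right else Stay)])]"
| "code k (Out r) q =
    [\<lambda>ss. (q + 1, (stay ss)[Suc k := (if ss ! Suc r = 1 then 1 else 2, Move_Right)])]"
| "code k (c ;; d) q = code k c q @ code k d (q + com_size c)"
| "code k (While b c) q =
    [\<lambda>ss. (if scan_holds b ss then q + 1 else q + com_size c + 2, stay ss)] @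
    code k c (q + 1) @ [\<lambda>ss. (q, stay ss)]"

fun regs :: "com \<Rightarrow> nat set" where
  "regs (Inc r) = {r}"
| "regs (Dec r) = {r}"
| "regs (Inc_Bit r) = {r}"
| "regs (Out r) = {r}"
| "regs (c ;; d) = regs c \<union> regs d"
| "regs (While (Pos r) c) = insert r (regs c)"
| "regs (While Nonblank c) = regs c"
| "regs _ = {}"

lemma length_code [simp]: "length (code k c q) = com_size c"
  by (induction c arbitrary: q) auto

lemma finite_regs: "finite (regs c)"
  by (induction c rule: regs.induct) auto

fun tapes :: "nat \<Rightarrow> bool list \<Rightarrow> state \<Rightarrow> tape list" where
  "tapes k x (h, R, out) =
    (int h, cells_of x) # map (\<lambda>r. (int (R r), (\<lambda>_. 0)(0 := 1))) [0..<k] @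
    [(int (length out), cells_of out)]"

lemma length_tapes [simp]: "length (tapes k x s) = k + 2"
  by (cases s) auto

lemma act_read_tape [simp]: "act_tape (read_tape t, Stay) t = t"
  by (cases t) auto

lemma length_stay [simp]: "length (stay ss) = length ss"
  by (simp add: stay_def)

lemma act_stay: "map2 act_tape (stay (map read_tape ts)) ts = ts"
  unfolding stay_def by (induction ts) auto

lemma act_stay_update:
  assumes "i < length ts"
  shows "map2 act_tape ((stay (map read_tape ts))[i := a]) ts = ts[i := act_tape a (ts ! i)]"
proof -
  have "map2 act_tape ((stay (map read_tape ts))[i := a]) (ts[i := ts ! i])
      = (map2 act_tape (stay (map read_tape ts)) ts)[i := act_tape a (ts ! i)]"
    by (simp add: zip_update map_update del: list_update_id)
  then show ?thesis by (simp add: act_stay)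
qed

lemma tapes_update_reg:
  assumes "r < k"
  shows "(tapes k x (h, R, out))[Suc r := (int v, (\<lambda>_. 0)(0 := 1))] = tapes k x (h, R(r := v), out)"
  using assms by (auto intro!: nth_equalityI simp: nth_append nth_list_update)

lemma tapes_update_out:
  "(tapes k x (h, R, out))[Suc k := (int (length out'), cells_of out')] = tapes k x (h, R, out')"
  by (simp add: list_update_append)

lemma cells_of_nat: "cells_of x (int j) = (if j < length x then if bit_at x j then 2 else 1 else 0)"
  by (auto simp: cells_of_def bit_at_def)

lemma cells_of_snoc: "(cells_of out)(int (length out) := if b then 2 else 1) = cells_of (out @ [b])"
  by (rule ext) (auto simp: cells_of_def nth_append nat_eq_iff)

lemma scan_holds_iff:
  assumes "\<And>r. b = Pos r \<Longrightarrow> r < k"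
  shows "scan_holds b (map read_tape (tapes k x s)) = holds x b s"
proof (cases s)
  case (fields h R out)
  show ?thesis
  proof (cases b)
    case (Pos r)
    with assms have "r < k" by blast
    then show ?thesis unfolding fields Pos
      by (auto simp: nth_append)
  qed (use fields in \<open>auto simp: cells_of_nat\<close>)
qed

lemma step_update:
  assumes "q < tm_states M" "tm_trans M q = (\<lambda>ss. (q + 1, (stay ss)[i := a ss]))" "i < length ts"
    and "ts[i := act_tape (a (map read_tape ts)) (ts ! i)] = ts'"
  shows "(tm_step M ^^ 1) (q, ts) = (q + 1, ts')"
  using assms by (simp add: act_stay_update)

text \<open>The code sits at an arbitrary address \<open>q\<close> of an arbitrary machine, which is
  what the induction needs for subcommands. Control always leaves at the address just after the
  code; for the whole program this is the halting state.\<close>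

lemma run_simulated:
  assumes "run x c s n s'" and "regs c \<subseteq> {..<k}"
    and "\<And>i. i < com_size c \<Longrightarrow> tm_trans M (q + i) = code k c q ! i"
    and "q + com_size c \<le> tm_states M"
  shows "(tm_step M ^^ n) (q, tapes k x s) = (q + com_size c, tapes k x s')"
  using assms
proof (induction arbitrary: q rule: run.induct)
  case (run_Inc r h R out)
  let ?ts = "tapes k x (h, R, out)"
  have r: "r < k" "q < tm_states M" and t: "tm_trans M q = code k (Inc r) q ! 0"
    using run_Inc.prems(1,3) run_Inc.prems(2)[of 0] by auto
  have "act_tape (map read_tape ?ts ! Suc r, Move_Right) (?ts ! Suc r)
      = (int (R r + 1), (\<lambda>_. 0)(0 := 1))"
    using r by (auto simp: nth_append cells_of_nat bit_at_def)
  then have upd: "?ts[Suc r := act_tape (map read_tape ?ts ! Suc r, Move_Right) (?ts ! Suc r)]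
      = tapes k x (h, R(r := R r + 1), out)"
    using tapes_update_reg[OF r(1)] by metis
  show ?case
    unfolding com_size.simps
    by (rule step_update[OF r(2) t[unfolded code.simps nth_Cons_0] _ upd]) (use r in simp)
next
  case (run_Dec r h R out)
  let ?ts = "tapes k x (h, R, out)"
  have r: "r < k" "q < tm_states M" and t: "tm_trans M q = code k (Dec r) q ! 0"
    using run_Dec.prems(1,3) run_Dec.prems(2)[of 0] by auto
  have "act_tape (map read_tape ?ts ! Suc r, if map read_tape ?ts ! Suc r = 1 then Stay else Move_Left) (?ts ! Suc r)
      = (int (R r - 1), (\<lambda>_. 0)(0 := 1))"
    using r by (auto simp: nth_append cells_of_nat bit_at_def)
  then have upd: "?ts[Suc r := act_tape (map read_tape ?ts ! Suc r, if map read_tape ?ts ! Suc r = 1 then Stay else Move_Left) (?ts ! Suc r)]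
      = tapes k x (h, R(r := R r - 1), out)"
    using tapes_update_reg[OF r(1)] by metis
  show ?case
    unfolding com_size.simps
    by (rule step_update[OF r(2) t[unfolded code.simps nth_Cons_0] _ upd]) (use r in simp)
next
  case (run_In_Right h R out)
  let ?ts = "tapes k x (h, R, out)"
  have r: "q < tm_states M" and t: "tm_trans M q = code k In_Right q ! 0"
    using run_In_Right.prems(3) run_In_Right.prems(2)[of 0] by auto
  have upd: "?ts[0 := act_tape (map read_tape ?ts ! 0, Move_Right) (?ts ! 0)] = tapes k x (Suc h, R, out)"
    by auto
  show ?case
    unfolding com_size.simps
    by (rule step_update[OF r t[unfolded code.simps nth_Cons_0] _ upd]) simp
next
  case (run_In_Left h R out)
  let ?ts = "tapes k x (Suc h, R, out)"
  have r: "q < tm_states M" and t: "tm_trans M q = code k In_Left q ! 0"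
    using run_In_Left.prems(3) run_In_Left.prems(2)[of 0] by auto
  have upd: "?ts[0 := act_tape (map read_tape ?ts ! 0, Move_Left) (?ts ! 0)] = tapes k x (h, R, out)"
    by auto
  show ?case
    unfolding com_size.simps
    by (rule step_update[OF r t[unfolded code.simps nth_Cons_0] _ upd]) simp
next
  case (run_Inc_Bit r h R out)
  let ?ts = "tapes k x (h, R, out)"
  have r: "r < k" "q < tm_states M" and t: "tm_trans M q = code k (Inc_Bit r) q ! 0"
    using run_Inc_Bit.prems(1,3) run_Inc_Bit.prems(2)[of 0] by auto
  have "act_tape (map read_tape ?ts ! Suc r, if map read_tape ?ts ! 0 = 2 then Move_Right else Stay) (?ts ! Suc r)
      = (int (R r + of_bool (bit_at x h)), (\<lambda>_. 0)(0 := 1))"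
    using r by (auto simp: nth_append cells_of_nat bit_at_def)
  then have upd: "?ts[Suc r := act_tape (map read_tape ?ts ! Suc r, if map read_tape ?ts ! 0 = 2 then Move_Right else Stay) (?ts ! Suc r)]
      = tapes k x (h, R(r := R r + of_bool (bit_at x h)), out)"
    using tapes_update_reg[OF r(1)] by metis
  show ?case
    unfolding com_size.simps
    by (rule step_update[OF r(2) t[unfolded code.simps nth_Cons_0] _ upd]) (use r in simp)
next
  case (run_Out r h R out)
  let ?ts = "tapes k x (h, R, out)"
  have r: "r < k" "q < tm_states M" and t: "tm_trans M q = code k (Out r) q ! 0"
    using run_Out.prems(1,3) run_Out.prems(2)[of 0] by auto
  have "act_tape (if map read_tape ?ts ! Suc r = 1 then 1 else 2, Move_Right) (?ts ! Suc k)
      = (int (length (out @ [R r > 0])), cells_of (out @ [R r > 0]))"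
    using r cells_of_snoc[of out "R r > 0"] by (auto simp: nth_append)
  then have upd: "?ts[Suc k := act_tape (if map read_tape ?ts ! Suc r = 1 then 1 else 2, Move_Right) (?ts ! Suc k)]
      = tapes k x (h, R, out @ [R r > 0])"
    using tapes_update_out by metis
  show ?case
    unfolding com_size.simps
    by (rule step_update[OF r(2) t[unfolded code.simps nth_Cons_0] _ upd]) (use r in simp)
next
  case (run_Seq c s m s' d n s'')
  have "(tm_step M ^^ m) (q, tapes k x s) = (q + com_size c, tapes k x s')"
    using run_Seq.prems by (intro run_Seq.IH(1)) (auto simp: nth_append)
  moreover have "(tm_step M ^^ n) (q + com_size c, tapes k x s')
      = (q + com_size c + com_size d, tapes k x s'')"
  proof (intro run_Seq.IH(2))
    fix i assume "i < com_size d"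
    then show "tm_trans M (q + com_size c + i) = code k d (q + com_size c) ! i"
      using run_Seq.prems(2)[of "com_size c + i"] by (simp add: nth_append add.assoc)
  qed (use run_Seq.prems in auto)
  ultimately show ?case
    by (simp add: add.commute[of m] funpow_add)
next
  case (run_While_False b s c)
  then have "tm_trans M q = code k (While b c) q ! 0" "q < tm_states M"
    using run_While_False.prems(2)[of 0] by auto
  moreover have "scan_holds b (map read_tape (tapes k x s)) = holds x b s"
    by (rule scan_holds_iff) (use run_While_False.prems(1) in auto)
  ultimately show ?case using run_While_False.hyps by (simp add: act_stay)
next
  case (run_While_True b s c m s' n s'')
  have "tm_trans M q = code k (While b c) q ! 0" and lt: "q < tm_states M"
    using run_While_True.prems(2)[of 0] run_While_True.prems(3) by auto
  moreover have "scan_holds b (map read_tape (tapes k x s)) = holds x b s"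
    by (rule scan_holds_iff) (use run_While_True.prems(1) in auto)
  ultimately have 1: "tm_step M (q, tapes k x s) = (q + 1, tapes k x s)"
    using run_While_True.hyps by (simp add: act_stay)
  have 2: "(tm_step M ^^ m) (q + 1, tapes k x s) = (q + 1 + com_size c, tapes k x s')"
  proof (intro run_While_True.IH(1))
    show "regs c \<subseteq> {..<k}" using run_While_True.prems(1) by (cases b) auto
    show "tm_trans M (q + 1 + i) = code k c (q + 1) ! i" if "i < com_size c" for i
      using that run_While_True.prems(2)[of "1 + i"] by (simp add: nth_append)
  qed (use run_While_True.prems in auto)
  have "tm_trans M (q + 1 + com_size c) = (\<lambda>ss. (q, stay ss))"
    using run_While_True.prems(2)[of "1 + com_size c"] by (simp add: nth_append)
  then have 3: "tm_step M (q + 1 + com_size c, tapes k x s') = (q, tapes k x s')"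
    using run_While_True.prems(3) by (simp add: act_stay)
  have 4: "(tm_step M ^^ n) (q, tapes k x s') = (q + com_size (While b c), tapes k x s'')"
    by (rule run_While_True.IH(2)) (use run_While_True.prems in auto)
  \<comment> \<open>One test, \<open>m\<close> steps of the body, one jump back, and
    \<open>n\<close> steps from the loop head.\<close>
  have "m + n + 2 = n + Suc (m + 1)" by simp
  then have "(tm_step M ^^ (m + n + 2)) (q, tapes k x s)
      = (tm_step M ^^ n) (tm_step M ((tm_step M ^^ m) (tm_step M (q, tapes k x s))))"
    by (simp only: funpow_add funpow.simps o_apply funpow_0 One_nat_def id_apply)
  then show ?case using 1 2 3 4 by simp
qed

text \<open>State 0 is a preamble. All tapes but the first start blank, so it writes the symbol 1
  into cell 0 of every register tape, where it marks the value zero. The program proper starts at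
  address 1.\<close>

definition com_tm :: "nat \<Rightarrow> com \<Rightarrow> tm" where
  "com_tm k c = \<lparr>tm_tapes = k + 2, tm_syms = 3, tm_states = 1 + com_size c,
    tm_trans = (!) ((\<lambda>ss. (1, (ss ! 0, Stay) # replicate k (1, Stay) @ [(ss ! Suc k, Stay)]))
      # code k c 1)\<rparr>"

definition wf_instr :: "nat \<Rightarrow> nat \<Rightarrow> instr \<Rightarrow> bool" where
  "wf_instr n k f \<longleftrightarrow> (\<forall>ss. length ss = k + 2 \<and> set ss \<subseteq> {..<3} \<longrightarrow>
     (case f ss of (q', as) \<Rightarrow> q' \<le> n \<and> length as = k + 2 \<and> (\<forall>(w, d) \<in> set as. w < 3)))"

lemma wf_instr_update:
  assumes "q < n" "\<And>ss. length ss = k + 2 \<Longrightarrow> set ss \<subseteq> {..<3} \<Longrightarrow> w ss < 3"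
  shows "wf_instr n k (\<lambda>ss. (q + 1, (stay ss)[i := (w ss, d ss)]))"
proof -
  have "v < 3" if ss: "length ss = k + 2" "set ss \<subseteq> {..<3}"
    and "(v, e) \<in> set ((stay ss)[i := (w ss, d ss)])" for ss v e
  proof -
    have "(v, e) \<in> insert (w ss, d ss) (set (stay ss))"
      using set_update_subset_insert that(3) by fastforce
    then show "v < 3" using ss assms(2)[of ss] by (auto simp: stay_def)
  qed
  then show ?thesis using assms(1) by (auto simp: wf_instr_def)
qed

lemma nth_bounded: "set ss \<subseteq> {..<n} \<Longrightarrow> i < length ss \<Longrightarrow> ss ! i < (n :: nat)"
  using nth_mem by fastforce

lemma wf_code:
  assumes "f \<in> set (code k c q)" "regs c \<subseteq> {..<k}" "q + com_size c \<le> n"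
  shows "wf_instr n k f"
  using assms
proof (induction k c q rule: code.induct)
  case (1 k r q)
  then show ?case by (auto intro!: wf_instr_update[simplified] nth_bounded)
next
  case (2 k r q)
  then show ?case by (auto intro!: wf_instr_update[simplified] nth_bounded)
next
  case (3 k q)
  then show ?case by (auto intro!: wf_instr_update[simplified] nth_bounded)
next
  case (4 k q)
  then show ?case by (auto intro!: wf_instr_update[simplified] nth_bounded)
next
  case (5 k r q)
  then show ?case by (auto intro!: wf_instr_update[simplified] nth_bounded)
next
  case (6 k r q)
  then show ?case by (auto intro!: wf_instr_update[simplified] nth_bounded)
next
  case (7 k c d q)
  then show ?case by auto
next
  case (8 k b c q)
  have "regs c \<subseteq> {..<k}" using 8(3) by (cases b) auto
  with 8 have IH: "f \<in> set (code k c (q + 1)) \<Longrightarrow> wf_instr n k f" by simp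
  from 8(2) consider "f \<in> set (code k c (q + 1))"
    | "f = (\<lambda>ss. (if scan_holds b ss then q + 1 else q + com_size c + 2, stay ss))"
    | "f = (\<lambda>ss. (q, stay ss))"
    by auto
  then show ?case
    by cases (use IH 8(4) in \<open>auto simp: wf_instr_def stay_def\<close>)
qed

lemma wf_com_tm:
  assumes "regs c \<subseteq> {..<k}"
  shows "wf_tm (com_tm k c)"
proof -
  have "wf_instr (1 + com_size c) k (tm_trans (com_tm k c) q)" if "q < 1 + com_size c" for q
  proof (cases q)
    case 0
    then show ?thesis by (auto simp: com_tm_def wf_instr_def intro!: nth_bounded)
  next
    case (Suc q')
    with that have "tm_trans (com_tm k c) q \<in> set (code k c 1)" by (simp add: com_tm_def)
    then show ?thesis using assms wf_code by fastforce
  qed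
  then show ?thesis by (auto simp: wf_tm_def com_tm_def wf_instr_def)
qed

lemma polytime_computableI:
  fixes p :: "nat poly"
  assumes "\<And>x. \<exists>n \<le> poly p (length x). \<exists>h R. run x c (0, \<lambda>_. 0, []) n (h, R, f x)"
  shows "polytime_computable f"
proof -
  define k where "k = Suc (Max (insert 0 (regs c)))"
  have k: "regs c \<subseteq> {..<k}"
    using finite_regs[of c] by (auto simp: k_def less_Suc_eq_le)
  let ?M = "com_tm k c"
  \<comment> \<open>The additional step is the preamble.\<close>
  have "\<exists>t \<le> poly (p + 1) (length x). case (tm_step ?M ^^ t) (tm_start ?M x) of (q, ts) \<Rightarrow>
        q = tm_states ?M \<and> snd (last ts) = cells_of (f x)" for x
  proof -
    from assms obtain n h R where n: "n \<le> poly p (length x)"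
      "run x c (0, \<lambda>_. 0, []) n (h, R, f x)" by blast
    have "tm_step ?M (tm_start ?M x) = (1, tapes k x (0, \<lambda>_. 0, []))"
    proof -
      have start: "tm_start ?M x = (0, (0, cells_of x) # replicate k (0, cells_of []) @ [(0, cells_of [])])"
        by (simp add: tm_start_def com_tm_def replicate_append_same)
      have "map2 act_tape (replicate k (1, Stay)) (replicate k (0, cells_of []))
          = map (\<lambda>r. (int 0, (\<lambda>_. 0)(0 := 1))) [0..<k]"
        by (rule nth_equalityI) (auto simp: cells_of_def)
      then show ?thesis unfolding start
        by (simp add: com_tm_def nth_append cells_of_def fun_eq_iff)
    qed
    moreover have "(tm_step ?M ^^ n) (1, tapes k x (0, \<lambda>_. 0, []))
        = (1 + com_size c, tapes k x (h, R, f x))"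
      by (rule run_simulated[OF n(2) k]) (auto simp: com_tm_def)
    ultimately have "(tm_step ?M ^^ Suc n) (tm_start ?M x)
        = (1 + com_size c, tapes k x (h, R, f x))"
      by (simp only: funpow_Suc_right o_apply)
    with n(1) show ?thesis
      by (intro exI[of _ "Suc n"]) (auto simp: com_tm_def)
  qed
  then show ?thesis
    unfolding polytime_computable_def tm_computes_within_def
    using wf_com_tm[OF k] by blast
qed

section \<open>Arithmetic over binary strings\<close>

definition runs_in :: "bool list \<Rightarrow> com \<Rightarrow> state \<Rightarrow> nat \<Rightarrow> state \<Rightarrow> bool" where
  "runs_in x c s T s' \<longleftrightarrow> (\<exists>n \<le> T. run x c s n s')"

lemma runs_in_mono: "runs_in x c s T s' \<Longrightarrow> T \<le> T' \<Longrightarrow> runs_in x c s T' s'"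
  unfolding runs_in_def by (meson le_trans)

lemma runs_in_Seq:
  "runs_in x c s T s' \<Longrightarrow> runs_in x d s' U s'' \<Longrightarrow> runs_in x (c ;; d) s (T + U) s''"
  unfolding runs_in_def by (meson add_mono run_Seq)

lemma runs_in_Inc: "R' = R(r := R r + 1) \<Longrightarrow> runs_in x (Inc r) (h, R, out) 1 (h, R', out)"
  unfolding runs_in_def by (intro exI[of _ 1]) (simp add: run_Inc[simplified])

lemma runs_in_Dec: "R' = R(r := R r - 1) \<Longrightarrow> runs_in x (Dec r) (h, R, out) 1 (h, R', out)"
  unfolding runs_in_def by (intro exI[of _ 1]) (simp add: run_Dec[simplified])

lemma runs_in_In_Right: "runs_in x In_Right (h, R, out) 1 (Suc h, R, out)"
  unfolding runs_in_def by (intro exI[of _ 1]) (simp add: run_In_Right[simplified])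

lemma runs_in_In_Left: "runs_in x In_Left (Suc h, R, out) 1 (h, R, out)"
  unfolding runs_in_def by (intro exI[of _ 1]) (simp add: run_In_Left[simplified])

lemma runs_in_Inc_Bit:
  "R' = R(r := R r + of_bool (bit_at x h)) \<Longrightarrow> runs_in x (Inc_Bit r) (h, R, out) 1 (h, R', out)"
  unfolding runs_in_def by (intro exI[of _ 1]) (simp add: run_Inc_Bit[simplified])

lemma runs_in_Out: "out' = out @ [R r > 0] \<Longrightarrow> runs_in x (Out r) (h, R, out) 1 (h, R, out')"
  unfolding runs_in_def by (intro exI[of _ 1]) (simp add: run_Out[simplified])

lemma runs_in_While:
  assumes "\<And>i. i < n \<Longrightarrow> holds x b (S i)"
    and "\<And>i. i < n \<Longrightarrow> runs_in x c (S i) T (S (Suc i))"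
    and "\<not> holds x b (S n)"
  shows "runs_in x (While b c) (S 0) (n * (T + 2) + 1) (S n)"
  using assms
proof (induction n arbitrary: S)
  case 0
  then have "run x (While b c) (S 0) 1 (S 0)" by (intro run_While_False)
  then show ?case unfolding runs_in_def by auto
next
  case (Suc n)
  have "runs_in x (While b c) (S (Suc 0)) (n * (T + 2) + 1) (S (Suc n))"
    by (rule Suc.IH[of "\<lambda>i. S (Suc i)"]) (use Suc.prems in auto)
  then obtain k where k: "k \<le> n * (T + 2) + 1" "run x (While b c) (S (Suc 0)) k (S (Suc n))"
    unfolding runs_in_def by auto
  have "runs_in x c (S 0) T (S (Suc 0))" using Suc.prems by auto
  then obtain m where m: "m \<le> T" "run x c (S 0) m (S (Suc 0))"
    unfolding runs_in_def by auto
  have "run x (While b c) (S 0) (m + k + 2) (S (Suc n))"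
    by (rule run_While_True[OF _ m(2) k(2)]) (use Suc.prems in auto)
  moreover have "m + k + 2 \<le> Suc n * (T + 2) + 1" using m(1) k(1) by simp
  ultimately show ?case unfolding runs_in_def by (intro exI conjI)
qed

definition drain :: "nat \<Rightarrow> com \<Rightarrow> com" where
  "drain a c = While (Pos a) (Dec a ;; c)"

text \<open>A loop that uses up its counter \<open>a\<close>. The families \<open>h\<close>,
  \<open>R\<close> and \<open>out\<close> describe the state after \<open>i\<close> rounds;
  \<open>R i\<close> is overridden at \<open>a\<close>, so it may say anything there. A round costs
  the body and 3 steps for test, decrement and jump; the final 1 is the failing test.\<close>

lemma runs_in_drain:
  assumes "\<And>i. i < n \<Longrightarrow> runs_in x c (h i, (R i)(a := n - Suc i), out i) T
        (h (Suc i), (R (Suc i))(a := n - Suc i), out (Suc i))"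
    and "s = (h 0, (R 0)(a := n), out 0)" and "s' = (h n, (R n)(a := 0), out n)"
  shows "runs_in x (drain a c) s (n * (T + 3) + 1) s'"
proof -
  let ?S = "\<lambda>i. (h i, (R i)(a := n - i), out i)"
  have "runs_in x (While (Pos a) (Dec a ;; c)) (?S 0) (n * ((1 + T) + 2) + 1) (?S n)"
  proof (rule runs_in_While)
    fix i assume i: "i < n"
    show "holds x (Pos a) (?S i)" using i by simp
    have "runs_in x (Dec a) (?S i) 1 (h i, (R i)(a := n - Suc i), out i)"
      by (rule runs_in_Dec) auto
    then show "runs_in x (Dec a ;; c) (?S i) (1 + T) (?S (Suc i))"
      using assms(1)[OF i] by (rule runs_in_Seq)
  qed simp
  moreover have "n * ((1 + T) + 2) + 1 = n * (T + 3) + 1" by (simp add: algebra_simps)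
  moreover have "?S 0 = s" "?S n = s'" using assms(2,3) by auto
  ultimately show ?thesis unfolding drain_def by (simp only:)
qed

lemma runs_in_move:
  assumes "a \<noteq> b" "R a = n" "R' = R(a := 0, b := R b + n)"
  shows "runs_in x (drain a (Inc b)) (h, R, out) (n * 4 + 1) (h, R', out)"
proof -
  have "runs_in x (drain a (Inc b)) (h, R, out) (n * (1 + 3) + 1) (h, R', out)"
    by (rule runs_in_drain[where R = "\<lambda>i. R(b := R b + i)" and h = "\<lambda>_. h" and out = "\<lambda>_. out"])
      (use assms in \<open>auto intro!: runs_in_Inc[simplified] simp: fun_eq_iff\<close>)
  then show ?thesis by simp
qed

lemma runs_in_subtract:
  assumes "a \<noteq> b" "R a = n" "R' = R(a := 0, b := R b - n)"
  shows "runs_in x (drain a (Dec b)) (h, R, out) (n * 4 + 1) (h, R', out)"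
proof -
  have "runs_in x (drain a (Dec b)) (h, R, out) (n * (1 + 3) + 1) (h, R', out)"
    by (rule runs_in_drain[where R = "\<lambda>i. R(b := R b - i)" and h = "\<lambda>_. h" and out = "\<lambda>_. out"])
      (use assms in \<open>auto intro!: runs_in_Dec[simplified] simp: fun_eq_iff\<close>)
  then show ?thesis by simp
qed

lemma runs_in_rewind:
  assumes "R a = n" "R' = R(a := 0)"
  shows "runs_in x (drain a In_Left) (n, R, out) (n * 4 + 1) (0, R', out)"
proof -
  have "runs_in x (drain a In_Left) (n, R, out) (n * (1 + 3) + 1) (0, R', out)"
  proof (rule runs_in_drain[where R = "\<lambda>_. R" and h = "\<lambda>i. n - i" and out = "\<lambda>_. out"])
    fix i assume "i < n"
    then have "n - i = Suc (n - Suc i)" by simp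
    then show "runs_in x In_Left (n - i, R(a := n - Suc i), out) 1 (n - Suc i, R(a := n - Suc i), out)"
      using runs_in_In_Left by simp
  qed (use assms in auto)
  then show ?thesis by simp
qed

text \<open>Variables are de Bruijn indices, and \<open>Sum\<close> binds one in its second argument.\<close>

datatype expr = Const nat | V nat | Len | Bit expr | Add expr expr | Sub expr expr | Sum expr expr

fun ev :: "expr \<Rightarrow> bool list \<Rightarrow> (nat \<Rightarrow> nat) \<Rightarrow> nat" where
  "ev (Const c) x v = c"
| "ev (V i) x v = v i"
| "ev Len x v = length x"
| "ev (Bit e) x v = of_bool (bit_at x (ev e x v))"
| "ev (Add e f) x v = ev e x v + ev f x v"
| "ev (Sub e f) x v = ev e x v - ev f x v"
| "ev (Sum e f) x v = (\<Sum>i<ev e x v. ev f x (case_nat i v))"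

text \<open>
  Variable \<open>i\<close> is in register \<open>vs i\<close>, the result goes to \<open>d\<close>, and the registers from \<open>d\<close> on
  are 0, so that decrementing one of them does nothing.
\<close>

fun comp :: "expr \<Rightarrow> (nat \<Rightarrow> nat) \<Rightarrow> nat \<Rightarrow> com" where
  "comp (Const c) vs d = ((\<lambda>b. b ;; Inc d) ^^ c) (Dec d)"
| "comp (V i) vs d = drain (vs i) (Inc d ;; Inc (d + 1)) ;; drain (d + 1) (Inc (vs i))"
| "comp Len vs d =
    While Nonblank (In_Right ;; Inc d ;; Inc (d + 1)) ;; drain (d + 1) In_Left"
| "comp (Bit e) vs d = comp e vs (d + 1) ;; drain (d + 1) (Inc (d + 2) ;; In_Right) ;;
    Inc_Bit d ;; drain (d + 2) In_Left"
| "comp (Add e f) vs d = comp e vs d ;; comp f vs (d + 1) ;; drain (d + 1) (Inc d)"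
| "comp (Sub e f) vs d = comp e vs d ;; comp f vs (d + 1) ;; drain (d + 1) (Dec d)"
| "comp (Sum e f) vs d = comp e vs (d + 1) ;;
    drain (d + 1) (comp f (case_nat (d + 2) vs) (d + 3) ;; drain (d + 3) (Inc d) ;; Inc (d + 2)) ;;
    drain (d + 2) (Dec (d + 3))"

text \<open>\<open>N\<close> bounds the variables as well as the input, because an index of
  summation can exceed the length of the input. The input head returns to 0 and all registers but
  \<open>d\<close> are restored, so that the code of subexpressions can be chained.\<close>

definition comp_within :: "nat poly \<Rightarrow> expr \<Rightarrow> bool" where
  "comp_within p e \<longleftrightarrow> (\<forall>N x v. length x \<le> N \<longrightarrow> (\<forall>i. v i \<le> N) \<longrightarrow>
     ev e x v \<le> poly p N \<and>
     (\<forall>vs d R out. (\<forall>i. vs i < d \<and> R (vs i) = v i) \<longrightarrow> (\<forall>r \<ge> d. R r = 0) \<longrightarrow>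
        runs_in x (comp e vs d) (0, R, out) (poly p N) (0, R(d := ev e x v), out)))"

lemma comp_withinI:
  assumes "\<And>N x v. length x \<le> N \<Longrightarrow> (\<And>i. v i \<le> N) \<Longrightarrow> ev e x v \<le> poly p N"
    and "\<And>N x v vs d R out. length x \<le> N \<Longrightarrow> (\<And>i. v i \<le> N) \<Longrightarrow> (\<And>i. vs i < d) \<Longrightarrow>
      (\<And>i. R (vs i) = v i) \<Longrightarrow> (\<And>r. r \<ge> d \<Longrightarrow> R r = 0) \<Longrightarrow>
      \<exists>T \<le> poly p N. runs_in x (comp e vs d) (0, R, out) T (0, R(d := ev e x v), out)"
  shows "comp_within p e"
  unfolding comp_within_def
proof (intro allI impI conjI)
  fix N and x :: "bool list" and v :: "nat \<Rightarrow> nat"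
  assume N: "length x \<le> N" "\<forall>i. v i \<le> N"
  then show "ev e x v \<le> poly p N" by (intro assms(1)) auto
  fix vs R :: "nat \<Rightarrow> nat" and d :: nat and out :: "bool list"
  assume "\<forall>i. vs i < d \<and> R (vs i) = v i" "\<forall>r \<ge> d. R r = 0"
  with N have "\<exists>T \<le> poly p N. runs_in x (comp e vs d) (0, R, out) T (0, R(d := ev e x v), out)"
    by (intro assms(2)) auto
  then show "runs_in x (comp e vs d) (0, R, out) (poly p N) (0, R(d := ev e x v), out)"
    using runs_in_mono by blast
qed

lemma comp_within_value:
  "comp_within p e \<Longrightarrow> length x \<le> N \<Longrightarrow> (\<And>i. v i \<le> N) \<Longrightarrow> ev e x v \<le> poly p N"
  unfolding comp_within_def by simp

lemma comp_within_run:
  assumes "comp_within p e" "length x \<le> N" "\<And>i. v i \<le> N" "\<And>i. vs i < d" "\<And>i. R (vs i) = v i"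
    "\<And>r. r \<ge> d \<Longrightarrow> R r = 0" "R' = R(d := ev e x v)"
  shows "runs_in x (comp e vs d) (0, R, out) (poly p N) (0, R', out)"
  using assms unfolding comp_within_def by simp

section \<open>Polynomial bounds for each form of expression\<close>

lemma comp_within_Const: "comp_within [:2 * c + 1:] (Const c)"
proof (rule comp_withinI)
  fix N d :: nat and x out :: "bool list" and v vs R :: "nat \<Rightarrow> nat"
  assume "\<And>r. r \<ge> d \<Longrightarrow> R r = 0"
  then have d: "R d = 0" by simp
  have "runs_in x (comp (Const c) vs d) (0, R, out) (2 * c + 1) (0, R(d := c), out)"
  proof (induction c)
    case 0
    have "runs_in x (Dec d) (0, R, out) 1 (0, R(d := 0), out)"
      by (rule runs_in_Dec) (use d in simp)
    then show ?case by (simp only: comp.simps funpow.simps id_apply mult_0_right add_0)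
  next
    case (Suc c)
    have inc: "runs_in x (Inc d) (0, R(d := c), out) 1 (0, R(d := Suc c), out)"
      by (rule runs_in_Inc) simp
    have eq: "comp (Const (Suc c)) vs d = comp (Const c) vs d ;; Inc d" by simp
    show ?case unfolding eq by (rule runs_in_mono[OF runs_in_Seq[OF Suc inc]]) simp
  qed
  then show "\<exists>T \<le> poly [:2 * c + 1:] N.
      runs_in x (comp (Const c) vs d) (0, R, out) T (0, R(d := ev (Const c) x v), out)"
    by auto
qed simp

text \<open>Reading a register by \<open>drain\<close> destroys it. So its value goes to both
  \<open>d\<close> and \<open>d + 1\<close> and is moved back from \<open>d + 1\<close>; the costs
  \<open>5 * v i + 1\<close> and \<open>4 * v i + 1\<close> give the polynomial.\<close>

lemma comp_within_V: "comp_within [:2, 9:] (V i)"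
proof (rule comp_withinI)
  fix N d :: nat and x out :: "bool list" and v vs R :: "nat \<Rightarrow> nat"
  assume N: "length x \<le> N" "\<And>i. v i \<le> N" and vs: "\<And>i. vs i < d" "\<And>i. R (vs i) = v i"
    and R: "\<And>r. r \<ge> d \<Longrightarrow> R r = 0"
  let ?R = "R(vs i := 0, d := v i, d + 1 := v i)"
  have ne: "vs i \<noteq> d" "vs i \<noteq> Suc d" using vs(1)[of i] by auto
  have "runs_in x (drain (vs i) (Inc d ;; Inc (d + 1))) (0, R, out) (v i * ((1 + 1) + 3) + 1) (0, ?R, out)"
  proof (rule runs_in_drain[where R = "\<lambda>j. R(d := j, d + 1 := j)" and h = "\<lambda>_. 0" and out = "\<lambda>_. out"])
    fix j
    let ?Q = "\<lambda>j. (R(d := j, d + 1 := j))(vs i := v i - Suc j)"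
    show "runs_in x (Inc d ;; Inc (d + 1)) (0, ?Q j, out) (1 + 1)
        (0, (R(d := Suc j, d + 1 := Suc j))(vs i := v i - Suc j), out)"
      by (rule runs_in_Seq[OF runs_in_Inc[OF refl] runs_in_Inc]) (use ne in \<open>auto simp: fun_eq_iff\<close>)
  qed (use ne vs R in \<open>auto simp: fun_eq_iff\<close>)
  moreover have "runs_in x (drain (d + 1) (Inc (vs i))) (0, ?R, out) (v i * 4 + 1) (0, R(d := v i), out)"
    by (rule runs_in_move) (use ne vs R in \<open>auto simp: fun_eq_iff\<close>)
  ultimately have "runs_in x (comp (V i) vs d) (0, R, out) (v i * ((1 + 1) + 3) + 1 + (v i * 4 + 1))
      (0, R(d := v i), out)"
    unfolding comp.simps by (rule runs_in_Seq)
  moreover have "v i * ((1 + 1) + 3) + 1 + (v i * 4 + 1) \<le> poly [:2, 9:] N"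
    using N(2)[of i] by simp
  ultimately show "\<exists>T \<le> poly [:2, 9:] N.
      runs_in x (comp (V i) vs d) (0, R, out) T (0, R(d := ev (V i) x v), out)"
    unfolding ev.simps by blast
next
  fix N and x :: "bool list" and v :: "nat \<Rightarrow> nat"
  assume N: "length x \<le> N" "\<And>i. v i \<le> N"
  show "ev (V i) x v \<le> poly [:2, 9:] N" using N(2)[of i] by simp
qed

lemma comp_within_Len: "comp_within [:2, 9:] Len"
proof (rule comp_withinI)
  fix N d :: nat and x out :: "bool list" and v vs R :: "nat \<Rightarrow> nat"
  assume N: "length x \<le> N" and R: "\<And>r. r \<ge> d \<Longrightarrow> R r = 0"
  let ?n = "length x"
  let ?S = "\<lambda>j. (j, R(d := j, d + 1 := j), out)"
  have "runs_in x (While Nonblank (In_Right ;; Inc d ;; Inc (d + 1))) (?S 0) (?n * ((1 + (1 + 1)) + 2) + 1)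
      (?S ?n)"
  proof (rule runs_in_While)
    fix j
    show "runs_in x (In_Right ;; Inc d ;; Inc (d + 1)) (?S j) (1 + (1 + 1)) (?S (Suc j))"
      by (rule runs_in_Seq[OF runs_in_In_Right runs_in_Seq[OF runs_in_Inc[OF refl] runs_in_Inc]])
        (auto simp: fun_eq_iff)
  qed auto
  moreover have "?S 0 = (0, R, out)" using R by (auto simp: fun_eq_iff)
  moreover have "runs_in x (drain (d + 1) In_Left) (?S ?n) (?n * 4 + 1) (0, R(d := ?n), out)"
    by (rule runs_in_rewind) (use R in \<open>auto simp: fun_eq_iff\<close>)
  ultimately have "runs_in x (comp Len vs d) (0, R, out) (?n * ((1 + (1 + 1)) + 2) + 1 + (?n * 4 + 1))
      (0, R(d := ?n), out)"
    unfolding comp.simps by (metis runs_in_Seq)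
  moreover have "?n * ((1 + (1 + 1)) + 2) + 1 + (?n * 4 + 1) \<le> poly [:2, 9:] N"
    using N by simp
  ultimately show "\<exists>T \<le> poly [:2, 9:] N.
      runs_in x (comp Len vs d) (0, R, out) T (0, R(d := ev Len x v), out)"
    unfolding ev.simps by blast
qed simp

text \<open>The value \<open>n\<close> of \<open>e\<close> drives the head to cell \<open>n\<close>,
  while register \<open>d + 2\<close> keeps a copy for the way back. This takes
  \<open>9 * n + 3\<close> steps besides the evaluation of \<open>e\<close>, and \<open>p\<close>
  bounds \<open>n\<close> too.\<close>

lemma comp_within_Bit:
  assumes e: "comp_within p e"
  shows "comp_within (p * 10 + 3) (Bit e)"
proof (rule comp_withinI)
  fix N d :: nat and x out :: "bool list" and v vs R :: "nat \<Rightarrow> nat"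
  assume N: "length x \<le> N" "\<And>i. v i \<le> N" and vs: "\<And>i. vs i < d" "\<And>i. R (vs i) = v i"
    and R: "\<And>r. r \<ge> d \<Longrightarrow> R r = 0"
  define n where "n = ev e x v"
  let ?b = "of_bool (bit_at x n)"
  have n: "n \<le> poly p N" using comp_within_value[OF e N] by (simp add: n_def)
  have "runs_in x (comp e vs (d + 1)) (0, R, out) (poly p N) (0, R(d + 1 := n), out)"
    by (rule comp_within_run[OF e N]) (use vs less_SucI[OF vs(1)] R in \<open>auto simp: n_def\<close>)
  moreover have "runs_in x (drain (d + 1) (Inc (d + 2) ;; In_Right)) (0, R(d + 1 := n), out)
      (n * ((1 + 1) + 3) + 1) (n, R(d + 2 := n), out)"
  proof (rule runs_in_drain[where R = "\<lambda>j. R(d + 2 := j)" and h = "\<lambda>j. j" and out = "\<lambda>_. out"])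
    fix j
    show "runs_in x (Inc (d + 2) ;; In_Right) (j, (R(d + 2 := j))(d + 1 := n - Suc j), out) (1 + 1)
      (Suc j, (R(d + 2 := Suc j))(d + 1 := n - Suc j), out)"
      by (rule runs_in_Seq[OF runs_in_Inc runs_in_In_Right]) (auto simp: fun_eq_iff)
  qed (use R in \<open>auto simp: fun_eq_iff\<close>)
  moreover have "runs_in x (Inc_Bit d) (n, R(d + 2 := n), out) 1 (n, R(d + 2 := n, d := ?b), out)"
    by (rule runs_in_Inc_Bit) (use R in \<open>auto simp: fun_eq_iff\<close>)
  moreover have "runs_in x (drain (d + 2) In_Left) (n, R(d + 2 := n, d := ?b), out) (n * 4 + 1)
      (0, R(d := ?b), out)"
    by (rule runs_in_rewind) (use R in \<open>auto simp: fun_eq_iff\<close>)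
  ultimately have "runs_in x (comp (Bit e) vs d) (0, R, out)
      (poly p N + (n * ((1 + 1) + 3) + 1 + (1 + (n * 4 + 1)))) (0, R(d := ?b), out)"
    unfolding comp.simps by (elim runs_in_Seq)
  moreover have "poly p N + (n * ((1 + 1) + 3) + 1 + (1 + (n * 4 + 1))) \<le> poly (p * 10 + 3) N"
    using n by simp
  ultimately show "\<exists>T \<le> poly (p * 10 + 3) N.
      runs_in x (comp (Bit e) vs d) (0, R, out) T (0, R(d := ev (Bit e) x v), out)"
    unfolding ev.simps n_def by blast
qed simp

lemma comp_within_Add:
  assumes e: "comp_within p e" and f: "comp_within q f"
  shows "comp_within (p + q * 5 + 1) (Add e f)"
proof (rule comp_withinI)
  fix N d :: nat and x out :: "bool list" and v vs R :: "nat \<Rightarrow> nat"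
  assume N: "length x \<le> N" "\<And>i. v i \<le> N" and vs: "\<And>i. vs i < d" "\<And>i. R (vs i) = v i"
    and R: "\<And>r. r \<ge> d \<Longrightarrow> R r = 0"
  let ?m = "ev e x v" and ?n = "ev f x v"
  have n: "?n \<le> poly q N" using comp_within_value[OF f N] .
  have ne: "vs i \<noteq> d" "vs i < Suc d" for i using vs(1)[of i] by auto
  have "runs_in x (comp e vs d) (0, R, out) (poly p N) (0, R(d := ?m), out)"
    by (rule comp_within_run[OF e N]) (use vs R in auto)
  moreover have "runs_in x (comp f vs (d + 1)) (0, R(d := ?m), out) (poly q N)
      (0, R(d := ?m, d + 1 := ?n), out)"
    by (rule comp_within_run[OF f N]) (use vs R ne in auto)
  moreover have "runs_in x (drain (d + 1) (Inc d)) (0, R(d := ?m, d + 1 := ?n), out) (?n * 4 + 1)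
      (0, R(d := ?m + ?n), out)"
    by (rule runs_in_move) (use R in \<open>auto simp: fun_eq_iff\<close>)
  ultimately have "runs_in x (comp (Add e f) vs d) (0, R, out)
      (poly p N + (poly q N + (?n * 4 + 1))) (0, R(d := ?m + ?n), out)"
    unfolding comp.simps by (elim runs_in_Seq)
  moreover have "poly p N + (poly q N + (?n * 4 + 1)) \<le> poly (p + q * 5 + 1) N"
    using n by simp
  ultimately show "\<exists>T \<le> poly (p + q * 5 + 1) N.
      runs_in x (comp (Add e f) vs d) (0, R, out) T (0, R(d := ev (Add e f) x v), out)"
    unfolding ev.simps by blast
next
  fix N and x :: "bool list" and v :: "nat \<Rightarrow> nat"
  assume N: "length x \<le> N" "\<And>i. v i \<le> N"
  show "ev (Add e f) x v \<le> poly (p + q * 5 + 1) N"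
    using comp_within_value[OF e N(1), of v, OF N(2)] comp_within_value[OF f N(1), of v, OF N(2)] by simp
qed

lemma comp_within_Sub:
  assumes e: "comp_within p e" and f: "comp_within q f"
  shows "comp_within (p + q * 5 + 1) (Sub e f)"
proof (rule comp_withinI)
  fix N d :: nat and x out :: "bool list" and v vs R :: "nat \<Rightarrow> nat"
  assume N: "length x \<le> N" "\<And>i. v i \<le> N" and vs: "\<And>i. vs i < d" "\<And>i. R (vs i) = v i"
    and R: "\<And>r. r \<ge> d \<Longrightarrow> R r = 0"
  let ?m = "ev e x v" and ?n = "ev f x v"
  have n: "?n \<le> poly q N" using comp_within_value[OF f N] .
  have ne: "vs i \<noteq> d" "vs i < Suc d" for i using vs(1)[of i] by auto
  have "runs_in x (comp e vs d) (0, R, out) (poly p N) (0, R(d := ?m), out)"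
    by (rule comp_within_run[OF e N]) (use vs R in auto)
  moreover have "runs_in x (comp f vs (d + 1)) (0, R(d := ?m), out) (poly q N)
      (0, R(d := ?m, d + 1 := ?n), out)"
    by (rule comp_within_run[OF f N]) (use vs R ne in auto)
  moreover have "runs_in x (drain (d + 1) (Dec d)) (0, R(d := ?m, d + 1 := ?n), out) (?n * 4 + 1)
      (0, R(d := ?m - ?n), out)"
    by (rule runs_in_subtract) (use R in \<open>auto simp: fun_eq_iff\<close>)
  ultimately have "runs_in x (comp (Sub e f) vs d) (0, R, out)
      (poly p N + (poly q N + (?n * 4 + 1))) (0, R(d := ?m - ?n), out)"
    unfolding comp.simps by (elim runs_in_Seq)
  moreover have "poly p N + (poly q N + (?n * 4 + 1)) \<le> poly (p + q * 5 + 1) N"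
    using n by simp
  ultimately show "\<exists>T \<le> poly (p + q * 5 + 1) N.
      runs_in x (comp (Sub e f) vs d) (0, R, out) T (0, R(d := ev (Sub e f) x v), out)"
    unfolding ev.simps by blast
next
  fix N and x :: "bool list" and v :: "nat \<Rightarrow> nat"
  assume N: "length x \<le> N" "\<And>i. v i \<le> N"
  show "ev (Sub e f) x v \<le> poly (p + q * 5 + 1) N"
    using comp_within_value[OF e N(1), of v, OF N(2)] by simp
qed

text \<open>Inside the sum the index is below \<open>poly p N\<close>, so the variables are bounded
  by \<open>poly p N + N\<close>; hence the composition. With \<open>F\<close> for the resulting
  bound on the body, the total is \<open>poly p N + n * (5 * F + 9) + 2\<close>.\<close>

lemma comp_within_Sum:
  assumes e: "comp_within p e" and f: "comp_within q f"
  shows "comp_within (p * (5 * (q \<circ>\<^sub>p (p + [:0, 1:])) + 10) + 2) (Sum e f)" (is "comp_within ?p _")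
proof (rule comp_withinI)
  fix N d :: nat and x out :: "bool list" and v vs R :: "nat \<Rightarrow> nat"
  assume N: "length x \<le> N" "\<And>i. v i \<le> N" and vs: "\<And>i. vs i < d" "\<And>i. R (vs i) = v i"
    and R: "\<And>r. r \<ge> d \<Longrightarrow> R r = 0"
  define n where "n = ev e x v"
  define g where "g = (\<lambda>i. ev f x (case_nat i v))"
  define F where "F = poly q (poly p N + N)"
  have n: "n \<le> poly p N" using comp_within_value[OF e N] by (simp add: n_def)
  have v: "case_nat i v j \<le> poly p N + N" if "i < n" for i j
    using that n N(2) by (auto split: nat.split intro: le_add2[THEN le_trans[rotated]])
  have x: "length x \<le> poly p N + N" using N by simp
  have g: "g i \<le> F" if "i < n" for i
    using comp_within_value[OF f x v] that by (auto simp: g_def F_def)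
  have vs': "vs i < Suc d" "vs i < Suc (Suc d)" "vs i < Suc (Suc (Suc d))"
    "vs i \<noteq> d" "vs i \<noteq> Suc d" "vs i \<noteq> Suc (Suc d)" for i
    using vs(1)[of i] by auto
  let ?R = "\<lambda>i. R(d := (\<Sum>j<i. g j), d + 2 := i)"
  have 1: "runs_in x (comp e vs (d + 1)) (0, R, out) (poly p N) (0, R(d + 1 := n), out)"
    by (rule comp_within_run[OF e N]) (use vs vs' R in \<open>auto simp: n_def\<close>)
  \<comment> \<open>Register \<open>d\<close> holds the partial sum, \<open>d + 1\<close> counts
    down, \<open>d + 2\<close> is the index and \<open>d + 3\<close> the current summand.\<close>
  let ?body = "comp f (case_nat (d + 2) vs) (d + 3) ;; drain (d + 3) (Inc d) ;; Inc (d + 2)"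
  have 2: "runs_in x (drain (d + 1) ?body) (0, R(d + 1 := n), out)
    (n * ((F + (F * 4 + 1 + 1)) + 3) + 1) (0, ?R n, out)"
  proof (rule runs_in_drain[where R = ?R and h = "\<lambda>_. 0" and out = "\<lambda>_. out"])
    fix i assume i: "i < n"
    let ?Q = "(?R i)(d + 1 := n - Suc i)"
    have "runs_in x (comp f (case_nat (d + 2) vs) (d + 3)) (0, ?Q, out) F (0, ?Q(d + 3 := g i), out)"
      unfolding F_def
      by (rule comp_within_run[OF f x v[OF i]])
        (use vs vs' R in \<open>auto simp: g_def numeral_3_eq_3 split: nat.split\<close>)
    moreover have "runs_in x (drain (d + 3) (Inc d)) (0, ?Q(d + 3 := g i), out) (F * 4 + 1)
      (0, ?Q(d := (\<Sum>j<Suc i. g j)), out)"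
      by (rule runs_in_mono[OF runs_in_move]) (use R g[OF i] in \<open>auto simp: fun_eq_iff\<close>)
    moreover have "runs_in x (Inc (d + 2)) (0, ?Q(d := (\<Sum>j<Suc i. g j)), out) 1
      (0, (?R (Suc i))(d + 1 := n - Suc i), out)"
      by (rule runs_in_Inc) (auto simp: fun_eq_iff)
    ultimately show "runs_in x ?body (0, ?Q, out) (F + (F * 4 + 1 + 1))
      (0, (?R (Suc i))(d + 1 := n - Suc i), out)"
      by (elim runs_in_Seq)
  qed (use R in \<open>auto simp: fun_eq_iff\<close>)
  \<comment> \<open>The index register is cleared by a loop whose body does nothing:
    \<open>d + 3\<close> is 0 and stays 0.\<close>
  have 3: "runs_in x (drain (d + 2) (Dec (d + 3))) (0, ?R n, out) (n * 4 + 1)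
      (0, R(d := (\<Sum>j<n. g j)), out)"
    by (rule runs_in_subtract) (use R in \<open>auto simp: fun_eq_iff\<close>)
  let ?T = "poly p N + (n * ((F + (F * 4 + 1 + 1)) + 3) + 1 + (n * 4 + 1))"
  have "runs_in x (comp (Sum e f) vs d) (0, R, out) ?T (0, R(d := (\<Sum>j<n. g j)), out)"
    unfolding comp.simps by (rule runs_in_Seq[OF 1 runs_in_Seq[OF 2 3]])
  moreover have "?T \<le> poly ?p N"
  proof -
    have "?T = poly p N + n * (5 * F + 9) + 2" by (simp add: algebra_simps)
    also have "\<dots> \<le> poly p N + poly p N * (5 * F + 9) + 2" using n by simp
    also have "\<dots> = poly ?p N" by (simp add: F_def poly_pcompose algebra_simps)
    finally show ?thesis .
  qed
  moreover have "ev (Sum e f) x v = (\<Sum>j<n. g j)" by (simp add: n_def g_def)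
  ultimately show "\<exists>T \<le> poly ?p N.
      runs_in x (comp (Sum e f) vs d) (0, R, out) T (0, R(d := ev (Sum e f) x v), out)"
    by metis
next
  fix N and x :: "bool list" and v :: "nat \<Rightarrow> nat"
  assume N: "length x \<le> N" "\<And>i. v i \<le> N"
  define n where "n = ev e x v"
  define F where "F = poly q (poly p N + N)"
  have n: "n \<le> poly p N" using comp_within_value[OF e N] by (simp add: n_def)
  have "ev f x (case_nat i v) \<le> F" if "i < n" for i
    unfolding F_def
    by (rule comp_within_value[OF f])
      (use that n N in \<open>auto split: nat.split intro: le_add2[THEN le_trans[rotated]]\<close>)
  then have "(\<Sum>i<n. ev f x (case_nat i v)) \<le> n * F"
    using sum_bounded_above[of "{..<n}" _ F] by simp
  also have "\<dots> \<le> poly p N * F" using n by simp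
  also have "\<dots> \<le> poly ?p N" by (simp add: F_def poly_pcompose algebra_simps)
  finally show "ev (Sum e f) x v \<le> poly ?p N" by (simp add: n_def)
qed

lemma comp_within_exists: "\<exists>p. comp_within p e"
proof (induction e)
qed (blast intro: comp_within_Const comp_within_V comp_within_Len comp_within_Bit comp_within_Add
  comp_within_Sub comp_within_Sum)+

text \<open>The same loop as for a sum, printing each value instead of adding it, so the polynomial
  for \<open>Sum\<close> serves again. Register 0 holds 0 and supplies the value of all variables
  but the output position.\<close>

theorem polytime_computable_ev:
  "polytime_computable (\<lambda>x. map (\<lambda>i. ev g x (case_nat i (\<lambda>_. 0)) > 0) [0..<ev l x (\<lambda>_. 0)])"
proof -
  obtain p q where p: "comp_within p l" and q: "comp_within q g"
    using comp_within_exists by metis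
  let ?P = "p * (5 * (q \<circ>\<^sub>p (p + [:0, 1:])) + 10) + 2"
  let ?body = "comp g (case_nat 2 (\<lambda>_. 0)) 3 ;; Out 3 ;; drain 3 (Dec 4) ;; Inc 2"
  let ?c = "comp l (\<lambda>_. 0) 1 ;; drain 1 ?body"
  show ?thesis
  proof (rule polytime_computableI)
    fix x :: "bool list"
    define N where "N = length x"
    define n where "n = ev l x (\<lambda>_. 0)"
    define b where "b = (\<lambda>i. ev g x (case_nat i (\<lambda>_. 0)))"
    define F where "F = poly q (poly p N + N)"
    have n: "n \<le> poly p N"
      using comp_within_value[OF p, of x N "\<lambda>_. 0"] by (simp add: n_def N_def)
    have v: "case_nat i (\<lambda>_. 0) j \<le> poly p N + N" if "i < n" for i j
      using that n by (auto split: nat.split)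
    have x: "length x \<le> poly p N + N" by (simp add: N_def)
    have b: "b i \<le> F" if "i < n" for i
      using comp_within_value[OF q x v] that by (auto simp: b_def F_def)
    let ?R = "\<lambda>i. (\<lambda>_. 0)(2 := i)" and ?out = "\<lambda>i. map (\<lambda>i. b i > 0) [0..<i]"
    have 1: "runs_in x (comp l (\<lambda>_. 0) 1) (0, \<lambda>_. 0, []) (poly p N) (0, (\<lambda>_. 0)(1 := n), [])"
      by (rule comp_within_run[OF p]) (auto simp: n_def N_def)
    have 2: "runs_in x (drain 1 ?body) (0, (\<lambda>_. 0)(1 := n), []) (n * ((F + (1 + (F * 4 + 1 + 1))) + 3) + 1)
      (0, ?R n, ?out n)"
    proof (rule runs_in_drain[where R = ?R and h = "\<lambda>_. 0" and out = ?out])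
      fix i assume i: "i < n"
      let ?Q = "(?R i)(1 := n - Suc i)"
      have "runs_in x (comp g (case_nat 2 (\<lambda>_. 0)) 3) (0, ?Q, ?out i) F (0, ?Q(3 := b i), ?out i)"
        unfolding F_def
        by (rule comp_within_run[OF q x v[OF i]]) (auto simp: b_def split: nat.split)
      moreover have "runs_in x (Out 3) (0, ?Q(3 := b i), ?out i) 1 (0, ?Q(3 := b i), ?out (Suc i))"
        by (rule runs_in_Out) auto
      moreover have "runs_in x (drain 3 (Dec 4)) (0, ?Q(3 := b i), ?out (Suc i)) (F * 4 + 1)
        (0, ?Q, ?out (Suc i))"
        by (rule runs_in_mono[OF runs_in_subtract]) (use b[OF i] in \<open>auto simp: fun_eq_iff\<close>)
      moreover have "runs_in x (Inc 2) (0, ?Q, ?out (Suc i)) 1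
          (0, (?R (Suc i))(1 := n - Suc i), ?out (Suc i))"
        by (rule runs_in_Inc) (auto simp: fun_eq_iff)
      ultimately show "runs_in x ?body (0, ?Q, ?out i) (F + (1 + (F * 4 + 1 + 1)))
          (0, (?R (Suc i))(1 := n - Suc i), ?out (Suc i))"
        by (elim runs_in_Seq)
    qed (auto simp: fun_eq_iff)
    let ?T = "poly p N + (n * ((F + (1 + (F * 4 + 1 + 1))) + 3) + 1)"
    have "?T = poly p N + n * (5 * F + 6) + 1" by (simp add: algebra_simps)
    also have "\<dots> \<le> poly p N + poly p N * (5 * F + 6) + 1" using n by simp
    also have "\<dots> \<le> poly ?P N" by (simp add: F_def poly_pcompose algebra_simps)
    finally show "\<exists>n \<le> poly ?P (length x). \<exists>h R. run x ?c (0, \<lambda>_. 0, []) n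
        (h, R, map (\<lambda>i. ev g x (case_nat i (\<lambda>_. 0)) > 0) [0..<ev l x (\<lambda>_. 0)])"
      using runs_in_mono[OF runs_in_Seq[OF 1 2]]
      unfolding runs_in_def n_def[symmetric] N_def[symmetric] b_def by blast
  qed
qed

text \<open>Expressions are represented by what they compute, so that the rules
  \<open>definable_intros\<close> can analyse HOL terms directly and no expression has to be written
  down. The valuation \<open>v\<close> keeps track of bound variables.\<close>

definition definable :: "(bool list \<Rightarrow> (nat \<Rightarrow> nat) \<Rightarrow> nat) \<Rightarrow> bool" where
  "definable F \<longleftrightarrow> (\<exists>e. \<forall>x v. ev e x v = F x v)"

definition decidable :: "(bool list \<Rightarrow> (nat \<Rightarrow> nat) \<Rightarrow> bool) \<Rightarrow> bool" where
  "decidable P \<longleftrightarrow> definable (\<lambda>x v. of_bool (P x v))"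

named_theorems definable_intros

theorem polytime_computable_definable:
  assumes "definable (\<lambda>x v. l x)" "decidable (\<lambda>x v. P x (v 0))"
  shows "polytime_computable (\<lambda>x. map (P x) [0..<l x])"
proof -
  obtain e g where "\<And>x v. ev e x v = l x" "\<And>x v. ev g x v = of_bool (P x (v 0))"
    using assms unfolding decidable_def definable_def by auto
  then show ?thesis using polytime_computable_ev[of g e] by (simp cong: map_cong)
qed

section \<open>Closure properties of definable functions and predicates\<close>

fun ren :: "(nat \<Rightarrow> nat) \<Rightarrow> expr \<Rightarrow> expr" where
  "ren f (Const c) = Const c"
| "ren f (V i) = V (f i)"
| "ren f Len = Len"
| "ren f (Bit e) = Bit (ren f e)"
| "ren f (Add a b) = Add (ren f a) (ren f b)"
| "ren f (Sub a b) = Sub (ren f a) (ren f b)"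
| "ren f (Sum a b) = Sum (ren f a) (ren (case_nat 0 (\<lambda>i. Suc (f i))) b)"

lemma ev_ren: "ev (ren f e) x v = ev e x (\<lambda>i. v (f i))"
proof (induction e arbitrary: f v)
  case (Sum a b)
  have "(\<lambda>i. case_nat j v (case_nat 0 (\<lambda>i. Suc (f i)) i)) = case_nat j (\<lambda>i. v (f i))" for j
    by (auto simp: fun_eq_iff split: nat.split)
  then show ?case using Sum by simp
qed auto

lemma definable_weaken: "definable F \<Longrightarrow> definable (\<lambda>x v. F x (\<lambda>i. v (Suc i)))"
proof -
  assume "definable F"
  then obtain e where "\<And>x v. ev e x v = F x v" unfolding definable_def by auto
  then show ?thesis unfolding definable_def by (intro exI[of _ "ren Suc e"]) (simp add: ev_ren)
qed

lemma definable_const [definable_intros]: "definable (\<lambda>x v. c)"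
  unfolding definable_def by (intro exI[of _ "Const c"]) simp

lemma definable_var [definable_intros]: "definable (\<lambda>x v. v i)"
  unfolding definable_def by (intro exI[of _ "V i"]) simp

lemma definable_length [definable_intros]: "definable (\<lambda>x v. length x)"
  unfolding definable_def by (intro exI[of _ Len]) simp

lemma decidable_bit_at [definable_intros]: "definable F \<Longrightarrow> decidable (\<lambda>x v. bit_at x (F x v))"
proof -
  assume "definable F"
  then obtain e where "\<And>x v. ev e x v = F x v" unfolding definable_def by auto
  then show ?thesis unfolding decidable_def definable_def by (intro exI[of _ "Bit e"]) simp
qed

lemma definable_add [definable_intros]: "definable F \<Longrightarrow> definable G \<Longrightarrow> definable (\<lambda>x v. F x v + G x v)"
proof -
  assume "definable F" "definable G"
  then obtain e g where "\<And>x v. ev e x v = F x v" "\<And>x v. ev g x v = G x v"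
    unfolding definable_def by auto
  then show ?thesis unfolding definable_def by (intro exI[of _ "Add e g"]) simp
qed

lemma definable_diff [definable_intros]: "definable F \<Longrightarrow> definable G \<Longrightarrow> definable (\<lambda>x v. F x v - G x v)"
proof -
  assume "definable F" "definable G"
  then obtain e g where "\<And>x v. ev e x v = F x v" "\<And>x v. ev g x v = G x v"
    unfolding definable_def by auto
  then show ?thesis unfolding definable_def by (intro exI[of _ "Sub e g"]) simp
qed

lemma definable_Suc [definable_intros]: "definable F \<Longrightarrow> definable (\<lambda>x v. Suc (F x v))"
  using definable_add[OF _ definable_const[of 1]] by simp

text \<open>Under the binder the old variables are shifted by one and the new one is
  \<open>v 0\<close>. The second premise is phrased so that resolution performs this shift in the
  body.\<close>

lemma definable_sum [definable_intros]:
  assumes "definable B" "definable (\<lambda>x v. F x (\<lambda>i. v (Suc i)) (v 0))"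
  shows "definable (\<lambda>x v. \<Sum>i<B x v. F x v i)"
proof -
  obtain b f where "\<And>x v. ev b x v = B x v" "\<And>x v. ev f x v = F x (\<lambda>i. v (Suc i)) (v 0)"
    using assms unfolding definable_def by auto
  then have "ev (Sum b f) x v = (\<Sum>i<B x v. F x v i)" for x v by simp
  then show ?thesis unfolding definable_def by blast
qed

lemma definable_mult [definable_intros]:
  assumes "definable F" "definable G"
  shows "definable (\<lambda>x v. F x v * G x v)"
  using definable_sum[OF assms(1) definable_weaken[OF assms(2)]] by simp

lemma definable_of_bool [definable_intros]: "decidable P \<Longrightarrow> definable (\<lambda>x v. of_bool (P x v))"
  by (simp add: decidable_def)

lemma decidable_const [definable_intros]: "decidable (\<lambda>x v. P)"
  unfolding decidable_def by (rule definable_const)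

lemma decidable_pos: "definable F \<Longrightarrow> decidable (\<lambda>x v. F x v > 0)"
proof -
  assume "definable F"
  then have "definable (\<lambda>x v. 1 - (1 - F x v))" by (intro definable_intros)
  moreover have "1 - (1 - n) = of_bool (n > 0)" for n :: nat by simp
  ultimately show ?thesis by (simp add: decidable_def)
qed

lemma decidable_not [definable_intros]: "decidable P \<Longrightarrow> decidable (\<lambda>x v. \<not> P x v)"
proof -
  assume "decidable P"
  then have "definable (\<lambda>x v. 1 - of_bool (P x v))" by (intro definable_intros)
  moreover have "1 - of_bool p = (of_bool (\<not> p) :: nat)" for p by simp
  ultimately show ?thesis by (simp add: decidable_def)
qed

lemma decidable_conj [definable_intros]: "decidable P \<Longrightarrow> decidable Q \<Longrightarrow> decidable (\<lambda>x v. P x v \<and> Q x v)"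
  unfolding decidable_def of_bool_conj by (rule definable_mult)

lemma decidable_disj [definable_intros]:
  assumes "decidable P" "decidable Q"
  shows "decidable (\<lambda>x v. P x v \<or> Q x v)"
  using decidable_not[OF decidable_conj[OF decidable_not[OF assms(1)] decidable_not[OF assms(2)]]] by simp

lemma decidable_imp [definable_intros]:
  assumes "decidable P" "decidable Q"
  shows "decidable (\<lambda>x v. P x v \<longrightarrow> Q x v)"
  using decidable_disj[OF decidable_not[OF assms(1)] assms(2)] by simp

lemma decidable_iff [definable_intros]:
  assumes "decidable P" "decidable Q"
  shows "decidable (\<lambda>x v. P x v \<longleftrightarrow> Q x v)"
proof -
  have "decidable (\<lambda>x v. (P x v \<longrightarrow> Q x v) \<and> (Q x v \<longrightarrow> P x v))"
    using assms by (intro definable_intros)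
  moreover have "((p \<longrightarrow> q) \<and> (q \<longrightarrow> p)) = (p \<longleftrightarrow> q)" for p q by blast
  ultimately show ?thesis by (simp only:)
qed

lemma decidable_less [definable_intros]: "definable F \<Longrightarrow> definable G \<Longrightarrow> decidable (\<lambda>x v. F x v < G x v)"
  using decidable_pos[OF definable_diff[of G F]] by simp

lemma decidable_le [definable_intros]: "definable F \<Longrightarrow> definable G \<Longrightarrow> decidable (\<lambda>x v. F x v \<le> G x v)"
  using decidable_not[OF decidable_less[of G F]] by (simp add: not_less)

lemma decidable_eq [definable_intros]:
  assumes "definable F" "definable G"
  shows "decidable (\<lambda>x v. F x v = G x v)"
proof -
  have "decidable (\<lambda>x v. F x v \<le> G x v \<and> G x v \<le> F x v)"
    using assms by (intro definable_intros)
  moreover have "(m \<le> n \<and> n \<le> m) = (m = n)" for m n :: nat by auto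
  ultimately show ?thesis by (simp only:)
qed

lemma decidable_ex [definable_intros]:
  assumes "definable B" "decidable (\<lambda>x v. P x (\<lambda>i. v (Suc i)) (v 0))"
  shows "decidable (\<lambda>x v. \<exists>i<B x v. P x v i)"
proof -
  have "decidable (\<lambda>x v. (\<Sum>i<B x v. of_bool (P x v i)) > (0 :: nat))"
    using assms by (intro decidable_pos definable_sum definable_of_bool)
  moreover have "(\<Sum>i<n. of_bool (p i)) > (0 :: nat) \<longleftrightarrow> (\<exists>i<n. p i)" for n and p :: "nat \<Rightarrow> bool"
    by (induction n) (auto simp: less_Suc_eq)
  ultimately show ?thesis by simp
qed

lemma decidable_all [definable_intros]:
  assumes "definable B" "decidable (\<lambda>x v. P x (\<lambda>i. v (Suc i)) (v 0))"
  shows "decidable (\<lambda>x v. \<forall>i<B x v. P x v i)"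
  using decidable_not[OF decidable_ex[OF assms(1) decidable_not[OF assms(2)]]] by simp

lemma definable_if [definable_intros]:
  assumes "decidable P" "definable F" "definable G"
  shows "definable (\<lambda>x v. if P x v then F x v else G x v)"
proof -
  have "definable (\<lambda>x v. F x v * of_bool (P x v) + G x v * of_bool (\<not> P x v))"
    using assms by (intro definable_intros)
  moreover have "F x v * of_bool (P x v) + G x v * of_bool (\<not> P x v)
      = (if P x v then F x v else G x v)" for x v by simp
  ultimately show ?thesis by (simp only:)
qed

lemma decidable_if [definable_intros]:
  assumes "decidable P" "decidable Q" "decidable R"
  shows "decidable (\<lambda>x v. if P x v then Q x v else R x v)"
  using definable_if[of P "\<lambda>x v. of_bool (Q x v)" "\<lambda>x v. of_bool (R x v)"] assms
  by (simp add: decidable_def if_distrib)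

text \<open>Division by counting: \<open>Suc q * b \<le> a\<close> says \<open>q < a div b\<close>,
  and the quotient is the number of such \<open>q\<close>, all of which are below
  \<open>a\<close>.\<close>

lemma div_eq_sum:
  fixes a b :: nat
  assumes "b > 0"
  shows "a div b = (\<Sum>q<a. of_bool (q < a div b))"
proof -
  have "(\<Sum>q<a. of_bool (q < a div b)) = (\<Sum>q<a. if q < a div b then 1 else 0 :: nat)"
    by (simp only: of_bool_def)
  also have "\<dots> = (\<Sum>q | q \<in> {..<a} \<and> q < a div b. 1)"
    by (rule sum.inter_filter[symmetric]) simp
  also have "{q. q \<in> {..<a} \<and> q < a div b} = {..<a div b}"
    using less_le_trans[OF _ div_le_dividend] by blast
  finally show ?thesis by simp
qed

lemma definable_div [definable_intros]:
  assumes "definable F" "definable G"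
  shows "definable (\<lambda>x v. F x v div G x v)"
proof -
  have "definable (\<lambda>x v. if G x v > 0 then \<Sum>q<F x v. of_bool (Suc q * G x v \<le> F x v) else 0)"
    using assms by (intro definable_intros assms[THEN definable_weaken])
  moreover have "(if b > 0 then \<Sum>q<a. of_bool (Suc q * b \<le> a) else 0) = a div b" for a b :: nat
  proof (cases "b > 0")
    case True
    then have "(Suc q * b \<le> a) = (q < a div b)" for q
      by (simp only: less_eq_div_iff_mult_less_eq flip: Suc_le_eq)
    with True show ?thesis using div_eq_sum[of b a] by (simp only: if_True)
  qed simp
  ultimately show ?thesis by (simp only:)
qed

lemma definable_mod [definable_intros]:
  assumes "definable F" "definable G"
  shows "definable (\<lambda>x v. F x v mod G x v)"
proof -
  have "definable (\<lambda>x v. F x v - F x v div G x v * G x v)"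
    using assms by (intro definable_intros)
  then show ?thesis by (simp add: minus_div_mult_eq_mod)
qed

lemma definable_poly [definable_intros]:
  assumes "definable F"
  shows "definable (\<lambda>x v. poly p (F x v))"
  by (induction p) (use assms in \<open>auto intro!: definable_intros\<close>)

text \<open>A function of finite support is a nested case distinction. This hardwires the transition
  table of a fixed machine, about which nothing but finiteness is known.\<close>

lemma definable_table:
  assumes "\<And>a. a \<ge> n \<Longrightarrow> f a = 0" "definable F"
  shows "definable (\<lambda>x v. f (F x v))"
  using assms(1)
proof (induction n arbitrary: f)
  case 0
  then show ?case by (simp add: definable_const)
next
  case (Suc n)
  let ?g = "f(n := 0)"
  have "definable (\<lambda>x v. ?g (F x v))"
    by (rule Suc.IH) (use Suc.prems in auto)
  then have "definable (\<lambda>x v. if F x v = n then f n else ?g (F x v))"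
    by (intro definable_intros assms)
  moreover have "(if F x v = n then f n else ?g (F x v)) = f (F x v)" for x v by simp
  ultimately show ?case by (simp only:)
qed

lemma definable_table2:
  assumes "\<And>a b. a \<ge> m \<or> b \<ge> n \<Longrightarrow> f a b = 0" "definable F" "definable G"
  shows "definable (\<lambda>x v. f (F x v) (G x v))"
proof -
  define g where "g = (\<lambda>c. f (c div n) (c mod n))"
  have g: "g a = 0" if "m * n \<le> a" for a
  proof -
    have "n = 0 \<or> m \<le> a div n" using that less_eq_div_iff_mult_less_eq[of n m a] by auto
    then show ?thesis using assms(1) by (auto simp: g_def)
  qed
  have "definable (\<lambda>x v. F x v * n + G x v)" using assms(2,3) by (intro definable_intros)
  \<comment> \<open>The code \<open>a * n + b\<close> determines the pair only for
    \<open>b < n\<close>; otherwise the value is 0 by assumption.\<close>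
  from definable_table[of "m * n" g, OF g this]
  have "definable (\<lambda>x v. if G x v < n then g (F x v * n + G x v) else 0)"
    using assms(3) by (intro definable_if decidable_less definable_const)
  moreover have "(if b < n then g (a * n + b) else 0) = f a b" for a b
    by (cases "b < n") (simp_all add: g_def assms(1))
  ultimately show ?thesis by (simp only:)
qed

lemma class_PI:
  assumes "decidable (\<lambda>x v. x \<in> L)"
  shows "L \<in> class_P"
proof -
  have "polytime_computable (\<lambda>x. map (\<lambda>i. x \<in> L) [0..<1])"
    using assms by (intro polytime_computable_definable definable_const)
  then show ?thesis by (simp add: class_P_def)
qed

section \<open>Shortest paths and graph encodings\<close>

lemma vwalk_imp_relpow:
  assumes "vwalk p (with_proj G)"
  shows "(hd p, last p) \<in> parcs G ^^ (length p - 1)"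
  using assms
proof (induction p)
  case (Cons u v es)
  then have "(u, last (v # es)) \<in> parcs G ^^ Suc (length es)"
    by (intro relpow_Suc_I2[of u v]) auto
  then show ?case by simp
qed auto

lemma relpow_imp_vwalk:
  assumes "pair_wf_digraph G" "u \<in> pverts G" "(u, v) \<in> parcs G ^^ k"
  shows "\<exists>p. vwalk p (with_proj G) \<and> hd p = u \<and> last p = v \<and> length p = Suc k"
  using assms(2,3)
proof (induction k arbitrary: u)
  case 0
  then show ?case by (intro exI[of _ "[u]"]) simp
next
  case (Suc k)
  then obtain w where w: "(u, w) \<in> parcs G" "(w, v) \<in> parcs G ^^ k"
    by (meson relpow_Suc_E2)
  with assms(1) have "w \<in> pverts G" using pair_wf_digraph.in_arcsD2 by fastforce
  with Suc.IH w(2) obtain p where p: "vwalk p (with_proj G)" "hd p = w" "last p = v"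
    "length p = Suc k" by blast
  then have "vwalk (u # p) (with_proj G)"
    using Suc.prems(1) w(1) by (intro vwalk_consI) auto
  then show ?case using p by (intro exI[of _ "u # p"]) auto
qed

lemma length_vwalk_to_vpath_le: "length (vwalk_to_vpath p) \<le> length p"
proof (induction p rule: vwalk_to_vpath_induct3)
  case (in_set x xs)
  then show ?case using length_dropWhile_le[of "\<lambda>y. y \<noteq> x" xs] by simp
qed auto

lemma length_vwalk_to_vpath_less:
  "\<not> distinct p \<Longrightarrow> length (vwalk_to_vpath p) < length p"
proof (induction p rule: vwalk_to_vpath_induct3)
  case (in_set x xs)
  have "length (vwalk_to_vpath (dropWhile (\<lambda>y. y \<noteq> x) xs)) \<le> length xs"
    using length_vwalk_to_vpath_le length_dropWhile_le le_trans by blast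
  then show ?case using in_set(1) by simp
qed auto

text \<open>A walk can be cut down to a path that is no longer, so powers of the relation measure
  distances. The vertex \<open>u\<close> is required explicitly because the zeroth power relates
  everything to itself.\<close>

lemma vdist_less_iff:
  assumes "pair_wf_digraph G"
  shows "vdist G u v < enat k \<longleftrightarrow> u \<in> pverts G \<and> (\<exists>j<k. (u, v) \<in> parcs G ^^ j)"
proof
  assume "vdist G u v < enat k"
  then obtain p where "vwalk p (with_proj G)" "hd p = u" "last p = v" "length p - 1 < k"
    unfolding vdist_def INF_less_iff by (auto simp: vpath_def)
  then show "u \<in> pverts G \<and> (\<exists>j<k. (u, v) \<in> parcs G ^^ j)"
    using vwalk_imp_relpow[of p G] hd_in_set[of p] by (auto simp: vwalk_def)
next
  assume "u \<in> pverts G \<and> (\<exists>j<k. (u, v) \<in> parcs G ^^ j)"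
  then obtain j p where "j < k" "vwalk p (with_proj G)" "hd p = u" "last p = v" "length p = Suc j"
    using relpow_imp_vwalk[OF assms] by blast
  then show "vdist G u v < enat k"
    unfolding vdist_def INF_less_iff
    using length_vwalk_to_vpath_le[of p]
    by (intro bexI[of _ "vwalk_to_vpath p"])
      (auto simp: vwalk_to_vpath_hd vwalk_to_vpath_last vwalk_to_vpath_vpath)
qed

text \<open>Distinctness is forced by the right-hand side: cutting out a cycle would give a shorter
  walk between the same ends.\<close>

lemma shortest_vpath_iff:
  assumes "pair_wf_digraph G"
  shows "shortest_vpath G p \<longleftrightarrow>
    vwalk p (with_proj G) \<and> (\<forall>j < length p - 1. (hd p, last p) \<notin> parcs G ^^ j)"
proof
  assume "shortest_vpath G p"
  then have p: "vwalk p (with_proj G)" "\<not> vdist G (hd p) (last p) < enat (length p - 1)"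
    by (auto simp: shortest_vpath_def vpath_def)
  moreover have "hd p \<in> pverts G" using p(1) hd_in_set by (auto simp: vwalk_def)
  ultimately show "vwalk p (with_proj G) \<and> (\<forall>j < length p - 1. (hd p, last p) \<notin> parcs G ^^ j)"
    using vdist_less_iff[OF assms] by blast
next
  assume p: "vwalk p (with_proj G) \<and> (\<forall>j < length p - 1. (hd p, last p) \<notin> parcs G ^^ j)"
  then have ge: "\<not> vdist G (hd p) (last p) < enat (length p - 1)"
    using vdist_less_iff[OF assms] by blast
  have "distinct p"
  proof (rule ccontr)
    assume "\<not> distinct p"
    let ?q = "vwalk_to_vpath p"
    have q: "vwalk ?q (with_proj G)" "?q \<noteq> []"
      using p vwalk_to_vpath_vpath[of p "with_proj G"] by (auto simp: vpath_def vwalk_def)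
    have "length ?q - 1 < length p - 1"
      using length_vwalk_to_vpath_less[OF \<open>\<not> distinct p\<close>] q(2) by (cases ?q) auto
    then show False
      using p vwalk_imp_relpow[OF q(1)] by (auto simp: vwalk_to_vpath_hd vwalk_to_vpath_last)
  qed
  with p have vp: "vpath p (with_proj G)" by auto
  then have "vdist G (hd p) (last p) \<le> enat (vwalk_length p)"
    unfolding vdist_def by (intro INF_lower) auto
  with ge vp show "shortest_vpath G p" by (simp add: shortest_vpath_def)
qed

lemma closeness_max_less_iff:
  assumes "pair_digraph G" "pverts G \<noteq> {}" "p \<noteq> []"
  shows "closeness_max G p < enat \<alpha> \<longleftrightarrow>
    (\<forall>u \<in> pverts G. \<exists>v \<in> set p. \<exists>j<\<alpha>. (u, v) \<in> parcs G ^^ j)"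
proof -
  interpret pair_digraph G by fact
  have "finite (pverts G)" using pair_finite_verts .
  then have "closeness_max G p < enat \<alpha> \<longleftrightarrow> (\<forall>u \<in> pverts G. \<exists>v \<in> set p. vdist G u v < enat \<alpha>)"
    using assms unfolding closeness_max_def vdist_to_path_def by (simp add: Min_less_iff)
  then show ?thesis using vdist_less_iff[OF pair_wf_digraph] by auto
qed

text \<open>Reachability in a symmetric relation is an equivalence, so one root suffices. A
  condition on pairs of vertices thus becomes one that a single table of distances can
  certify.\<close>

lemma connected_iff_root:
  assumes "pair_wf_digraph G" "r \<in> pverts G"
  shows "Digraph_Component.connected (with_proj G) \<longleftrightarrow>
    (\<forall>v \<in> pverts G. (v, r) \<in> (parcs G \<union> (parcs G)\<inverse>)\<^sup>*)"
proof -
  let ?E = "parcs G \<union> (parcs G)\<inverse>"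
  have E: "symcl (parcs G) = ?E" by (auto simp: symcl_def)
  have on: "(u, v) \<in> rtrancl_on (pverts G) ?E \<longleftrightarrow> (u, v) \<in> ?E\<^sup>*"
    if "u \<in> pverts G" "v \<in> pverts G" for u v
  proof
    assume "(u, v) \<in> ?E\<^sup>*"
    then show "(u, v) \<in> rtrancl_on (pverts G) ?E" using that
    proof (rule rtrancl_consistent_rtrancl_on)
      fix a b assume "(a, b) \<in> ?E"
      then show "b \<in> pverts G"
        using pair_wf_digraph.in_arcsD1[OF assms(1)] pair_wf_digraph.in_arcsD2[OF assms(1)] by auto
    qed
  qed (rule rtrancl_on_rtranclI)
  have sym: "sym (?E\<^sup>*)" by (intro sym_rtrancl sym_Un_converse)
  have "Digraph_Component.connected (with_proj G) \<longleftrightarrow>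
      (\<forall>u \<in> pverts G. \<forall>v \<in> pverts G. (u, v) \<in> ?E\<^sup>*)"
    using assms(2) on by (auto simp: connected_conv E)
  also have "\<dots> \<longleftrightarrow> (\<forall>v \<in> pverts G. (v, r) \<in> ?E\<^sup>*)"
    using assms(2) sym by (meson rtrancl_trans symD)
  finally show ?thesis .
qed

section \<open>Binary numerals and decoding of instances\<close>

lemma horner_sum_nat_bits: "horner_sum of_bool 2 (nat_bits n) = n"
proof (induction n rule: nat_bits.induct)
  case (1 n)
  show ?case
  proof (cases "n = 0")
    case False
    then show ?thesis
      using 1 by (subst nat_bits.simps) (simp add: of_bool_odd_eq_mod_2)
  qed (simp add: nat_bits.simps)
qed

text \<open>Bits are least significant first, so the hypothesis says that the leading digit is not
  0; such numerals are unique.\<close>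

lemma nat_bits_horner_sum:
  "(bs \<noteq> [] \<Longrightarrow> last bs) \<Longrightarrow> nat_bits (horner_sum of_bool 2 bs) = bs"
proof (induction bs)
  case Nil
  then show ?case by (simp add: nat_bits.simps)
next
  case (Cons b bs)
  let ?n = "horner_sum of_bool 2 bs :: nat"
  have "bs \<noteq> [] \<Longrightarrow> last bs" using Cons.prems by auto
  with Cons.IH have IH: "nat_bits ?n = bs" .
  have pos: "of_bool b + 2 * ?n \<noteq> 0"
  proof
    assume "of_bool b + 2 * ?n = 0"
    then have "\<not> b" "?n = 0" by auto
    with IH have "bs = []" by (simp add: nat_bits.simps)
    with Cons.prems \<open>\<not> b\<close> show False by simp
  qed
  have "(of_bool b + 2 * ?n) div 2 = ?n" "odd (of_bool b + 2 * ?n) = b" by auto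
  then show ?case using pos IH by (subst nat_bits.simps) simp
qed

lemma last_nat_bits: "n > 0 \<Longrightarrow> nat_bits n \<noteq> [] \<and> last (nat_bits n)"
proof (induction n rule: nat_bits.induct)
  case (1 n)
  show ?case
  proof (cases "n div 2 = 0")
    case True
    with 1 have "n = 1" by auto
    then show ?thesis by (simp add: nat_bits.simps)
  next
    case False
    then show ?thesis using 1 by (subst (1 2) nat_bits.simps) auto
  qed
qed

lemma length_MCCSP_encode:
  "length (MCCSP_encode G \<alpha>) = card (pverts G) + 1 + card (pverts G) * card (pverts G) + length (nat_bits \<alpha>)"
  by (simp add: MCCSP_encode_def Let_def)

lemma MCCSP_encode_nth:
  fixes G \<alpha>
  defines "n \<equiv> card (pverts G)"
  assumes "i < length (MCCSP_encode G \<alpha>)"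
  shows "MCCSP_encode G \<alpha> ! i =
    (if i < n then True else if i = n then False
     else if i < n + 1 + n * n then ((i - (n + 1)) div n, (i - (n + 1)) mod n) \<in> parcs G
     else nat_bits \<alpha> ! (i - (n + 1 + n * n)))"
proof -
  let ?A = "replicate n True @ [False]"
  let ?B = "map (\<lambda>e. e \<in> parcs G) (List.product [0..<n] [0..<n])"
  have x: "MCCSP_encode G \<alpha> = ?A @ ?B @ nat_bits \<alpha>"
    by (simp add: MCCSP_encode_def n_def Let_def)
  show ?thesis
  proof (cases "i < n + 1 + n * n")
    case True
    then have "MCCSP_encode G \<alpha> ! i = (?A @ ?B) ! i"
      unfolding x append_assoc[symmetric] by (subst nth_append) simp
    also have "\<dots> = (if i < n then True else if i = n then False
        else ((i - (n + 1)) div n, (i - (n + 1)) mod n) \<in> parcs G)"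
    proof (cases "i < n + 1")
      case False
      then have lt: "i - (n + 1) < n * n" using True by simp
      then have "(i - (n + 1)) div n < n" by (simp add: less_mult_imp_div_less)
      moreover have "n > 0" using lt by (cases n) auto
      ultimately show ?thesis using False lt by (simp add: nth_append product_nth)
    qed (auto simp: nth_append)
    finally show ?thesis using True by simp
  next
    case False
    then show ?thesis unfolding x append_assoc[symmetric] by (subst nth_append) simp
  qed
qed

definition graph_of :: "nat \<Rightarrow> bool list \<Rightarrow> nat pair_pre_digraph" where
  "graph_of n x = \<lparr>pverts = {..<n},
     parcs = {(i, j). i < n \<and> j < n \<and> bit_at x (n + 1 + i * n + j)}\<rparr>"

definition bound_of :: "nat \<Rightarrow> bool list \<Rightarrow> nat" where
  "bound_of n x = horner_sum of_bool 2 (drop (n + 1 + n * n) x)"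

text \<open>Describes the encodings of arbitrary graphs, possibly with loops or disconnected, with
  positive bounds: the strict inequality leaves room for a digit of the bound, and the final 1
  excludes leading zeros.\<close>

definition enc_shape :: "nat \<Rightarrow> bool list \<Rightarrow> bool" where
  "enc_shape n x \<longleftrightarrow> (\<forall>i<n. bit_at x i) \<and> \<not> bit_at x n \<and> n + 1 + n * n < length x \<and>
     bit_at x (length x - 1)"

text \<open>The number is the position of the first \<open>False\<close>.\<close>

lemma enc_shape_unique: "enc_shape n x \<Longrightarrow> enc_shape m x \<Longrightarrow> m = n"
  unfolding enc_shape_def by (metis nat_neq_iff)

lemma mat_index_less: "i < n \<Longrightarrow> j < n \<Longrightarrow> i * n + j < n * (n :: nat)"
proof -
  assume "i < n" "j < n"
  then have "i * n + j < Suc i * n" by simp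
  also have "\<dots> \<le> n * n" using \<open>i < n\<close> by (intro mult_le_mono1) simp
  finally show ?thesis .
qed

lemma MCCSP_encode_shape:
  assumes "pverts G = {..<card (pverts G)}" "pair_wf_digraph G" "\<alpha> > 0"
  defines "n \<equiv> card (pverts G)" and "x \<equiv> MCCSP_encode G \<alpha>"
  shows "enc_shape n x" "graph_of n x = G" "bound_of n x = \<alpha>"
proof -
  have len: "length x = n + 1 + n * n + length (nat_bits \<alpha>)"
    unfolding x_def n_def by (rule length_MCCSP_encode)
  note nth = MCCSP_encode_nth[of _ G \<alpha>, folded x_def n_def]
  have bits: "nat_bits \<alpha> \<noteq> []" "last (nat_bits \<alpha>)" using last_nat_bits assms(3) by auto
  then have "length x - 1 < length x" "n + 1 + n * n \<le> length x - 1"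
    "length x - 1 - (n + 1 + n * n) = length (nat_bits \<alpha>) - 1"
    using len by (cases "nat_bits \<alpha>"; simp)+
  then show "enc_shape n x"
    using bits len by (auto simp: enc_shape_def bit_at_def nth last_conv_nth)
  have "bit_at x (n + 1 + i * n + j) \<longleftrightarrow> (i, j) \<in> parcs G" if "i < n" "j < n" for i j
  proof -
    have "i * n + j < n * n" using mat_index_less that .
    then show ?thesis using that len by (simp add: bit_at_def nth)
  qed
  moreover have "i < n \<and> j < n" if "(i, j) \<in> parcs G" for i j
    using that assms(1) pair_wf_digraph.in_arcsD1[OF assms(2)] pair_wf_digraph.in_arcsD2[OF assms(2)]
    by (metis n_def lessThan_iff)
  ultimately have "{(i, j). i < n \<and> j < n \<and> bit_at x (n + 1 + i * n + j)} = parcs G" by auto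
  then show "graph_of n x = G" using assms(1) by (simp add: graph_of_def n_def)
  have "drop (n + 1 + n * n) x = nat_bits \<alpha>"
    by (rule nth_equalityI) (auto simp: len nth)
  then show "bound_of n x = \<alpha>" by (simp add: bound_of_def horner_sum_nat_bits)
qed

lemma MCCSP_encode_graph_of:
  assumes "enc_shape n x"
  shows "MCCSP_encode (graph_of n x) (bound_of n x) = x"
proof -
  let ?d = "drop (n + 1 + n * n) x"
  have lt: "n + 1 + n * n < length x" and "x ! (length x - 1)"
    using assms by (auto simp: enc_shape_def bit_at_def)
  then have "last x" by (subst last_conv_nth) auto
  with lt have "?d \<noteq> []" "last ?d" by (auto simp: last_drop)
  then have bits: "nat_bits (bound_of n x) = ?d"
    by (simp add: bound_of_def nat_bits_horner_sum)
  have card: "card (pverts (graph_of n x)) = n" by (simp add: graph_of_def)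
  have len: "length (MCCSP_encode (graph_of n x) (bound_of n x)) = length x"
    using lt by (simp add: length_MCCSP_encode card bits)
  show ?thesis
  proof (rule nth_equalityI[OF len])
    fix i assume i: "i < length (MCCSP_encode (graph_of n x) (bound_of n x))"
    then have ix: "i < length x" using len by simp
    consider "i < n" | "i = n" | "n < i" "i < n + 1 + n * n" | "n + 1 + n * n \<le> i" by linarith
    then show "MCCSP_encode (graph_of n x) (bound_of n x) ! i = x ! i"
    proof cases
      case 1
      then show ?thesis
        unfolding MCCSP_encode_nth[OF i] card using assms by (simp add: enc_shape_def bit_at_def)
    next
      case 2
      then show ?thesis
        unfolding MCCSP_encode_nth[OF i] card using assms ix by (simp add: enc_shape_def bit_at_def)
    next
      case 4
      then show ?thesis
        unfolding MCCSP_encode_nth[OF i] card bits using 4 lt by (simp add: nth_drop)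
    next
      case 3
      let ?q = "i - (n + 1)"
      have q: "?q < n * n" "i = n + 1 + ?q" using 3 by auto
      then have "n > 0" by (cases n) auto
      then have "?q div n < n" "?q mod n < n" using q(1) by (auto simp: less_mult_imp_div_less)
      moreover have "n + 1 + ?q div n * n + ?q mod n = i" using q(2) by simp
      ultimately show ?thesis
        unfolding MCCSP_encode_nth[OF i] card using 3 ix by (auto simp: graph_of_def bit_at_def)
    qed
  qed
qed

text \<open>Encoding and decoding are inverse to each other on strings of the right shape, so the
  quantifier over graphs turns into a statement about the decoded one.\<close>

lemma MCCSP_D_iff:
  "x \<in> MCCSP_D \<longleftrightarrow> (\<exists>n. enc_shape n x \<and> MCCSP_instance (graph_of n x) (bound_of n x) \<and>
     MCCSP_yes (graph_of n x) (bound_of n x))"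
proof
  assume "x \<in> MCCSP_D"
  then obtain G \<alpha> where x: "x = MCCSP_encode G \<alpha>" and G: "MCCSP_instance G \<alpha>" "MCCSP_yes G \<alpha>"
    by (auto simp: MCCSP_D_def)
  then have "pverts G = {..<card (pverts G)}" "pair_wf_digraph G" "\<alpha> > 0"
    by (auto simp: MCCSP_instance_def intro: pair_digraph.pair_wf_digraph)
  from MCCSP_encode_shape[OF this, folded x]
  show "\<exists>n. enc_shape n x \<and> MCCSP_instance (graph_of n x) (bound_of n x) \<and>
     MCCSP_yes (graph_of n x) (bound_of n x)"
    using G by (intro exI[of _ "card (pverts G)"]) simp
next
  assume "\<exists>n. enc_shape n x \<and> MCCSP_instance (graph_of n x) (bound_of n x) \<and>
     MCCSP_yes (graph_of n x) (bound_of n x)"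
  then obtain n where "enc_shape n x" "MCCSP_instance (graph_of n x) (bound_of n x)"
     "MCCSP_yes (graph_of n x) (bound_of n x)" by blast
  then show "x \<in> MCCSP_D"
    unfolding MCCSP_D_def using MCCSP_encode_graph_of by (auto intro!: exI)
qed

lemma MCCSP_encode_in_MCCSP_D_iff:
  assumes "pverts G = {..<card (pverts G)}" "pair_wf_digraph G" "\<alpha> > 0"
  shows "MCCSP_encode G \<alpha> \<in> MCCSP_D \<longleftrightarrow> MCCSP_instance G \<alpha> \<and> MCCSP_yes G \<alpha>"
  using MCCSP_encode_shape[OF assms] enc_shape_unique MCCSP_D_iff by metis

section \<open>Vertices along a walk\<close>

lemma vwalk_iff_nth:
  "vwalk p (with_proj G) \<longleftrightarrow> p \<noteq> [] \<and> set p \<subseteq> pverts G \<and>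
    (\<forall>i. Suc i < length p \<longrightarrow> (p ! i, p ! Suc i) \<in> parcs G)"
proof -
  have "set (vwalk_arcs p) = {(p ! i, p ! Suc i) | i. Suc i < length p}"
  proof (induction p rule: vwalk_arcs.induct)
    case (3 x y xs)
    have "{(((x # y # xs) ! i), ((x # y # xs) ! Suc i)) | i. Suc i < length (x # y # xs)}
        = insert (x, y) {((y # xs) ! i, (y # xs) ! Suc i) | i. Suc i < length (y # xs)}"
      (is "?A = insert _ ?B")
    proof (intro set_eqI iffI)
      fix e assume "e \<in> ?A"
      then obtain i where "e = ((x # y # xs) ! i, (x # y # xs) ! Suc i)" "Suc i < length (x # y # xs)"
        by blast
      then show "e \<in> insert (x, y) ?B" by (cases i) auto
    next
      fix e assume "e \<in> insert (x, y) ?B"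
      then show "e \<in> ?A"
      proof
        assume "e = (x, y)"
        then show ?thesis by (intro CollectI exI[of _ 0]) simp
      next
        assume "e \<in> ?B"
        then obtain i where "e = ((y # xs) ! i, (y # xs) ! Suc i)" "Suc i < length (y # xs)"
          by blast
        then show ?thesis by (intro CollectI exI[of _ "Suc i"]) simp
      qed
    qed
    then show ?case using 3 by simp
  qed auto
  then show ?thesis by (auto simp: vwalk_def)
qed

lemma vwalk_nth_relpow:
  assumes "vwalk p (with_proj G)"
  shows "i + k < length p \<Longrightarrow> (p ! i, p ! (i + k)) \<in> parcs G ^^ k"
proof (induction k)
  case (Suc k)
  then have "(p ! (i + k), p ! Suc (i + k)) \<in> parcs G" using assms by (simp add: vwalk_iff_nth)
  then show ?case using Suc by (intro relpow_Suc_I) auto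
qed simp

lemma vwalk_nth_last_rtrancl:
  assumes "vwalk p (with_proj G)" "x \<in> set p"
  shows "(x, last p) \<in> (parcs G)\<^sup>*"
proof -
  obtain as bs where p: "p = as @ x # bs" using assms(2) by (auto simp: in_set_conv_decomp)
  then have "vwalk (x # bs) (with_proj G)" using assms(1) vwalkI_append_r[of "x # bs" as] by simp
  from relpow_imp_rtrancl[OF vwalk_imp_relpow[OF this]] show ?thesis by (simp add: p)
qed

text \<open>Serves twice: a vertex without outgoing arcs can only be the end of a path, and a clause
  vertex on the path has an arc into the path.\<close>

lemma vwalk_successor:
  assumes "vwalk p (with_proj G)" "x \<in> set p" "x \<noteq> last p"
  shows "\<exists>y \<in> set p. (x, y) \<in> parcs G"
proof -
  obtain as bs where p: "p = as @ x # bs" using assms(2) by (auto simp: in_set_conv_decomp)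
  then have walk: "vwalk (x # bs) (with_proj G)" using assms(1) vwalkI_append_r[of "x # bs" as] by simp
  have "bs \<noteq> []" using assms(3) p by auto
  from walk this have "(x, hd bs) \<in> parcs G" by (rule vwalk_consE) simp
  with \<open>bs \<noteq> []\<close> show ?thesis using p by (intro bexI[of _ "hd bs"]) auto
qed

section \<open>Constraint satisfaction as a path problem\<close>

text \<open>
  A constraint satisfaction problem with variables below \<open>m\<close>, values below \<open>B\<close> and clauses below
  \<open>N\<close>: \<open>R c i a\<close> says that giving the value \<open>a\<close> to variable \<open>i\<close> satisfies clause \<open>c\<close>.
\<close>

definition csp_sat :: "nat \<Rightarrow> nat \<Rightarrow> nat \<Rightarrow> (nat \<Rightarrow> nat \<Rightarrow> nat \<Rightarrow> bool) \<Rightarrow> bool" where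
  "csp_sat m B N R \<longleftrightarrow> (\<exists>f. (\<forall>i<m. f i < B) \<and> (\<forall>c<N. \<exists>i<m. R c i (f i)))"

text \<open>
  The vertex \<open>i * B + a\<close> stands for the value \<open>a\<close> of variable \<open>i\<close>, and all vertices of variable
  \<open>i\<close> have arcs to all vertices of variable \<open>i + 1\<close>. The sink \<open>m * B\<close> acts as the only vertex of
  variable \<open>m\<close>. The vertex \<open>m * B + 1 + c\<close> of clause \<open>c\<close> has arcs to what satisfies it.
\<close>

definition csp_arc :: "nat \<Rightarrow> nat \<Rightarrow> (nat \<Rightarrow> nat \<Rightarrow> nat \<Rightarrow> bool) \<Rightarrow> nat \<Rightarrow> nat \<Rightarrow> bool" where
  "csp_arc m B R v w \<longleftrightarrow>
    v < m * B \<and> w \<le> m * B \<and> w div B = Suc (v div B) \<or>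
    m * B < v \<and> w < m * B \<and> R (v - (m * B + 1)) (w div B) (w mod B)"

definition csp_graph :: "nat \<Rightarrow> nat \<Rightarrow> nat \<Rightarrow> (nat \<Rightarrow> nat \<Rightarrow> nat \<Rightarrow> bool) \<Rightarrow> nat pair_pre_digraph" where
  "csp_graph m B N R = \<lparr>pverts = {..<m * B + 1 + N},
     parcs = {(v, w). v < m * B + 1 + N \<and> csp_arc m B R v w}\<rparr>"

section \<open>Solutions and dominating paths\<close>

lemma card_csp_graph: "card (pverts (csp_graph m B N R)) = m * B + 1 + N"
  by (simp add: csp_graph_def)

lemma pair_digraph_csp_graph: "pair_digraph (csp_graph m B N R)"
proof -
  have "parcs (csp_graph m B N R) \<subseteq> {..<m * B + 1 + N} \<times> {..<m * B + 1 + N}"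
    by (auto simp: csp_graph_def csp_arc_def)
  then show ?thesis
    by unfold_locales
      (auto simp: csp_graph_def csp_arc_def intro: finite_subset[of _ "{..<m * B + 1 + N} \<times> {..<m * B + 1 + N}"])
qed

text \<open>Used in both directions of the equivalence: no path meets a layer twice, and the ends of
  a walk determine its length, so that a walk through the layers cannot be shortened.\<close>

lemma relpow_csp_graph_layer:
  "(v, w) \<in> parcs (csp_graph m B N R) ^^ k \<Longrightarrow> v \<le> m * B \<Longrightarrow> w \<le> m * B \<and> w div B = v div B + k"
proof (induction k arbitrary: w)
  case (Suc k)
  then obtain u where u: "(v, u) \<in> parcs (csp_graph m B N R) ^^ k" "(u, w) \<in> parcs (csp_graph m B N R)"
    by auto
  then have "u \<le> m * B" "u div B = v div B + k" using Suc by auto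
  then show ?case using u(2) by (auto simp: csp_graph_def csp_arc_def)
qed auto

lemma closeness_max_less_2_iff:
  assumes "pair_digraph G" "pverts G \<noteq> {}" "p \<noteq> []"
  shows "closeness_max G p < enat 2 \<longleftrightarrow>
    (\<forall>u \<in> pverts G. u \<in> set p \<or> (\<exists>v \<in> set p. (u, v) \<in> parcs G))"
proof -
  have "(\<exists>j<2. (u, v) \<in> parcs G ^^ j) \<longleftrightarrow> u = v \<or> (u, v) \<in> parcs G" for u v
    by (auto simp: numeral_2_eq_2 less_Suc_eq)
  then show ?thesis unfolding closeness_max_less_iff[OF assms] by auto
qed

lemma csp_sat_if_yes:
  assumes "0 < m" "0 < B" "MCCSP_yes (csp_graph m B N R) 2"
  shows "csp_sat m B N R"
proof -
  let ?G = "csp_graph m B N R"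
  obtain p where p: "shortest_vpath ?G p" "closeness_max ?G p < enat 2"
    using assms(3) by (auto simp: MCCSP_yes_def)
  then have walk: "vwalk p (with_proj ?G)"
    by (simp add: shortest_vpath_def vpath_def)
  then have ne: "p \<noteq> []" by (simp add: vwalk_def)
  have "pverts ?G \<noteq> {}" by (auto simp: csp_graph_def)
  with p(2) have "\<forall>u \<in> pverts ?G. u \<in> set p \<or> (\<exists>v \<in> set p. (u, v) \<in> parcs ?G)"
    using closeness_max_less_2_iff[OF pair_digraph_csp_graph _ ne] by simp
  then have close: "u \<in> set p \<or> (\<exists>v \<in> set p. (u, v) \<in> parcs ?G)" if "u < m * B + 1 + N" for u
    using that by (simp add: csp_graph_def)
  \<comment> \<open>Nothing leaves the sink, so it is close to the path only by lying on it, and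
    then it is the last vertex.\<close>
  have sink: "(m * B, v) \<notin> parcs ?G" for v by (auto simp: csp_graph_def csp_arc_def)
  then have "m * B \<in> set p" using close[of "m * B"] sink by auto
  then have last: "last p = m * B" using vwalk_successor[OF walk] sink by metis
  have layer: "p ! j div B > p ! i div B" if "i < j" "j < length p" "p ! i < m * B" for i j
  proof -
    have "(p ! i, p ! (i + (j - i))) \<in> parcs ?G ^^ (j - i)"
      using that by (intro vwalk_nth_relpow[OF walk]) simp
    from relpow_csp_graph_layer[OF this] show ?thesis using that by simp
  qed
  have unique: "v = w" if vw: "v \<in> set p" "w \<in> set p" "v < m * B" "w < m * B" "v div B = w div B" for v w
  proof -
    obtain i where i: "i < length p" "p ! i = v" using vw(1) unfolding in_set_conv_nth by auto
    obtain j where j: "j < length p" "p ! j = w" using vw(2) unfolding in_set_conv_nth by auto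
    show ?thesis
    proof (cases i j rule: linorder_cases)
      case less
      from layer[OF this j(1)] show ?thesis using vw(3,5) i j by simp
    next
      case greater
      from layer[OF this i(1)] show ?thesis using vw(4,5) i j by simp
    qed (use i j in simp)
  qed
  \<comment> \<open>The path may begin in a late layer. A variable whose layer is missed gets any
    value; clauses are satisfied through vertices that do lie on the path.\<close>
  have "\<exists>a<B. \<forall>v \<in> set p. v < m * B \<longrightarrow> v div B = i \<longrightarrow> v mod B = a" for i
  proof (cases "\<exists>w \<in> set p. w < m * B \<and> w div B = i")
    case True
    then obtain w where w: "w \<in> set p" "w < m * B" "w div B = i" by blast
    have "v mod B = w mod B" if "v \<in> set p" "v < m * B" "v div B = i" for v
      using unique[OF that(1) w(1) that(2) w(2)] that(3) w(3) by simp
    then show ?thesis using assms(2) by (intro exI[of _ "w mod B"]) simp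
  next
    case False
    then show ?thesis using assms(2) by blast
  qed
  then obtain f where f_less: "\<And>i. f i < B"
    and f: "\<And>i v. v \<in> set p \<Longrightarrow> v < m * B \<Longrightarrow> v div B = i \<Longrightarrow> v mod B = f i"
    by metis
  have "\<exists>i<m. R c i (f i)" if "c < N" for c
  proof -
    let ?u = "m * B + 1 + c"
    have "\<exists>v \<in> set p. (?u, v) \<in> parcs ?G"
    \<comment> \<open>A clause vertex may itself lie on the path (at its start, as no arc enters
      it). It is not the sink, so it has a successor on the path, which again satisfies the
      clause.\<close>
    proof (cases "?u \<in> set p")
      case True
      then show ?thesis using vwalk_successor[OF walk True] last by simp
    qed (use close[of ?u] that in simp)
    then obtain v where v: "v \<in> set p" "v < m * B" "R c (v div B) (v mod B)"
      by (auto simp: csp_graph_def csp_arc_def)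
    then have "v div B < m" by (simp add: less_mult_imp_div_less)
    then show ?thesis using v f[OF v(1,2) refl] by auto
  qed
  then show ?thesis unfolding csp_sat_def using f_less by blast
qed

lemma yes_if_csp_sat:
  assumes "0 < m" "0 < B" "csp_sat m B N R"
  shows "MCCSP_instance (csp_graph m B N R) 2 \<and> MCCSP_yes (csp_graph m B N R) 2"
proof -
  let ?G = "csp_graph m B N R"
  interpret G: pair_digraph ?G by (rule pair_digraph_csp_graph)
  obtain f where f: "\<And>i. i < m \<Longrightarrow> f i < B" "\<And>c. c < N \<Longrightarrow> \<exists>i<m. R c i (f i)"
    using assms(3) by (auto simp: csp_sat_def)
  \<comment> \<open>The default value 0 at \<open>i = m\<close> makes the last vertex
    \<open>m * B\<close>, the sink.\<close>
  define g where "g = (\<lambda>i. i * B + (if i < m then f i else 0))"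
  define p where "p = map g [0..<Suc m]"
  have g_div: "g i div B = i" and g_mod: "i < m \<Longrightarrow> g i mod B = f i" for i
    using f(1)[of i] assms(2) by (auto simp: g_def)
  have g_less: "g i < m * B" if "i < m" for i
  proof -
    have "g i < Suc i * B" using f(1) that by (simp add: g_def)
    also have "\<dots> \<le> m * B" using that by (intro mult_le_mono1) simp
    finally show ?thesis .
  qed
  then have g_le: "g i \<le> m * B" if "i \<le> m" for i
    using that le_neq_implies_less by (fastforce simp: g_def)
  have p: "p \<noteq> []" "length p = Suc m" "\<And>i. i \<le> m \<Longrightarrow> p ! i = g i" "set p = g ` {..m}"
    by (auto simp: p_def simp del: upt_Suc)
  have hd_last: "hd p = g 0" "last p = g m" "g m = m * B"
    using p by (auto simp: hd_conv_nth last_conv_nth g_def)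
  \<comment> \<open>Holds for all vertices of a layer, chosen or not, since consecutive layers are
    completely joined. So the path is close to all of them.\<close>
  have arc: "(v, g (Suc (v div B))) \<in> parcs ?G" if "v < m * B" for v
  proof -
    have "v div B < m" using that by (simp add: less_mult_imp_div_less)
    then show ?thesis using that g_le[of "Suc (v div B)"] by (simp add: csp_graph_def csp_arc_def g_div)
  qed
  have walk: "vwalk p (with_proj ?G)"
    unfolding vwalk_iff_nth
  proof (intro conjI allI impI)
    show "set p \<subseteq> pverts ?G" using g_le by (force simp: p csp_graph_def)
    show "(p ! i, p ! Suc i) \<in> parcs ?G" if "Suc i < length p" for i
      using that p arc[OF g_less, of i] by (simp add: g_div)
  qed (rule p)
  have "(hd p, last p) \<notin> parcs ?G ^^ j" if "j < length p - 1" for j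
  proof
    assume "(hd p, last p) \<in> parcs ?G ^^ j"
    from relpow_csp_graph_layer[OF this] have "g m div B = g 0 div B + j"
      using g_le[of 0] by (simp add: hd_last(1,2))
    with that show False by (simp add: g_div p)
  qed
  then have short: "shortest_vpath ?G p"
    using walk shortest_vpath_iff[OF G.pair_wf_digraph] by blast
  have close: "u \<in> set p \<or> (\<exists>v \<in> set p. (u, v) \<in> parcs ?G)" if "u \<in> pverts ?G" for u
  proof -
    consider "u < m * B" | "u = m * B" | c where "u = m * B + 1 + c" "c < N"
    proof -
      have "u = m * B + 1 + (u - (m * B + 1))" "u - (m * B + 1) < N" if "m * B < u"
        using that \<open>u \<in> pverts ?G\<close> by (auto simp: csp_graph_def)
      then show thesis using that by (meson linorder_cases)
    qed
    then show ?thesis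
    proof cases
      case 1
      then have "Suc (u div B) \<le> m" by (simp add: less_mult_imp_div_less Suc_leI)
      then show ?thesis using arc[OF 1] by (auto simp: p)
    next
      case 2
      then show ?thesis using hd_last(3) by (auto simp: p intro!: image_eqI[of _ g m])
    next
      case (3 c)
      then obtain i where i: "i < m" "R c i (f i)" using f(2) by blast
      then have "(u, g i) \<in> parcs ?G"
        using 3 g_less[OF i(1)] by (simp add: csp_graph_def csp_arc_def g_div g_mod)
      then show ?thesis using i(1) by (auto simp: p)
    qed
  qed
  have ne: "pverts ?G \<noteq> {}" by (auto simp: csp_graph_def)
  have "MCCSP_yes ?G 2"
    unfolding MCCSP_yes_def
    using short close closeness_max_less_2_iff[OF pair_digraph_csp_graph ne p(1)] by blast
  moreover have "Digraph_Component.connected (with_proj ?G)"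
  proof -
    let ?E = "parcs ?G \<union> (parcs ?G)\<inverse>"
    have "(u, m * B) \<in> ?E\<^sup>*" if "u \<in> pverts ?G" for u
    proof -
      have "(v, m * B) \<in> (parcs ?G)\<^sup>*" if "v \<in> set p" for v
        using vwalk_nth_last_rtrancl[OF walk that] hd_last by simp
      then have "(u, m * B) \<in> (parcs ?G)\<^sup>*"
        using close[OF that] by (meson converse_rtrancl_into_rtrancl)
      then show ?thesis by (rule rtrancl_mono[THEN subsetD, rotated]) simp
    qed
    moreover have "m * B \<in> pverts ?G" by (simp add: csp_graph_def)
    ultimately show ?thesis using connected_iff_root[OF G.pair_wf_digraph] by blast
  qed
  ultimately show ?thesis
    by (simp add: MCCSP_instance_def card_csp_graph G.pair_digraph) (simp add: csp_graph_def)
qed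

theorem csp_graph_in_MCCSP_D:
  assumes "0 < m" "0 < B"
  shows "MCCSP_encode (csp_graph m B N R) 2 \<in> MCCSP_D \<longleftrightarrow> csp_sat m B N R"
proof -
  have "MCCSP_encode (csp_graph m B N R) 2 \<in> MCCSP_D \<longleftrightarrow>
      MCCSP_instance (csp_graph m B N R) 2 \<and> MCCSP_yes (csp_graph m B N R) 2"
    by (rule MCCSP_encode_in_MCCSP_D_iff)
      (use pair_digraph.pair_wf_digraph[OF pair_digraph_csp_graph] in
        \<open>auto simp: card_csp_graph\<close>, simp_all add: csp_graph_def)
  then show ?thesis using csp_sat_if_yes yes_if_csp_sat assms by blast
qed

text \<open>The final case spells 2 in binary, least significant bit first: 0 and then 1.\<close>

definition csp_bit :: "nat \<Rightarrow> nat \<Rightarrow> nat \<Rightarrow> (nat \<Rightarrow> nat \<Rightarrow> nat \<Rightarrow> bool) \<Rightarrow> nat \<Rightarrow> bool" where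
  "csp_bit m B N R i = (let n = m * B + 1 + N in
     if i < n then True else if i = n then False
     else if i < n + 1 + n * n then csp_arc m B R ((i - (n + 1)) div n) ((i - (n + 1)) mod n)
     else i \<noteq> n + 1 + n * n)"

lemma MCCSP_encode_csp_graph:
  fixes m B N R
  defines "n \<equiv> m * B + 1 + N"
  shows "MCCSP_encode (csp_graph m B N R) 2 = map (csp_bit m B N R) [0..<n + 1 + n * n + 2]"
proof -
  let ?G = "csp_graph m B N R"
  have n: "card (pverts ?G) = n" by (simp add: card_csp_graph n_def)
  have bits: "nat_bits 2 = [False, True]"
    by (simp add: nat_bits.simps)
  have len: "length (MCCSP_encode ?G 2) = n + 1 + n * n + 2"
    by (simp add: length_MCCSP_encode n bits)
  show ?thesis
  proof (rule nth_equalityI)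
    fix i assume i: "i < length (MCCSP_encode ?G 2)"
    have "n * n > 0" by (simp add: n_def)
    have "(i - (n + 1)) div n < n" if "i < n + 1 + n * n"
      using that \<open>n * n > 0\<close> by (intro less_mult_imp_div_less) linarith
    then have "((i - (n + 1)) div n, (i - (n + 1)) mod n) \<in> parcs ?G \<longleftrightarrow>
        csp_arc m B R ((i - (n + 1)) div n) ((i - (n + 1)) mod n)" if "i < n + 1 + n * n"
      using that by (simp add: csp_graph_def n_def)
    moreover have "[False, True] ! (i - (n + 1 + n * n)) \<longleftrightarrow> i \<noteq> n + 1 + n * n"
      if "\<not> i < n + 1 + n * n"
    proof -
      have "i - (n + 1 + n * n) = 0 \<or> i - (n + 1 + n * n) = 1" using i len by linarith
      then show ?thesis using that by auto
    qed
    ultimately have "MCCSP_encode ?G 2 ! i = csp_bit m B N R i"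
      unfolding MCCSP_encode_nth[OF i] n bits csp_bit_def Let_def n_def[symmetric] by simp
    then show "MCCSP_encode ?G 2 ! i = map (csp_bit m B N R) [0..<n + 1 + n * n + 2] ! i"
      using i len by (simp del: upt_Suc)
  qed (simp add: len)
qed

text \<open>The premise on \<open>R\<close> admits definable terms as arguments, because
  \<open>csp_arc\<close> applies \<open>R\<close> to quotients and remainders of the position in the
  matrix.\<close>

theorem csp_reduction:
  assumes "definable (\<lambda>x v. m x)" "definable (\<lambda>x v. B x)" "definable (\<lambda>x v. N x)"
    and "\<And>x. 0 < m x" "\<And>x. 0 < B x"
    and R: "\<And>c i a. definable c \<Longrightarrow> definable i \<Longrightarrow> definable a \<Longrightarrow> decidable (\<lambda>x v. R x (c x v) (i x v) (a x v))"
    and L: "\<And>x. x \<in> L \<longleftrightarrow> csp_sat (m x) (B x) (N x) (R x)"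
  shows "polytime_reducible L MCCSP_D"
proof -
  let ?n = "\<lambda>x. m x * B x + 1 + N x"
  let ?f = "\<lambda>x. map (csp_bit (m x) (B x) (N x) (R x)) [0..<?n x + 1 + ?n x * ?n x + 2]"
  have "polytime_computable ?f"
    by (rule polytime_computable_definable)
      (unfold csp_bit_def Let_def csp_arc_def, (intro definable_intros assms(1-3) R)+)
  moreover have "x \<in> L \<longleftrightarrow> ?f x \<in> MCCSP_D" for x
    using csp_graph_in_MCCSP_D[OF assms(4,5), of x x "N x" "R x"] L
    by (simp only: MCCSP_encode_csp_graph)
  ultimately show ?thesis unfolding polytime_reducible_def by blast
qed

section \<open>Tableaux of Turing machine runs\<close>

lemma length_pair_enc: "length (pair_enc x u) = 2 * length x + 2 + length u"
  by (induction x) (auto simp: pair_enc_def)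

lemma bit_at_Cons: "bit_at (b # x) j = (if j = 0 then b else bit_at x (j - 1))"
  by (cases j) (auto simp: bit_at_def)

lemma bit_at_pair_enc:
  "bit_at (pair_enc x u) j =
    (if j < 2 * length x then bit_at x (j div 2)
     else if j < 2 * length x + 2 then j = 2 * length x + 1
     else bit_at u (j - (2 * length x + 2)))"
proof (induction x arbitrary: j)
  case Nil
  have "pair_enc [] u = False # True # u" by (simp add: pair_enc_def)
  then show ?case by (simp add: bit_at_Cons)
next
  case (Cons b x)
  have eq: "pair_enc (b # x) u = b # b # pair_enc x u" by (simp add: pair_enc_def)
  consider "j = 0" | "j = 1" | l where "j = l + 2"
    by (metis One_nat_def Suc_1 add.commute add_Suc_right add.right_neutral not0_implies_Suc plus_1_eq_Suc)
  then show ?case by cases (auto simp: eq bit_at_Cons Cons)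
qed

text \<open>A row is a state with a full tuple of scanned symbols, used through its index, so that
  one variable determines the next state and all actions. The halting state has rows too, since runs
  are continued to a common length.\<close>

definition tm_rows :: "tm \<Rightarrow> (nat \<times> nat list) list" where
  "tm_rows M = List.product [0..<Suc (tm_states M)] (List.n_lists (tm_tapes M) [0..<tm_syms M])"

definition row_step :: "tm \<Rightarrow> nat \<Rightarrow> nat \<times> (nat \<times> move) list" where
  "row_step M a = (case tm_rows M ! a of (q, ss) \<Rightarrow>
     if q < tm_states M then tm_trans M q ss else (q, stay ss))"

text \<open>The value 0 outside the table, here and below, provides the finite support that
  \<open>definable_table\<close> and \<open>definable_table2\<close> require.\<close>

definition row_state :: "tm \<Rightarrow> nat \<Rightarrow> nat" where
  "row_state M a = (if a < length (tm_rows M) then fst (tm_rows M ! a) else 0)"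

definition row_scan :: "tm \<Rightarrow> nat \<Rightarrow> nat \<Rightarrow> nat" where
  "row_scan M a i = (if a < length (tm_rows M) \<and> i < tm_tapes M then snd (tm_rows M ! a) ! i else 0)"

definition row_next :: "tm \<Rightarrow> nat \<Rightarrow> nat" where
  "row_next M a = (if a < length (tm_rows M) then fst (row_step M a) else 0)"

definition row_write :: "tm \<Rightarrow> nat \<Rightarrow> nat \<Rightarrow> nat" where
  "row_write M a i =
    (if a < length (tm_rows M) \<and> i < tm_tapes M then fst (snd (row_step M a) ! i) else 0)"

text \<open>The head moves by \<open>row_move M a i - 1\<close>.\<close>

definition row_move :: "tm \<Rightarrow> nat \<Rightarrow> nat \<Rightarrow> nat" where
  "row_move M a i = (if a < length (tm_rows M) \<and> i < tm_tapes M
     then nat (shift_head (snd (snd (row_step M a) ! i)) 1) else 0)"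

lemma definable_rows [definable_intros]:
  assumes "definable F"
  shows "definable (\<lambda>x v. row_state M (F x v))" "definable (\<lambda>x v. row_next M (F x v))"
  by (rule definable_table[of "length (tm_rows M)", OF _ assms]; simp add: row_state_def row_next_def)+

lemma definable_rows2 [definable_intros]:
  assumes "definable F" "definable G"
  shows "definable (\<lambda>x v. row_scan M (F x v) (G x v))" "definable (\<lambda>x v. row_write M (F x v) (G x v))"
    "definable (\<lambda>x v. row_move M (F x v) (G x v))"
  by (rule definable_table2[of "length (tm_rows M)" "tm_tapes M", OF _ assms];
      auto simp: row_scan_def row_write_def row_move_def)+

lemma shift_head_eq: "shift_head d h = h + int (nat (shift_head d 1)) - 1"
  by (cases d) auto

section \<open>Configurations and their rows\<close>

definition wf_conf :: "tm \<Rightarrow> tm_config \<Rightarrow> bool" where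
  "wf_conf M c \<longleftrightarrow> fst c \<le> tm_states M \<and> length (snd c) = tm_tapes M \<and>
     (\<forall>i < tm_tapes M. \<forall>z. snd (snd c ! i) z < tm_syms M)"

definition matches :: "tm \<Rightarrow> tm_config \<Rightarrow> nat \<Rightarrow> bool" where
  "matches M c a \<longleftrightarrow> a < length (tm_rows M) \<and> row_state M a = fst c \<and>
     (\<forall>i < tm_tapes M. row_scan M a i = read_tape (snd c ! i))"

lemma read_tape_eq: "read_tape t = snd t (fst t)"
  by (cases t) auto

lemma wf_conf_scan:
  assumes "wf_conf M c"
  shows "length (map read_tape (snd c)) = tm_tapes M"
    "set (map read_tape (snd c)) \<subseteq> {..<tm_syms M}"
proof -
  show "length (map read_tape (snd c)) = tm_tapes M" using assms by (simp add: wf_conf_def)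
  have "read_tape t < tm_syms M" if "t \<in> set (snd c)" for t
  proof -
    obtain i where "i < tm_tapes M" "t = snd c ! i"
      using \<open>t \<in> set (snd c)\<close> assms by (auto simp: in_set_conv_nth wf_conf_def)
    then show ?thesis using assms by (simp add: wf_conf_def read_tape_eq)
  qed
  then show "set (map read_tape (snd c)) \<subseteq> {..<tm_syms M}" by auto
qed

lemma matches_iff:
  assumes "wf_conf M c"
  shows "matches M c a \<longleftrightarrow> a < length (tm_rows M) \<and> tm_rows M ! a = (fst c, map read_tape (snd c))"
proof (cases "a < length (tm_rows M)")
  case True
  obtain q ss where row: "tm_rows M ! a = (q, ss)" by fastforce
  then have "(q, ss) \<in> set (tm_rows M)" using True nth_mem by fastforce
  then have len: "length ss = tm_tapes M" by (auto simp: tm_rows_def set_n_lists)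
  have "matches M c a \<longleftrightarrow> q = fst c \<and> (\<forall>i < tm_tapes M. ss ! i = read_tape (snd c ! i))"
    using True by (auto simp: matches_def row_state_def row_scan_def row)
  moreover have "(\<forall>i < tm_tapes M. ss ! i = read_tape (snd c ! i)) \<longleftrightarrow> ss = map read_tape (snd c)"
    using len assms by (auto simp: wf_conf_def list_eq_iff_nth_eq)
  ultimately show ?thesis using True by (simp add: row)
qed (simp add: matches_def)

lemma matches_exists:
  assumes "wf_conf M c"
  shows "\<exists>a. matches M c a"
proof -
  have "fst c < Suc (tm_states M)" using assms by (simp add: wf_conf_def)
  then have "(fst c, map read_tape (snd c)) \<in> set (tm_rows M)"
    using wf_conf_scan[OF assms] by (simp add: tm_rows_def set_n_lists atLeast0LessThan del: upt_Suc)
  then show ?thesis using matches_iff[OF assms] by (auto simp: in_set_conv_nth)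
qed

lemma row_step_tm_step:
  assumes "wf_tm M" "wf_conf M c" "matches M c a"
  shows "wf_conf M (tm_step M c)" "fst (tm_step M c) = row_next M a"
    "i < tm_tapes M \<Longrightarrow> snd (tm_step M c) ! i =
      (fst (snd c ! i) + int (row_move M a i) - 1,
       (snd (snd c ! i))(fst (snd c ! i) := row_write M a i))"
proof -
  obtain q ts where c: "c = (q, ts)" by fastforce
  have a: "a < length (tm_rows M)" "tm_rows M ! a = (q, map read_tape ts)"
    using matches_iff[OF assms(2)] assms(3) by (auto simp: c)
  have ts: "q \<le> tm_states M" "length ts = tm_tapes M"
    "\<And>i z. i < tm_tapes M \<Longrightarrow> snd (ts ! i) z < tm_syms M"
    using assms(2) by (auto simp: wf_conf_def c)
  obtain q' as where step: "row_step M a = (q', as)" by fastforce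
  have scan: "length (map read_tape ts) = tm_tapes M" "set (map read_tape ts) \<subseteq> {..<tm_syms M}"
    using wf_conf_scan[OF assms(2)] by (simp_all add: c)
  then have as: "q' \<le> tm_states M \<and> length as = tm_tapes M \<and> (\<forall>(w, d) \<in> set as. w < tm_syms M)"
  proof (cases "q < tm_states M")
    case True
    then have "tm_trans M q (map read_tape ts) = (q', as)" using step a by (simp add: row_step_def)
    moreover have "case tm_trans M q (map read_tape ts) of (q', as) \<Rightarrow> q' \<le> tm_states M \<and>
        length as = tm_tapes M \<and> (\<forall>(w, d) \<in> set as. w < tm_syms M)"
      using assms(1) True scan by (simp only: wf_tm_def simp_thms)
    ultimately show ?thesis by simp
  next
    case False
    then have "q' = q" "as = stay (map read_tape ts)" using step a by (auto simp: row_step_def)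
    then show ?thesis using ts(1,2) scan(2) by (auto simp: stay_def)
  qed
  have "tm_step M c = (q', map2 act_tape as ts)"
  proof (cases "q < tm_states M")
    case False
    then have "q' = q" "as = stay (map read_tape ts)" using step a by (auto simp: row_step_def)
    then show ?thesis using False by (simp add: c act_stay)
  qed (use step a in \<open>simp add: row_step_def c\<close>)
  note step_c = this
  show "fst (tm_step M c) = row_next M a" by (simp add: step_c row_next_def a step)
  have tape: "snd (tm_step M c) ! i = (fst (ts ! i) + int (row_move M a i) - 1,
       (snd (ts ! i))(fst (ts ! i) := row_write M a i))" if "i < tm_tapes M" for i
  proof -
    have "snd (tm_step M c) ! i = act_tape (as ! i) (ts ! i)"
      using that as ts(2) by (simp add: step_c)
    also have "\<dots> = (shift_head (snd (as ! i)) (fst (ts ! i)), (snd (ts ! i))(fst (ts ! i) := fst (as ! i)))"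
      by (cases "as ! i"; cases "ts ! i") simp
    finally show ?thesis
      using that a(1) shift_head_eq[of "snd (as ! i)" "fst (ts ! i)"]
      by (simp only: row_move_def row_write_def step snd_conv simp_thms if_True)
  qed
  then show "i < tm_tapes M \<Longrightarrow> snd (tm_step M c) ! i =
      (fst (snd c ! i) + int (row_move M a i) - 1,
       (snd (snd c ! i))(fst (snd c ! i) := row_write M a i))"
    by (simp add: c)
  have "row_write M a i < tm_syms M" if "i < tm_tapes M" for i
  proof -
    have "as ! i \<in> set as" using that as by simp
    then have "fst (as ! i) < tm_syms M" using as by (auto simp: case_prod_beta)
    then show ?thesis using that a(1) by (simp add: row_write_def step)
  qed
  then have "\<forall>i < tm_tapes M. \<forall>z. snd (snd (tm_step M c) ! i) z < tm_syms M"
    using tape ts(3) by simp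
  then show "wf_conf M (tm_step M c)"
    using as ts(2) by (simp add: wf_conf_def step_c)
qed

lemma wf_conf_start:
  assumes "wf_tm M"
  shows "wf_conf M (tm_start M w)"
proof -
  have "cells_of w z < tm_syms M" "cells_of [] z < tm_syms M" for z w
    using assms by (auto simp: cells_of_def wf_tm_def)
  then show ?thesis
    using assms by (auto simp: wf_conf_def tm_start_def wf_tm_def nth_Cons split: nat.split)
qed

lemma wf_conf_run: "wf_tm M \<Longrightarrow> wf_conf M ((tm_step M ^^ t) (tm_start M w))"
proof (induction t)
  case (Suc t)
  then show ?case using matches_exists row_step_tm_step(1) by (metis funpow.simps(2) o_apply)
qed (simp add: wf_conf_start)

text \<open>Within \<open>W\<close> steps a head stays within distance \<open>W\<close> of its
  start. After the shift by \<open>W\<close>, the positions from 0 to \<open>2 * W\<close> therefore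
  contain everything that matters.\<close>

lemma head_run_bound:
  assumes "wf_tm M" "i < tm_tapes M"
  shows "\<bar>fst (snd ((tm_step M ^^ t) (tm_start M w)) ! i)\<bar> \<le> int t"
proof (induction t)
  case 0
  then show ?case using assms(2) by (auto simp: tm_start_def nth_Cons split: nat.split)
next
  case (Suc t)
  let ?c = "(tm_step M ^^ t) (tm_start M w)"
  have wf: "wf_conf M ?c" by (rule wf_conf_run[OF assms(1)])
  then obtain a where a: "matches M ?c a" using matches_exists by blast
  have "row_move M a i \<le> 2"
  proof -
    have "nat (shift_head d 1) \<le> 2" for d by (cases d) auto
    then show ?thesis by (simp add: row_move_def)
  qed
  moreover have "fst (snd ((tm_step M ^^ Suc t) (tm_start M w)) ! i) = fst (snd ?c ! i) + int (row_move M a i) - 1"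
    using row_step_tm_step(3)[OF assms(1) wf a assms(2)] by simp
  ultimately show ?case using Suc by linarith
qed

text \<open>Lets all runs be followed to the same time \<open>W\<close>, whenever they halt.\<close>

lemma tm_halted:
  assumes "(tm_step M ^^ t) c = (tm_states M, ts)" "t \<le> s"
  shows "(tm_step M ^^ s) c = (tm_states M, ts)"
proof -
  have fixed: "(tm_step M ^^ d) (tm_states M, ts) = (tm_states M, ts)" for d
    by (induction d) auto
  have "(tm_step M ^^ s) c = (tm_step M ^^ (s - t)) ((tm_step M ^^ t) c)"
    using assms(2) by (metis comp_apply funpow_add le_add_diff_inverse2)
  then show ?thesis using assms(1) fixed by simp
qed

lemma poly_mono_nat: "m \<le> n \<Longrightarrow> poly p m \<le> poly p (n :: nat)"
  by (induction p) (auto intro!: add_mono mult_mono)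

text \<open>The possible symbols at position \<open>j - W\<close> of tape \<open>i\<close> when the input is some \<open>pair_enc x u\<close>.\<close>

definition init_ok :: "bool list \<Rightarrow> nat \<Rightarrow> nat \<Rightarrow> nat \<Rightarrow> nat \<Rightarrow> nat \<Rightarrow> bool" where
  "init_ok x P W i j s \<longleftrightarrow>
    (if i \<noteq> 0 \<or> j < W then s = 0
     else if j < W + (2 * length x + 2) then
       s = (if (if j - W < 2 * length x then bit_at x ((j - W) div 2) else j - W = 2 * length x + 1)
            then 2 else 1)
     else if j < W + (2 * length x + 2 + P) then s < 3 else s = 0)"

text \<open>
  A run of \<open>M\<close> for \<open>W\<close> steps on some \<open>pair_enc x u\<close>: \<open>X t\<close> is the row of the transition table
  that is applied at time \<open>t\<close>, \<open>H t i\<close> is the position of head \<open>i\<close>, and \<open>C t i j\<close> is the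
  symbol at position \<open>j\<close> of tape \<open>i\<close>. Positions are shifted by \<open>W\<close>.
\<close>

locale tableau =
  fixes M :: tm and P W :: nat and x :: "bool list" and X :: "nat \<Rightarrow> nat"
    and H :: "nat \<Rightarrow> nat \<Rightarrow> nat" and C :: "nat \<Rightarrow> nat \<Rightarrow> nat \<Rightarrow> nat"
  assumes scan: "\<forall>t\<le>W. \<forall>i<tm_tapes M. H t i \<le> 2 * W \<longrightarrow> C t i (H t i) = row_scan M (X t) i"
    and state_step: "\<forall>t<W. row_state M (X (Suc t)) = row_next M (X t)"
    and head_step: "\<forall>t<W. \<forall>i<tm_tapes M. H t i \<le> 2 * W \<longrightarrow>
      Suc (H (Suc t) i) = H t i + row_move M (X t) i"
    and write_step: "\<forall>t<W. \<forall>i<tm_tapes M. H t i \<le> 2 * W \<longrightarrow>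
      C (Suc t) i (H t i) = row_write M (X t) i"
    and frame_step: "\<forall>t<W. \<forall>i<tm_tapes M. \<forall>j\<le>2 * W. C t i j < tm_syms M \<longrightarrow> H t i \<noteq> j \<longrightarrow>
      C (Suc t) i j = C t i j"
    and row: "\<forall>t\<le>W. X t < length (tm_rows M)"
    and start_state: "row_state M (X 0) = 0"
    and start_head: "\<forall>i<tm_tapes M. H 0 i = W"
    and start_tape: "\<forall>i<tm_tapes M. \<forall>j\<le>2 * W. init_ok x P W i j (C 0 i j)"
    and start_blank: "\<forall>j. W + (2 * length x + 2) \<le> j \<longrightarrow> j < 2 * W \<longrightarrow> C 0 0 j = 0 \<longrightarrow> C 0 0 (Suc j) = 0"
    and final_state: "row_state M (X W) = tm_states M"
    and final_output: "C W (tm_tapes M - 1) W = 2"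

text \<open>\<open>init_ok\<close> leaves it open which of the \<open>P\<close> cells after the
  separator are blank. Since blanks are followed by blanks only, the others form an initial segment,
  and this is \<open>u\<close>; its length is the offset \<open>l\<close> of the first
  blank.\<close>

lemma tableau_input:
  assumes "2 * length x + 2 + P \<le> W" "\<And>j. j \<le> 2 * W \<Longrightarrow> init_ok x P W 0 j (c j)"
    and mono: "\<And>j. W + (2 * length x + 2) \<le> j \<Longrightarrow> j < 2 * W \<Longrightarrow> c j = 0 \<Longrightarrow> c (Suc j) = 0"
  shows "\<exists>u. length u \<le> P \<and> (\<forall>j\<le>2 * W. c j = cells_of (pair_enc x u) (int j - int W))"
proof -
  let ?o = "W + (2 * length x + 2)"
  define l where "l = (LEAST l. c (?o + l) = 0)"
  \<comment> \<open>A blank inside the tableau, so that the least one exists and has offset at most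
    \<open>P\<close>.\<close>
  have "c (?o + P) = 0" using assms(1) assms(2)[of "?o + P"] by (simp add: init_ok_def)
  then have l: "c (?o + l) = 0" "l \<le> P" and less: "\<And>i. i < l \<Longrightarrow> c (?o + i) \<noteq> 0"
    unfolding l_def by (auto intro: LeastI Least_le dest: not_less_Least)
  have zero: "?o + l + d \<le> 2 * W \<Longrightarrow> c (?o + l + d) = 0" for d
  proof (induction d)
    case (Suc d)
    then have "c (Suc (?o + l + d)) = 0" by (intro mono) auto
    then show ?case by simp
  qed (use l in simp)
  have nonzero: "c (?o + i) = 1 \<or> c (?o + i) = 2" if "i < l" for i
  proof -
    have "?o + i \<le> 2 * W" using that l(2) assms(1) by simp
    then have "c (?o + i) < 3" using assms(2)[of "?o + i"] that l(2) by (simp add: init_ok_def)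
    with less[OF that] show ?thesis by linarith
  qed
  define u where "u = map (\<lambda>i. c (?o + i) = 2) [0..<l]"
  have "c j = cells_of (pair_enc x u) (int j - int W)" if j: "j \<le> 2 * W" for j
  proof -
    consider "j < W" | "W \<le> j" "j < ?o" | "?o \<le> j" by linarith
    then show ?thesis
    proof cases
      case 1
      then show ?thesis using assms(2)[OF j] by (simp add: init_ok_def cells_of_def)
    next
      case 2
      then have eq: "int j - int W = int (j - W)" by simp
      have "j - W < 2 * length x + 2" using 2 by linarith
      then show ?thesis
        unfolding eq cells_of_nat
        using 2 assms(2)[OF j] by (simp add: init_ok_def bit_at_pair_enc length_pair_enc)
    next
      case 3
      define i where "i = j - ?o"
      have i: "j = ?o + i" using 3 by (simp add: i_def)
      then have cell: "cells_of (pair_enc x u) (int j - int W)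
          = (if i < l then if c (?o + i) = 2 then 2 else 1 else 0)"
      proof -
        have "int j - int W = int (2 * length x + 2 + i)" using i by simp
        moreover have "bit_at u i = (c (?o + i) = 2)" if "i < l" using that by (simp add: u_def bit_at_def)
        moreover have "length u = l" by (simp add: u_def)
        ultimately show ?thesis
          by (simp only: cells_of_nat bit_at_pair_enc length_pair_enc) simp
      qed
      show ?thesis
      proof (cases "i < l")
        case True
        then show ?thesis using cell nonzero[OF True] i by auto
      next
        case False
        then have "j = ?o + l + (i - l)" using i by simp
        then show ?thesis using cell zero[of "i - l"] False j by simp
      qed
    qed
  qed
  then show ?thesis using l(2) by (intro exI[of _ u]) (simp add: u_def)
qed

text \<open>The initial tape fixes \<open>u\<close>. From then on determinism leaves no choice: by
  induction on the time, the tableau is the run shifted by \<open>W\<close>, as far as the cells up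
  to \<open>2 * W\<close> are concerned.\<close>

lemma tableau_run:
  assumes M: "wf_tm M" and "2 * length x + 2 + P \<le> W" and tab: "tableau M P W x X H C"
  shows "\<exists>u ts. length u \<le> P \<and>
    (tm_step M ^^ W) (tm_start M (pair_enc x u)) = (tm_states M, ts) \<and>
    length ts = tm_tapes M \<and> snd (last ts) 0 = 2"
proof -
  let ?k = "tm_tapes M"
  have k: "?k \<ge> 1" using M by (simp add: wf_tm_def)
  note tab = tab[unfolded tableau_def]
  have "\<exists>u. length u \<le> P \<and> (\<forall>j\<le>2 * W. C 0 0 j = cells_of (pair_enc x u) (int j - int W))"
    by (rule tableau_input[OF assms(2)]) (use tab k in auto)
  then obtain u where u: "length u \<le> P"
    "\<And>j. j \<le> 2 * W \<Longrightarrow> C 0 0 j = cells_of (pair_enc x u) (int j - int W)" by blast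
  define c where "c = (\<lambda>t. (tm_step M ^^ t) (tm_start M (pair_enc x u)))"
  have wf: "wf_conf M (c t)" for t unfolding c_def by (rule wf_conf_run[OF M])
  have bound: "\<bar>fst (snd (c t) ! i)\<bar> \<le> int t" if "i < ?k" for t i
    unfolding c_def by (rule head_run_bound[OF M that])
  define inv where "inv = (\<lambda>t. fst (c t) = row_state M (X t) \<and>
    (\<forall>i<?k. int (H t i) = fst (snd (c t) ! i) + int W \<and>
      (\<forall>j\<le>2 * W. C t i j = snd (snd (c t) ! i) (int j - int W))))"
  \<comment> \<open>Discharges the guards \<open>H t i \<le> 2 * W\<close> of the tableau
    conditions.\<close>
  have H: "H t i \<le> 2 * W" if "inv t" "i < ?k" "t \<le> W" for t i
    using that bound[OF that(2), of t] unfolding inv_def by fastforce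
  have matches: "matches M (c t) (X t)" if "inv t" "t \<le> W" for t
    unfolding matches_def
  proof (intro conjI allI impI)
    show "X t < length (tm_rows M)" using tab that(2) by blast
    show "row_state M (X t) = fst (c t)" using that(1) by (simp add: inv_def)
    fix i assume i: "i < ?k"
    have "row_scan M (X t) i = C t i (H t i)" using tab that i H[OF that(1) i that(2)] by simp
    also have "\<dots> = snd (snd (c t) ! i) (int (H t i) - int W)"
      using that(1) i H[OF that(1) i that(2)] by (simp add: inv_def)
    also have "int (H t i) - int W = fst (snd (c t) ! i)" using that(1) i by (simp add: inv_def)
    finally show "row_scan M (X t) i = read_tape (snd (c t) ! i)" by (simp add: read_tape_eq)
  qed
  have "inv t" if "t \<le> W" for t
    using that
  proof (induction t)
    case 0
    have "fst (snd (c 0) ! i) = 0 \<and> snd (snd (c 0) ! i) = (if i = 0 then cells_of (pair_enc x u) else cells_of [])"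
      if "i < ?k" for i
      using that by (cases i) (auto simp: c_def tm_start_def)
    moreover have "C 0 i j = (if i = 0 then cells_of (pair_enc x u) else cells_of []) (int j - int W)"
      if "i < ?k" "j \<le> 2 * W" for i j
    proof (cases "i = 0")
      case False
      have "init_ok x P W i j (C 0 i j)" using tab that by blast
      then show ?thesis using False by (simp add: init_ok_def cells_of_def)
    qed (use u(2) that in simp)
    moreover have "fst (c 0) = 0" by (simp add: c_def tm_start_def)
    ultimately show ?case using tab by (simp add: inv_def)
  next
    case (Suc t)
    then have t: "t < W" "t \<le> W" and inv: "inv t" by auto
    note m = matches[OF inv t(2)]
    have c_Suc: "c (Suc t) = tm_step M (c t)" by (simp add: c_def)
    note step = row_step_tm_step[OF M wf m, folded c_Suc]
    have "int (H (Suc t) i) = fst (snd (c (Suc t)) ! i) + int W \<and>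
      (\<forall>j\<le>2 * W. C (Suc t) i j = snd (snd (c (Suc t)) ! i) (int j - int W))" if i: "i < ?k" for i
    proof (intro conjI allI impI)
      have Hi: "int (H t i) = fst (snd (c t) ! i) + int W" using inv i by (simp add: inv_def)
      have "Suc (H (Suc t) i) = H t i + row_move M (X t) i"
        using tab t i H[OF inv i t(2)] by simp
      then have "int (H (Suc t) i) + 1 = int (H t i) + int (row_move M (X t) i)" by linarith
      with Hi show "int (H (Suc t) i) = fst (snd (c (Suc t)) ! i) + int W"
        by (simp add: step(3)[OF i])
      fix j assume j: "j \<le> 2 * W"
      have Cj: "C t i j = snd (snd (c t) ! i) (int j - int W)" using inv i j by (simp add: inv_def)
      show "C (Suc t) i j = snd (snd (c (Suc t)) ! i) (int j - int W)"
      proof (cases "j = H t i")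
        case True
        then have "C (Suc t) i j = row_write M (X t) i" using tab t i H[OF inv i t(2)] by simp
        then show ?thesis using True Hi by (simp add: step(3)[OF i])
      next
        case False
        have "C t i j < tm_syms M" using Cj wf[of t] i by (simp add: wf_conf_def)
        then have "C (Suc t) i j = C t i j" using tab t i j False by auto
        moreover have "int j - int W \<noteq> fst (snd (c t) ! i)" using False Hi by linarith
        ultimately show ?thesis using Cj by (simp add: step(3)[OF i])
      qed
    qed
    moreover have "fst (c (Suc t)) = row_state M (X (Suc t))" using tab t step(2) by simp
    ultimately show ?case by (simp add: inv_def)
  qed
  then have inv: "inv W" by simp
  obtain q ts where qts: "c W = (q, ts)" by fastforce
  have len: "length ts = ?k" using wf[of W] by (simp add: wf_conf_def qts)
  have "last ts = ts ! (?k - 1)" using len k by (subst last_conv_nth) auto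
  moreover have "C W (?k - 1) W = snd (ts ! (?k - 1)) (int W - int W)"
    using inv k by (simp add: inv_def qts)
  ultimately have "snd (last ts) 0 = 2" using tab by simp
  moreover have "q = tm_states M" using inv tab by (simp add: inv_def qts)
  ultimately show ?thesis using u(1) qts len unfolding c_def by blast
qed

text \<open>The additional bounds on \<open>H\<close> and \<open>C\<close> make these values fit
  into the domain of the constraint problem.\<close>

lemma run_tableau:
  assumes M: "wf_tm M" and "2 * length x + 2 + P \<le> W" and u: "length u \<le> P"
    and "(tm_step M ^^ W) (tm_start M (pair_enc x u)) = (tm_states M, ts)" "snd (last ts) 0 = 2"
  shows "\<exists>X H C. tableau M P W x X H C \<and> (\<forall>t\<le>W. \<forall>i<tm_tapes M. H t i \<le> 2 * W) \<and>
    (\<forall>t. \<forall>i<tm_tapes M. \<forall>j. C t i j < tm_syms M)"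
proof -
  let ?k = "tm_tapes M"
  have k: "?k \<ge> 1" using M by (simp add: wf_tm_def)
  define c where "c = (\<lambda>t. (tm_step M ^^ t) (tm_start M (pair_enc x u)))"
  have wf: "wf_conf M (c t)" for t unfolding c_def by (rule wf_conf_run[OF M])
  have bound: "\<bar>fst (snd (c t) ! i)\<bar> \<le> int t" if "i < ?k" for t i
    unfolding c_def by (rule head_run_bound[OF M that])
  obtain X where X: "\<And>t. matches M (c t) (X t)" using matches_exists[OF wf] by metis
  define H where "H = (\<lambda>t i. nat (fst (snd (c t) ! i) + int W))"
  define C where "C = (\<lambda>t i j. snd (snd (c t) ! i) (int j - int W))"
  have H: "int (H t i) = fst (snd (c t) ! i) + int W" "H t i \<le> 2 * W" if "i < ?k" "t \<le> W" for t i
    using bound[OF that(1), of t] that(2) by (auto simp: H_def)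
  have c_Suc: "c (Suc t) = tm_step M (c t)" for t by (simp add: c_def)
  note step = row_step_tm_step[OF M wf X, folded c_Suc]
  have start: "snd (c 0) ! i = (0, if i = 0 then cells_of (pair_enc x u) else cells_of [])" if "i < ?k" for i
    using that by (cases i) (auto simp: c_def tm_start_def)
  have cW: "c W = (tm_states M, ts)" using assms(4) by (simp add: c_def)
  then have "length ts = ?k" using wf[of W] by (simp add: wf_conf_def)
  then have last: "last ts = ts ! (?k - 1)" using k by (subst last_conv_nth) auto
  have init: "init_ok x P W i j (C 0 i j)" if "i < ?k" for i j
  proof -
    consider "i \<noteq> 0" | "i = 0" "j < W" | z where "i = 0" "j = W + z" by (metis le_add_diff_inverse not_less)
    then show ?thesis
    proof cases
      case (3 z)
      then have "C 0 i j = (if z < length (pair_enc x u) then if bit_at (pair_enc x u) z then 2 else 1 else 0)"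
        using start[OF that] by (simp add: C_def cells_of_nat)
      then show ?thesis
        using 3 u unfolding init_ok_def by (simp add: bit_at_pair_enc length_pair_enc)
    qed (use start[OF that] in \<open>simp_all add: C_def init_ok_def cells_of_def\<close>)
  qed
  have mono: "C 0 0 (Suc j) = 0" if "W + (2 * length x + 2) \<le> j" "C 0 0 j = 0" for j
  proof -
    define z where "z = j - W"
    have j: "j = W + z" using that(1) by (simp add: z_def)
    have "C 0 0 (W + y) = (if y < length (pair_enc x u) then if bit_at (pair_enc x u) y then 2 else 1 else 0)" for y
      using start[of 0] k by (simp add: C_def cells_of_nat)
    from this[of z] this[of "Suc z"] show ?thesis using that(2) j by (simp split: if_splits)
  qed
  have "tableau M P W x X H C"
    unfolding tableau_def
  proof (intro conjI allI impI)
    fix t i assume t: "t \<le> W" and i: "i < ?k"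
    have "C t i (H t i) = read_tape (snd (c t) ! i)" using H(1)[OF i t] by (simp add: C_def read_tape_eq)
    then show "C t i (H t i) = row_scan M (X t) i" using X[of t] i by (simp add: matches_def)
  next
    fix t
    show "row_state M (X (Suc t)) = row_next M (X t)"
      using X[of "Suc t"] step(2)[of t] by (simp add: matches_def)
  next
    fix t i assume t: "t < W" and i: "i < ?k"
    show "Suc (H (Suc t) i) = H t i + row_move M (X t) i"
      using H(1)[OF i, of t] H(1)[OF i, of "Suc t"] t step(3)[OF i, of t] by simp
    show "C (Suc t) i (H t i) = row_write M (X t) i"
      using H(1)[OF i, of t] t step(3)[OF i, of t] by (simp add: C_def)
    fix j assume "H t i \<noteq> j"
    then have "int j - int W \<noteq> fst (snd (c t) ! i)" using H(1)[OF i, of t] t by linarith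
    then show "C (Suc t) i j = C t i j" using step(3)[OF i, of t] by (simp add: C_def)
  next
    fix t show "X t < length (tm_rows M)" using X[of t] by (simp add: matches_def)
  next
    show "row_state M (X 0) = 0" using X[of 0] by (simp add: matches_def c_def tm_start_def)
    show "H 0 i = W" if "i < ?k" for i using start[OF that] by (simp add: H_def)
    show "row_state M (X W) = tm_states M" using X[of W] by (simp add: matches_def cW)
    show "C W (?k - 1) W = 2" using assms(5) last by (simp add: C_def cW)
  qed (use init mono in auto)
  moreover have "C t i j < tm_syms M" if "i < ?k" for t i j
    using wf[of t] that by (simp add: wf_conf_def C_def)
  ultimately show ?thesis using H(2) by blast
qed

section \<open>The tableau as a constraint satisfaction problem\<close>

definition tvar :: "nat \<Rightarrow> nat \<Rightarrow> nat \<Rightarrow> nat \<Rightarrow> nat \<Rightarrow> nat" where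
  "tvar B r t i j = ((r * B + t) * B + i) * B + j"

text \<open>
  The clauses of the tableau, by kind \<open>r\<close>. The variable \<open>X t\<close> is \<open>tvar B 0 t 0 0\<close>, the variable
  \<open>H t i\<close> is \<open>tvar B 1 t i 0\<close>, and \<open>C t i j\<close> is \<open>tvar B 2 t i j\<close>.
\<close>

definition tab_clause ::
  "tm \<Rightarrow> nat \<Rightarrow> nat \<Rightarrow> nat \<Rightarrow> bool list \<Rightarrow> nat \<Rightarrow> nat \<Rightarrow> nat \<Rightarrow> nat \<Rightarrow> nat \<Rightarrow> nat \<Rightarrow> nat \<Rightarrow> bool" where
  "tab_clause M P W B x r t i j a y s \<longleftrightarrow>
    (r = 0 \<longrightarrow> t \<le> W \<and> i < tm_tapes M \<and> j \<le> 2 * W \<and> a < length (tm_rows M) \<longrightarrow>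
      y = tvar B 0 t 0 0 \<and> s \<noteq> a \<or> y = tvar B 1 t i 0 \<and> s \<noteq> j \<or>
      y = tvar B 2 t i j \<and> s = row_scan M a i) \<and>
    (r = 1 \<longrightarrow> t < W \<and> a < length (tm_rows M) \<longrightarrow>
      y = tvar B 0 t 0 0 \<and> s \<noteq> a \<or> y = tvar B 0 (Suc t) 0 0 \<and> row_state M s = row_next M a) \<and>
    (r = 2 \<longrightarrow> t < W \<and> i < tm_tapes M \<and> j \<le> 2 * W \<and> a < length (tm_rows M) \<longrightarrow>
      y = tvar B 0 t 0 0 \<and> s \<noteq> a \<or> y = tvar B 1 t i 0 \<and> s \<noteq> j \<or>
      y = tvar B 1 (Suc t) i 0 \<and> Suc s = j + row_move M a i) \<and>
    (r = 3 \<longrightarrow> t < W \<and> i < tm_tapes M \<and> j \<le> 2 * W \<and> a < length (tm_rows M) \<longrightarrow>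
      y = tvar B 0 t 0 0 \<and> s \<noteq> a \<or> y = tvar B 1 t i 0 \<and> s \<noteq> j \<or>
      y = tvar B 2 (Suc t) i j \<and> s = row_write M a i) \<and>
    (r = 4 \<longrightarrow> t < W \<and> i < tm_tapes M \<and> j \<le> 2 * W \<and> a < tm_syms M \<longrightarrow>
      y = tvar B 2 t i j \<and> s \<noteq> a \<or> y = tvar B 1 t i 0 \<and> s = j \<or> y = tvar B 2 (Suc t) i j \<and> s = a) \<and>
    (r = 5 \<longrightarrow> t \<le> W \<longrightarrow> y = tvar B 0 t 0 0 \<and> s < length (tm_rows M)) \<and>
    (r = 6 \<longrightarrow> y = tvar B 0 0 0 0 \<and> row_state M s = 0) \<and>
    (r = 7 \<longrightarrow> i < tm_tapes M \<longrightarrow> y = tvar B 1 0 i 0 \<and> s = W) \<and>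
    (r = 8 \<longrightarrow> i < tm_tapes M \<and> j \<le> 2 * W \<longrightarrow> y = tvar B 2 0 i j \<and> init_ok x P W i j s) \<and>
    (r = 9 \<longrightarrow> W + (2 * length x + 2) \<le> j \<and> j < 2 * W \<longrightarrow>
      y = tvar B 2 0 0 j \<and> s \<noteq> 0 \<or> y = tvar B 2 0 0 (Suc j) \<and> s = 0) \<and>
    (r = 10 \<longrightarrow> y = tvar B 0 W 0 0 \<and> row_state M s = tm_states M) \<and>
    (r = 11 \<longrightarrow> y = tvar B 2 W (tm_tapes M - 1) W \<and> s = 2)"

lemma tvar_less: "r < R \<Longrightarrow> t < B \<Longrightarrow> i < B \<Longrightarrow> j < B \<Longrightarrow> tvar B r t i j < R * B * B * B"
proof -
  assume less: "r < R" "t < B" "i < B" "j < B"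
  have step: "a * B + b < c * B" if "a < c" "b < B" for a b c
    using mult_le_mono1[of "Suc a" c B] that unfolding mult_Suc by linarith
  show ?thesis unfolding tvar_def by (intro step less)
qed

lemma tvar_div_mod:
  assumes "t < B" "i < B" "j < B"
  shows "tvar B r t i j mod B = j" "tvar B r t i j div B mod B = i"
    "tvar B r t i j div B div B mod B = t" "tvar B r t i j div B div B div B = r"
proof -
  have "(a * B + b) mod B = b" "(a * B + b) div B = a" if "b < B" for a b
    using that by simp_all
  then show "tvar B r t i j mod B = j" "tvar B r t i j div B mod B = i"
    "tvar B r t i j div B div B mod B = t" "tvar B r t i j div B div B div B = r"
    using assms by (simp_all add: tvar_def)
qed

text \<open>The number of a clause has the digits \<open>r\<close>, \<open>t\<close>,
  \<open>i\<close>, \<open>j\<close>, \<open>a\<close> in base \<open>B\<close>. Twelve kinds of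
  clauses and three kinds of variables account for the sizes \<open>12 * B * B * B * B\<close> and
  \<open>3 * B * B * B\<close> below. For each \<open>r\<close>, all conjuncts of
  \<open>tab_clause\<close> but one are vacuous.\<close>

definition tab_rel :: "tm \<Rightarrow> nat \<Rightarrow> nat \<Rightarrow> nat \<Rightarrow> bool list \<Rightarrow> nat \<Rightarrow> nat \<Rightarrow> nat \<Rightarrow> bool" where
  "tab_rel M P W B x c y s = tab_clause M P W B x (c div B div B div B div B)
     (c div B div B div B mod B) (c div B div B mod B) (c div B mod B) (c mod B) y s"

text \<open>The transition clauses are implications over all possible values \<open>a\<close> and
  \<open>j\<close>. Taking the actual row or symbol and the actual head position for these refutes
  the disjuncts with \<noteq>, and what remains is the tableau condition.\<close>

lemma csp_sat_imp_tableau: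
  assumes B: "2 * W + 2 \<le> B" "length (tm_rows M) \<le> B" "tm_syms M \<le> B" "tm_tapes M \<le> B"
    and k: "tm_tapes M \<ge> 1"
    and sat: "csp_sat (3 * B * B * B) B (12 * B * B * B * B) (tab_rel M P W B x)"
  shows "\<exists>X H C. tableau M P W x X H C"
proof -
  obtain f where f: "\<And>c. c < 12 * B * B * B * B \<Longrightarrow> \<exists>y < 3 * B * B * B. tab_rel M P W B x c y (f y)"
    using sat unfolding csp_sat_def by auto
  have clause: "\<exists>y. tab_clause M P W B x r t i j a y (f y)"
    if "r < 12" "t < B" "i < B" "j < B" "a < B" for r t i j a
  proof -
    let ?c = "tvar B r t i j * B + a"
    have div: "?c div B = tvar B r t i j" "?c mod B = a" using that by simp_all
    have "?c < Suc (tvar B r t i j) * B" using that by simp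
    also have "\<dots> \<le> 12 * B * B * B * B"
      using tvar_less[OF that(1-4)] by (intro mult_le_mono1) simp
    finally obtain y where "tab_rel M P W B x ?c y (f y)" using f by blast
    then show ?thesis unfolding tab_rel_def div tvar_div_mod[OF that(2-4)] by blast
  qed
  define X where "X = (\<lambda>t. f (tvar B 0 t 0 0))"
  define H where "H = (\<lambda>t i. f (tvar B 1 t i 0))"
  define C where "C = (\<lambda>t i j. f (tvar B 2 t i j))"
  have vars: "f (tvar B 0 t 0 0) = X t" "f (tvar B 1 t i 0) = H t i" "f (tvar B 2 t i j) = C t i j"
    for t i j by (simp_all add: X_def H_def C_def)
  note defs = tab_clause_def vars vars(2)[unfolded One_nat_def]
  have W: "t < B" "Suc t < B" if "t \<le> W" for t using that B(1) by auto
  have j: "j < B" if "j \<le> 2 * W" for j using that B(1) by simp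
  have i: "i < B" if "i < tm_tapes M" for i using that B(4) by simp
  have zero: "0 < B" using B(1) by simp
  have X: "X t < length (tm_rows M)" if "t \<le> W" for t
    using clause[of 5 t 0 0 0] W[OF that] zero that by (auto simp: defs)
  then have XB: "X t < B" if "t \<le> W" for t using that B(2) by fastforce
  have "tableau M P W x X H C"
    unfolding tableau_def
  proof (intro conjI allI impI)
    fix t r assume "t \<le> W" "r < tm_tapes M" "H t r \<le> 2 * W"
    then show "C t r (H t r) = row_scan M (X t) r"
      using clause[of 0 t r "H t r" "X t"] W j i X XB by (auto simp: defs)
  next
    fix t assume "t < W"
    then show "row_state M (X (Suc t)) = row_next M (X t)"
      using clause[of 1 t 0 0 "X t"] W X XB zero by (auto simp: defs)
  next
    fix t r assume "t < W" "r < tm_tapes M" "H t r \<le> 2 * W"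
    then show "Suc (H (Suc t) r) = H t r + row_move M (X t) r"
      using clause[of 2 t r "H t r" "X t"] W j i X XB by (auto simp: defs)
  next
    fix t r assume "t < W" "r < tm_tapes M" "H t r \<le> 2 * W"
    then show "C (Suc t) r (H t r) = row_write M (X t) r"
      using clause[of 3 t r "H t r" "X t"] W j i X XB by (auto simp: defs)
  next
    fix t r l assume "t < W" "r < tm_tapes M" "l \<le> 2 * W" "C t r l < tm_syms M" "H t r \<noteq> l"
    then show "C (Suc t) r l = C t r l"
      using clause[of 4 t r l "C t r l"] W j i B(3) by (auto simp: defs)
  next
    show "row_state M (X 0) = 0"
      using clause[of 6 0 0 0 0] zero by (auto simp: defs)
  next
    fix r assume "r < tm_tapes M"
    then show "H 0 r = W"
      using clause[of 7 0 r 0 0] zero i by (auto simp: defs)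
  next
    fix r l assume "r < tm_tapes M" "l \<le> 2 * W"
    then show "init_ok x P W r l (C 0 r l)"
      using clause[of 8 0 r l 0] zero i j by (auto simp: defs)
  next
    fix l assume "W + (2 * length x + 2) \<le> l" "l < 2 * W" "C 0 0 l = 0"
    then show "C 0 0 (Suc l) = 0"
      using clause[of 9 0 0 l 0] zero j by (auto simp: defs)
  next
    show "row_state M (X W) = tm_states M"
      using clause[of 10 0 0 0 0] zero by (auto simp: defs)
  next
    show "C W (tm_tapes M - 1) W = 2"
      using clause[of 11 0 0 0 0] zero by (auto simp: defs)
  qed (use X in blast)
  then show ?thesis by blast
qed

lemma tableau_imp_csp_sat:
  assumes B: "2 * W + 2 \<le> B" "length (tm_rows M) \<le> B" "tm_syms M \<le> B" "tm_tapes M \<le> B"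
    and k: "tm_tapes M \<ge> 1"
    and T: "tableau M P W x X H C" "\<And>t i. t \<le> W \<Longrightarrow> i < tm_tapes M \<Longrightarrow> H t i \<le> 2 * W"
      "\<And>t i j. i < tm_tapes M \<Longrightarrow> C t i j < tm_syms M"
  shows "csp_sat (3 * B * B * B) B (12 * B * B * B * B) (tab_rel M P W B x)"
proof -
  interpret tab: tableau M P W x X H C by (rule T(1))
  have T0: "C t i (H t i) = row_scan M (X t) i" if "t \<le> W" "i < tm_tapes M" for t i
    using tab.scan T(2)[OF that] that by blast
  have T1: "row_state M (X (Suc t)) = row_next M (X t)" if "t < W" for t
    using tab.state_step that by blast
  have T2: "Suc (H (Suc t) i) = H t i + row_move M (X t) i" if "t < W" "i < tm_tapes M" for t i
    using tab.head_step T(2)[OF less_imp_le[OF that(1)] that(2)] that by blast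
  have T3: "C (Suc t) i (H t i) = row_write M (X t) i" if "t < W" "i < tm_tapes M" for t i
    using tab.write_step T(2)[OF less_imp_le[OF that(1)] that(2)] that by blast
  have T4: "H t i = j \<or> C (Suc t) i j = C t i j" if "t < W" "i < tm_tapes M" "j \<le> 2 * W" for t i j
    using tab.frame_step T(3)[OF that(2)] that by blast
  have T5: "X t < length (tm_rows M)" if "t \<le> W" for t using tab.row that by blast
  have T6: "row_state M (X 0) = 0" using tab.start_state by blast
  have T7: "H 0 i = W" if "i < tm_tapes M" for i using tab.start_head that by blast
  have T8: "init_ok x P W i j (C 0 i j)" if "i < tm_tapes M" "j \<le> 2 * W" for i j
    using tab.start_tape that by blast
  have T9: "C 0 0 (Suc j) = 0" if "W + (2 * length x + 2) \<le> j" "j < 2 * W" "C 0 0 j = 0" for j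
    using tab.start_blank that by blast
  have T10: "row_state M (X W) = tm_states M" using tab.final_state by blast
  have T11: "C W (tm_tapes M - 1) W = 2" using tab.final_output by blast
  define g where "g = (\<lambda>y. let j = y mod B; i = y div B mod B; t = y div B div B mod B;
    r = y div B div B div B in if r = 0 then X t else if r = 1 then H t i else C t i j)"
  \<comment> \<open>Numbers that do not stand for a tableau entry might get values beyond the
    domain; these are replaced by 0.\<close>
  define f where "f = (\<lambda>y. if g y < B then g y else 0)"
  have zero: "0 < B" using B(1) by simp
  have W: "t < B" if "t \<le> W" for t using that B(1) by auto
  have j: "j < B" if "j \<le> 2 * W" for j using that B(1) by simp
  have i: "i < B" if "i < tm_tapes M" for i using that B(4) by simp
  have fX: "f (tvar B 0 t 0 0) = X t" if "t \<le> W" for t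
  proof -
    show ?thesis using T5[OF that] B(2) W[OF that] zero by (simp add: f_def g_def Let_def tvar_div_mod)
  qed
  have fH: "f (tvar B 1 t i 0) = H t i" if "t \<le> W" "i < tm_tapes M" for t i
    using T(2)[OF that] j W[OF that(1)] i[OF that(2)] zero
    by (simp add: f_def g_def Let_def tvar_div_mod)
  have fC: "f (tvar B 2 t i j) = C t i j" if "t \<le> W" "i < tm_tapes M" "j \<le> 2 * W" for t i j
    using T(3)[OF that(2), of t j] B(3) W[OF that(1)] i[OF that(2)] j[OF that(3)]
    by (simp add: f_def g_def Let_def tvar_div_mod)
  note fs = fX fH fC fH[unfolded One_nat_def]
  let ?m = "3 * B * B * B"
  have v: "tvar B 0 t 0 0 < ?m" if "t \<le> W" for t
    using W[OF that] zero by (intro tvar_less) auto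
  have v1: "tvar B 1 t l 0 < ?m" if "t \<le> W" "l < tm_tapes M" for t l
    using W[OF that(1)] i[OF that(2)] zero by (intro tvar_less) auto
  have v2: "tvar B 2 t l z < ?m" if "t \<le> W" "l < tm_tapes M" "z \<le> 2 * W" for t l z
    using W[OF that(1)] i[OF that(2)] j[OF that(3)] by (intro tvar_less) auto
  have m: "0 < ?m" using zero by simp
  have sat: "\<exists>y < ?m. tab_clause M P W B x r t l z a y (f y)" if "r < 12" for r t l z a
  proof -
    let ?Q = "\<lambda>y. tab_clause M P W B x r t l z a y (f y)"
    have "r = 0 \<or> r = 1 \<or> r = 2 \<or> r = 3 \<or> r = 4 \<or> r = 5 \<or> r = 6 \<or> r = 7 \<or> r = 8 \<or>
        r = 9 \<or> r = 10 \<or> r = 11"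
      using that by (simp add: less_Suc_eq numeral_eq_Suc)
    then consider "r = 0" | "r = 1" | "r = 2" | "r = 3" | "r = 4" | "r = 5" | "r = 6" | "r = 7" | "r = 8"
      | "r = 9" | "r = 10" | "r = 11"
      by blast
    then show ?thesis
    proof cases
      case 1
      show ?thesis
      proof (cases "t \<le> W \<and> l < tm_tapes M \<and> z \<le> 2 * W \<and> a < length (tm_rows M)")
        case True
        then have "?Q (tvar B 0 t 0 0) \<or> ?Q (tvar B 1 t l 0) \<or> ?Q (tvar B 2 t l z)"
          using T0[of t l] 1 by (auto simp: tab_clause_def fs)
        then show ?thesis using v v1 v2 True by blast
      \<comment> \<open>Parameters out of range make the clause vacuous, so any variable satisfies
        it, for instance number 0.\<close>
      qed (use 1 m in \<open>auto simp: tab_clause_def intro!: exI[of _ 0]\<close>)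
    next
      case 2
      show ?thesis
      proof (cases "t < W \<and> a < length (tm_rows M)")
        case True
        then have "?Q (tvar B 0 t 0 0) \<or> ?Q (tvar B 0 (Suc t) 0 0)"
          using T1[of t] 2 by (auto simp: tab_clause_def fs)
        then show ?thesis using v[of t] v[of "Suc t"] True by auto
      qed (use 2 m in \<open>auto simp: tab_clause_def intro!: exI[of _ 0]\<close>)
    next
      case 3
      show ?thesis
      proof (cases "t < W \<and> l < tm_tapes M \<and> z \<le> 2 * W \<and> a < length (tm_rows M)")
        case True
        then have "?Q (tvar B 0 t 0 0) \<or> ?Q (tvar B 1 t l 0) \<or> ?Q (tvar B 1 (Suc t) l 0)"
          using T2[of t l] 3 by (auto simp: tab_clause_def fs)
        then show ?thesis using v[of t] v1[of t l] v1[of "Suc t" l] True by auto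
      qed (use 3 m in \<open>auto simp: tab_clause_def intro!: exI[of _ 0]\<close>)
    next
      case 4
      show ?thesis
      proof (cases "t < W \<and> l < tm_tapes M \<and> z \<le> 2 * W \<and> a < length (tm_rows M)")
        case True
        then have "?Q (tvar B 0 t 0 0) \<or> ?Q (tvar B 1 t l 0) \<or> ?Q (tvar B 2 (Suc t) l z)"
          using T3[of t l] 4 by (auto simp: tab_clause_def fs)
        then show ?thesis using v[of t] v1[of t l] v2[of "Suc t" l z] True by auto
      qed (use 4 m in \<open>auto simp: tab_clause_def intro!: exI[of _ 0]\<close>)
    next
      case 5
      show ?thesis
      proof (cases "t < W \<and> l < tm_tapes M \<and> z \<le> 2 * W \<and> a < tm_syms M")
        case True
        then have "?Q (tvar B 2 t l z) \<or> ?Q (tvar B 1 t l 0) \<or> ?Q (tvar B 2 (Suc t) l z)"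
          using T4[of t l z] 5 by (auto simp: tab_clause_def fs)
        then show ?thesis using v2[of t l z] v1[of t l] v2[of "Suc t" l z] True by auto
      qed (use 5 m in \<open>auto simp: tab_clause_def intro!: exI[of _ 0]\<close>)
    next
      case 6
      show ?thesis
      proof (cases "t \<le> W")
        case True
        then have "?Q (tvar B 0 t 0 0)" using T5[of t] 6 by (auto simp: tab_clause_def fs)
        then show ?thesis using v True by blast
      qed (use 6 m in \<open>auto simp: tab_clause_def intro!: exI[of _ 0]\<close>)
    next
      case 7
      then have "?Q (tvar B 0 0 0 0)" using T6 by (auto simp: tab_clause_def fs)
      then show ?thesis using v by blast
    next
      case 8
      show ?thesis
      proof (cases "l < tm_tapes M")
        case True
        then have "?Q (tvar B 1 0 l 0)" using T7[of l] 8 by (auto simp: tab_clause_def fs)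
        then show ?thesis using v1 True by blast
      qed (use 8 m in \<open>auto simp: tab_clause_def intro!: exI[of _ 0]\<close>)
    next
      case 9
      show ?thesis
      proof (cases "l < tm_tapes M \<and> z \<le> 2 * W")
        case True
        then have "?Q (tvar B 2 0 l z)" using T8[of l z] 9 by (auto simp: tab_clause_def fs)
        then show ?thesis using v2 True by blast
      qed (use 9 m in \<open>auto simp: tab_clause_def intro!: exI[of _ 0]\<close>)
    next
      case 10
      show ?thesis
      proof (cases "W + (2 * length x + 2) \<le> z \<and> z < 2 * W")
        case True
        then have "?Q (tvar B 2 0 0 z) \<or> ?Q (tvar B 2 0 0 (Suc z))"
          using T9[of z] 10 k by (auto simp: tab_clause_def fs)
        then show ?thesis using v2[of 0 0 z] v2[of 0 0 "Suc z"] True k by auto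
      qed (use 10 m in \<open>auto simp: tab_clause_def intro!: exI[of _ 0]\<close>)
    next
      case 11
      then have "?Q (tvar B 0 W 0 0)" using T10 by (auto simp: tab_clause_def fs)
      then show ?thesis using v by blast
    next
      case 12
      then have "?Q (tvar B 2 W (tm_tapes M - 1) W)" using T11 k by (auto simp: tab_clause_def fs)
      then show ?thesis using v2[of W "tm_tapes M - 1" W] k by auto
    qed
  qed
  have less: "f y < B" for y using zero by (simp add: f_def)
  show ?thesis
    unfolding csp_sat_def tab_rel_def
  proof (intro exI[of _ f] conjI allI impI)
    fix c assume "c < 12 * B * B * B * B"
    then have "c div B div B div B div B < 12" by (intro less_mult_imp_div_less)
    then show "\<exists>y < ?m. tab_clause M P W B x (c div B div B div B div B)
     (c div B div B div B mod B) (c div B div B mod B) (c div B mod B) (c mod B) y (f y)"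
      by (rule sat)
  qed (rule less)
qed

theorem np_reducible_MCCSP:
  assumes "L \<in> class_NP"
  shows "polytime_reducible L MCCSP_D"
proof -
  obtain R p where R: "R \<in> class_P"
    and L: "\<And>x. x \<in> L \<longleftrightarrow> (\<exists>u. length u \<le> poly p (length x) \<and> pair_enc x u \<in> R)"
    using assms unfolding class_NP_def by blast
  obtain M T where M: "wf_tm M" and run: "tm_computes_within M (\<lambda>w. [w \<in> R]) (\<lambda>n. poly T n)"
    using R unfolding class_P_def polytime_computable_def by blast
  define P where "P = (\<lambda>x :: bool list. poly p (length x))"
  define Q where "Q = (\<lambda>x :: bool list. 2 * length x + 2 + P x)"
  \<comment> \<open>\<open>Q x\<close> bounds the length of \<open>pair_enc x u\<close> for all
    admissible \<open>u\<close>. The first summand bounds the running time, the second makes the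
    input fit into the tableau.\<close>
  define W where "W = (\<lambda>x. poly T (Q x) + Q x)"
  define B where "B = (\<lambda>x. 2 * W x + 2 + length (tm_rows M) + tm_syms M + tm_tapes M)"
  have Q: "2 * length x + 2 + P x \<le> W x" for x by (simp add: W_def Q_def)
  have B: "2 * W x + 2 \<le> B x" "length (tm_rows M) \<le> B x" "tm_syms M \<le> B x" "tm_tapes M \<le> B x" for x
    by (simp_all add: B_def)
  have k: "tm_tapes M \<ge> 1" using M by (simp add: wf_tm_def)
  have halts: "\<exists>ts. (tm_step M ^^ W x) (tm_start M (pair_enc x u)) = (tm_states M, ts) \<and>
      snd (last ts) = cells_of [pair_enc x u \<in> R]" if "length u \<le> P x" for x u
  proof -
    let ?w = "pair_enc x u"
    obtain t q ts where t: "t \<le> poly T (length ?w)" "(tm_step M ^^ t) (tm_start M ?w) = (q, ts)"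
      "q = tm_states M" "snd (last ts) = cells_of [?w \<in> R]"
      using run unfolding tm_computes_within_def by fastforce
    have "poly T (length ?w) \<le> poly T (Q x)"
      using that by (intro poly_mono_nat) (simp add: length_pair_enc Q_def)
    then have "t \<le> W x" using t(1) by (simp add: W_def)
    then show ?thesis using tm_halted[of t M _ ts "W x"] t by blast
  qed
  have L_iff: "x \<in> L \<longleftrightarrow> csp_sat (3 * B x * B x * B x) (B x) (12 * B x * B x * B x * B x)
      (tab_rel M (P x) (W x) (B x) x)" for x
  proof
    assume "x \<in> L"
    then obtain u where u: "length u \<le> P x" "pair_enc x u \<in> R" using L by (auto simp: P_def)
    obtain ts where "(tm_step M ^^ W x) (tm_start M (pair_enc x u)) = (tm_states M, ts)"
      "snd (last ts) 0 = 2"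
      using halts[OF u(1)] u(2) by (auto simp: cells_of_def)
    from run_tableau[OF M Q u(1) this] obtain X H C where "tableau M (P x) (W x) x X H C"
      "\<forall>t\<le>W x. \<forall>i<tm_tapes M. H t i \<le> 2 * W x" "\<forall>t. \<forall>i<tm_tapes M. \<forall>j. C t i j < tm_syms M"
      by blast
    then show "csp_sat (3 * B x * B x * B x) (B x) (12 * B x * B x * B x * B x)
      (tab_rel M (P x) (W x) (B x) x)"
      using tableau_imp_csp_sat[OF B k] by simp
  next
    assume "csp_sat (3 * B x * B x * B x) (B x) (12 * B x * B x * B x * B x)
      (tab_rel M (P x) (W x) (B x) x)"
    from csp_sat_imp_tableau[OF B k this] obtain X H C where "tableau M (P x) (W x) x X H C"
      by blast
    from tableau_run[OF M Q this] obtain u ts where u: "length u \<le> P x"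
      "(tm_step M ^^ W x) (tm_start M (pair_enc x u)) = (tm_states M, ts)" "snd (last ts) 0 = 2"
      by blast
    then have "cells_of [pair_enc x u \<in> R] 0 = 2" using halts[OF u(1)] by auto
    then have "pair_enc x u \<in> R" by (auto simp: cells_of_def split: if_splits)
    then show "x \<in> L" using L u(1) by (auto simp: P_def)
  qed
  have defs: "definable (\<lambda>x v. P x)" "definable (\<lambda>x v. W x)" "definable (\<lambda>x v. B x)"
    unfolding P_def Q_def W_def B_def by (intro definable_intros)+
  show ?thesis
  proof (rule csp_reduction[OF _ defs(3) _ _ _ _ L_iff])
    show "definable (\<lambda>x v. 3 * B x * B x * B x)" "definable (\<lambda>x v. 12 * B x * B x * B x * B x)"
      by (intro definable_intros defs)+
    show "0 < 3 * B x * B x * B x" "0 < B x" for x by (simp_all add: B_def)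
    fix c y s :: "bool list \<Rightarrow> (nat \<Rightarrow> nat) \<Rightarrow> nat"
    assume "definable c" "definable y" "definable s"
    then show "decidable (\<lambda>x v. tab_rel M (P x) (W x) (B x) x (c x v) (y x v) (s x v))"
      unfolding tab_rel_def tab_clause_def init_ok_def tvar_def
      by (intro definable_intros defs)
  qed
qed

section \<open>Certificates for central shortest paths\<close>

abbreviation rel_on :: "nat \<Rightarrow> (nat \<Rightarrow> nat \<Rightarrow> bool) \<Rightarrow> nat rel" where
  "rel_on n E \<equiv> {(v, w). v < n \<and> w < n \<and> E v w}"

text \<open>\<open>K k v\<close> claims that \<open>v\<close> reaches a vertex in \<open>S\<close> by a walk of length at most \<open>k\<close>.\<close>

definition levels :: "nat \<Rightarrow> nat \<Rightarrow> (nat \<Rightarrow> nat \<Rightarrow> bool) \<Rightarrow> (nat \<Rightarrow> bool) \<Rightarrow> (nat \<Rightarrow> nat \<Rightarrow> bool) \<Rightarrow> bool" where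
  "levels m n E S K \<longleftrightarrow>
    (\<forall>k<m. \<forall>v<n. K k v \<longrightarrow> S v \<or> 0 < k \<and> (\<exists>w<n. E v w \<and> K (k - 1) w))"

lemma levels_sound:
  assumes "levels m n E S K" "k < m" "v < n" "K k v"
  shows "\<exists>j\<le>k. \<exists>s<n. S s \<and> (v, s) \<in> rel_on n E ^^ j"
  using assms(2-4)
proof (induction k arbitrary: v)
  case 0
  then have "S v" using assms(1) unfolding levels_def by blast
  then show ?case using 0 by (intro exI[of _ 0]) auto
next
  case (Suc k)
  show ?case
  proof (cases "S v")
    case True
    then show ?thesis using Suc.prems by (intro exI[of _ 0]) auto
  next
    case False
    then obtain w where w: "w < n" "E v w" "K k w"
      using assms(1) Suc.prems unfolding levels_def by fastforce
    then obtain j s where "j \<le> k" "s < n" "S s" "(w, s) \<in> rel_on n E ^^ j"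
      using Suc.IH[of w] Suc.prems by auto
    moreover have "(v, w) \<in> rel_on n E" using w Suc.prems by simp
    ultimately have "(v, s) \<in> rel_on n E ^^ Suc j" by (meson relpow_Suc_I2)
    with \<open>j \<le> k\<close> \<open>s < n\<close> \<open>S s\<close> show ?thesis by (intro exI[of _ "Suc j"]) auto
  qed
qed

lemma levels_complete:
  assumes "\<And>k v. k < m \<Longrightarrow> v < n \<Longrightarrow> K k v \<longleftrightarrow> (\<exists>j\<le>k. \<exists>s<n. S s \<and> (v, s) \<in> rel_on n E ^^ j)"
  shows "levels m n E S K"
  unfolding levels_def
proof (intro allI impI)
  fix k v assume k: "k < m" and v: "v < n" and "K k v"
  then obtain j s where js: "j \<le> k" "s < n" "S s" "(v, s) \<in> rel_on n E ^^ j" using assms by blast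
  show "S v \<or> 0 < k \<and> (\<exists>w<n. E v w \<and> K (k - 1) w)"
  proof (cases j)
    case 0
    then show ?thesis using js by auto
  next
    case (Suc i)
    then obtain w where w: "(v, w) \<in> rel_on n E" "(w, s) \<in> rel_on n E ^^ i"
      using js(4) by (meson relpow_Suc_E2)
    then have "w < n" "E v w" by auto
    moreover have "k - 1 < m" "i \<le> k - 1" using k js(1) Suc by auto
    then have "K (k - 1) w" using assms[of "k - 1" w] \<open>w < n\<close> js(2,3) w(2) by blast
    ultimately show ?thesis using js(1) Suc by auto
  qed
qed

text \<open>A certificate has only \<open>m\<close> rows. Walks that short suffice, because the
  least power of \<open>R\<close> that contains a given pair has an exponent of at most
  \<open>card R\<close>.\<close>

lemma relpow_shorten:
  fixes R :: "'a rel"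
  assumes "finite R" "card R < m" "(v, s) \<in> R ^^ j"
  shows "\<exists>i\<le>j. i < m \<and> (v, s) \<in> R ^^ i"
proof -
  define i where "i = (LEAST i. (v, s) \<in> R ^^ i)"
  have i: "(v, s) \<in> R ^^ i" unfolding i_def by (rule LeastI[where P = "\<lambda>i. (v, s) \<in> R ^^ i", OF assms(3)])
  have i_le: "i \<le> k" if "(v, s) \<in> R ^^ k" for k unfolding i_def by (rule Least_le[where P = "\<lambda>i. (v, s) \<in> R ^^ i", OF that])
  have "i \<le> card R"
  proof (cases "i = 0")
    case False
    then have "(v, s) \<in> (\<Union>k \<in> {k. 0 < k \<and> k \<le> card R}. R ^^ k)"
      using relpow_finite_bounded1[OF assms(1), of i] i by auto
    then obtain k where "k \<le> card R" "(v, s) \<in> R ^^ k" by auto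
    then show ?thesis using i_le[of k] by simp
  qed simp
  then show ?thesis using i i_le[OF assms(3)] assms(2) by (intro exI[of _ i]) simp
qed

lemma card_rel_on: "finite (rel_on n E)" "card (rel_on n E) \<le> n * n"
proof -
  have sub: "rel_on n E \<subseteq> {..<n} \<times> {..<n}" by auto
  show "finite (rel_on n E)" by (rule finite_subset[OF sub]) simp
  show "card (rel_on n E) \<le> n * n" using card_mono[OF _ sub] by simp
qed

text \<open>
  A certificate for the graph on \<open>{..<n}\<close> with arcs \<open>E\<close> and the bound with binary digits
  \<open>A 0, \<dots>, A (l - 1)\<close>. It consists of the matrices \<open>c 0\<close>, reachability of vertex 0 in the
  underlying undirected graph; \<open>c 1\<close>, closeness to the path; \<open>c 2\<close>, where \<open>c 2 i v\<close> says that
  vertex \<open>i\<close> of the path is \<open>v\<close>; \<open>c 3\<close>, the vertices that are reached from the start of the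
  path in exactly \<open>k\<close> steps; and \<open>c 4\<close>, where \<open>c 4 j k\<close> says that \<open>k\<close> is less than the number
  with the digits \<open>A j, \<dots>, A (l - 1)\<close>.
\<close>

locale cert =
  fixes m n l :: nat and E :: "nat \<Rightarrow> nat \<Rightarrow> bool" and A :: "nat \<Rightarrow> bool"
    and c :: "nat \<Rightarrow> nat \<Rightarrow> nat \<Rightarrow> bool"
  assumes no_loop: "\<forall>i<n. \<not> E i i"
    and nonempty: "0 < n"
    and conn_levels: "levels m n (\<lambda>v w. E v w \<or> E w v) (\<lambda>v. v = 0) (c 0)"
    and conn: "\<forall>v<n. \<exists>k<m. c 0 k v"
    and close_levels: "levels m n E (\<lambda>v. \<exists>i<m. c 2 i v) (c 1)"
    and close: "\<forall>v<n. \<exists>k<m. c 1 k v \<and> c 4 0 k"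
    and path_start: "\<exists>v<n. c 2 0 v"
    and path_unique: "\<forall>i<m. \<forall>v<n. \<forall>w<n. c 2 i v \<longrightarrow> c 2 i w \<longrightarrow> v = w"
    and path_step: "\<forall>i<m. Suc i < m \<longrightarrow> (\<forall>v<n. c 2 (Suc i) v \<longrightarrow> (\<exists>w<n. c 2 i w \<and> E w v))"
    and reach_start: "\<forall>v<n. c 2 0 v \<longrightarrow> c 3 0 v"
    and reach_step: "\<forall>k<m. Suc k < m \<longrightarrow> (\<forall>v<n. \<forall>w<n. c 3 k v \<longrightarrow> E v w \<longrightarrow> c 3 (Suc k) w)"
    and shortest: "\<forall>i<m. \<forall>k<i. \<forall>v<n. c 2 i v \<longrightarrow> \<not> c 3 k v"
    and digits: "\<forall>j<m. \<forall>k<m. c 4 j k \<longrightarrow> j < l \<and> (c 4 (Suc j) (k div 2) \<or>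
      k mod 2 = 0 \<and> A j \<and> (k = 0 \<or> c 4 (Suc j) (k div 2 - 1)))"

text \<open>One digit of a comparison. An odd \<open>k = 2 * q + 1\<close> is smaller iff
  \<open>q < b\<close>; an even \<open>k = 2 * q\<close> also if \<open>a\<close> holds and
  \<open>q \<le> b\<close>, which is written as \<open>k = 0\<close> or \<open>q - 1 < b\<close> so
  that the recursion stays within strict comparisons.\<close>

lemma less_double_add_iff:
  fixes k b :: nat
  shows "k < of_bool a + 2 * b \<longleftrightarrow> k div 2 < b \<or> k mod 2 = 0 \<and> a \<and> (k = 0 \<or> k div 2 - 1 < b)"
  by (cases a) (simp; presburger)+

context cert
begin

lemma digits_sound:
  assumes "l < m"
  shows "j \<le> l \<Longrightarrow> k < m \<Longrightarrow> c 4 j k \<Longrightarrow> k < horner_sum of_bool 2 (map A [j..<l])"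
proof (induction "l - j" arbitrary: j k)
  case 0
  then have "j < m" using assms by simp
  \<comment> \<open>No digits are left at \<open>j = l\<close>, and the conjunct
    \<open>j < l\<close> in \<open>digits\<close> rules out any claim there.\<close>
  then have "j < l" using digits[rule_format, of j k] 0 by simp
  then show ?case using 0 by simp
next
  case (Suc d)
  then have j: "j < l" "j < m" using assms by auto
  let ?b = "horner_sum of_bool 2 (map A [Suc j..<l]) :: nat"
  have IH: "i < m \<Longrightarrow> c 4 (Suc j) i \<Longrightarrow> i < ?b" for i
    using Suc.hyps(2) j by (intro Suc.hyps(1)) auto
  have "k div 2 < m" "k div 2 - 1 < m" using Suc.prems(2) by linarith+
  then have "k div 2 < ?b \<or> k mod 2 = 0 \<and> A j \<and> (k = 0 \<or> k div 2 - 1 < ?b)"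
    using digits[rule_format, OF j(2) Suc.prems(2,3)] IH[of "k div 2"] IH[of "k div 2 - 1"] by auto
  then have "k < of_bool (A j) + 2 * ?b" by (simp only: less_double_add_iff)
  moreover have "map A [j..<l] = A j # map A [Suc j..<l]" using j(1) by (simp add: upt_conv_Cons)
  ultimately show ?case by simp
qed

text \<open>Used contrapositively: a vertex that is absent from row \<open>k\<close> is not reached
  in \<open>k\<close> steps.\<close>

lemma reach_sound:
  assumes "c 2 0 v" "v < n"
  shows "(v, w) \<in> rel_on n E ^^ k \<Longrightarrow> k < m \<Longrightarrow> c 3 k w"
proof (induction k arbitrary: w)
  case 0
  then show ?case using reach_start assms by simp
next
  case (Suc k)
  then obtain u where u: "(v, u) \<in> rel_on n E ^^ k" "(u, w) \<in> rel_on n E" by auto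
  then have "c 3 k u" using Suc by simp
  then show ?case using reach_step u(2) Suc.prems(2) by auto
qed

text \<open>By \<open>path_step\<close> the row before an occupied row is occupied, so the occupied
  rows form an initial segment, ending at \<open>d\<close>. By \<open>path_unique\<close> each holds
  a single vertex, so the path covers all that \<open>c 2\<close> mentions.\<close>

lemma path_exists:
  "\<exists>p. p \<noteq> [] \<and> length p \<le> m \<and> (\<forall>i<length p. p ! i < n \<and> c 2 i (p ! i)) \<and>
    (\<forall>i v. i < m \<longrightarrow> v < n \<longrightarrow> c 2 i v \<longrightarrow> v \<in> set p) \<and>
    (\<forall>i. Suc i < length p \<longrightarrow> E (p ! i) (p ! Suc i))"
proof -
  have m: "0 < m" using conn[rule_format, OF nonempty] by auto
  define I where "I = {i. i < m \<and> (\<exists>v<n. c 2 i v)}"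
  have I: "finite I" "I \<noteq> {}" using path_start m by (auto simp: I_def)
  define d where "d = Max I"
  have d: "d < m" "\<exists>v<n. c 2 d v" using Max_in[OF I] by (auto simp: d_def I_def)
  have le_d: "i \<le> d" if "i < m" "v < n" "c 2 i v" for i v
  proof -
    have "i \<in> I" using that unfolding I_def by blast
    then show ?thesis unfolding d_def by (rule Max_ge[OF I(1)])
  qed
  have ex: "\<exists>v<n. c 2 (d - i) v" if "i \<le> d" for i
    using that
  proof (induction i)
    case (Suc i)
    then obtain v where v: "v < n" "c 2 (d - i) v" by auto
    have "d - i = Suc (d - Suc i)" "Suc (d - Suc i) < m" using Suc.prems d(1) by auto
    then show ?case using path_step v by (metis Suc_lessD)
  qed (use d in simp)
  then have "\<exists>v. v < n \<and> c 2 i v" if "i \<le> d" for i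
    using ex[of "d - i"] that by auto
  then obtain g where g: "\<And>i. i \<le> d \<Longrightarrow> g i < n \<and> c 2 i (g i)" by metis
  let ?p = "map g [0..<Suc d]"
  have nth: "?p ! i = g i" if "i \<le> d" for i using that by (simp del: upt_Suc)
  have len: "length ?p = Suc d" by simp
  have "v \<in> set ?p" if "i < m" "v < n" "c 2 i v" for i v
  proof -
    have "i \<le> d" using le_d that by blast
    then have "v = g i" using path_unique that g by blast
    then show ?thesis using \<open>i \<le> d\<close> by (simp del: upt_Suc)
  qed
  moreover have "E (?p ! i) (?p ! Suc i)" if "Suc i < length ?p" for i
  proof -
    have i: "i \<le> d" "Suc i \<le> d" "i < m" "Suc i < m" using that d(1) by auto
    then obtain w where "w < n" "c 2 i w" "E w (g (Suc i))" using path_step g by blast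
    moreover have "w = g i" using path_unique g[OF i(1)] i(3) calculation by blast
    ultimately show ?thesis using nth i by simp
  qed
  moreover have "?p ! i < n \<and> c 2 i (?p ! i)" if "i < length ?p" for i
    using that g nth by simp
  ultimately show ?thesis using d(1) len by (intro exI[of _ ?p]) (auto simp del: upt_Suc)
qed

end

section \<open>Soundness and completeness of certificates\<close>

abbreviation graph_on :: "nat \<Rightarrow> (nat \<Rightarrow> nat \<Rightarrow> bool) \<Rightarrow> nat pair_pre_digraph" where
  "graph_on n E \<equiv> \<lparr>pverts = {..<n}, parcs = rel_on n E\<rparr>"

lemma rel_on_sym: "rel_on n (\<lambda>v w. E v w \<or> E w v) = rel_on n E \<union> (rel_on n E)\<inverse>"
  by auto

lemma pair_wf_graph_on: "pair_wf_digraph (graph_on n E)"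
  by unfold_locales auto

theorem (in cert) cert_sound:
  assumes "l < m"
  defines "\<alpha> \<equiv> horner_sum of_bool 2 (map A [0..<l])"
  shows "MCCSP_instance (graph_on n E) \<alpha>" "MCCSP_yes (graph_on n E) \<alpha>"
proof -
  let ?G = "graph_on n E"
  have G: "pair_digraph ?G"
    by unfold_locales (use no_loop card_rel_on(1) in auto)
  have alpha: "k < \<alpha>" if "k < m" "c 4 0 k" for k
    unfolding \<alpha>_def using digits_sound[OF assms(1), of 0 k] that by simp
  \<comment> \<open>Positivity comes from closeness: some \<open>k\<close> is certified to be below
    the bound.\<close>
  have "0 < \<alpha>" using close[rule_format, OF nonempty] alpha by fastforce
  moreover have "Digraph_Component.connected (with_proj ?G)"
    unfolding connected_iff_root[OF pair_wf_graph_on, of 0 n E, simplified, OF nonempty]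
  proof (intro ballI)
    fix v assume "v \<in> {..<n}"
    then obtain k where "k < m" "c 0 k v" "v < n" using conn by auto
    from levels_sound[OF conn_levels this(1,3,2)] obtain j where "(v, 0) \<in> (rel_on n E \<union> (rel_on n E)\<inverse>) ^^ j"
      unfolding rel_on_sym by auto
    then show "(v, 0) \<in> (rel_on n E \<union> (rel_on n E)\<inverse>)\<^sup>*" by (rule relpow_imp_rtrancl)
  qed
  ultimately show "MCCSP_instance ?G \<alpha>" using G by (simp add: MCCSP_instance_def)
  obtain p where p: "p \<noteq> []" "length p \<le> m" "\<And>i. i < length p \<Longrightarrow> p ! i < n \<and> c 2 i (p ! i)"
    "\<And>i v. i < m \<Longrightarrow> v < n \<Longrightarrow> c 2 i v \<Longrightarrow> v \<in> set p"
    "\<And>i. Suc i < length p \<Longrightarrow> E (p ! i) (p ! Suc i)"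
    using path_exists by blast
  have walk: "vwalk p (with_proj ?G)"
    unfolding vwalk_iff_nth
  proof (intro conjI allI impI)
    show "set p \<subseteq> pverts ?G" using p(3) by (auto simp: in_set_conv_nth)
    show "(p ! i, p ! Suc i) \<in> parcs ?G" if "Suc i < length p" for i
      using p(3)[of i] p(3)[of "Suc i"] p(5)[OF that] that by simp
  qed (rule p(1))
  have hd: "hd p < n" "c 2 0 (hd p)" and last: "last p < n" "c 2 (length p - 1) (last p)"
    using p(1) p(3)[of 0] p(3)[of "length p - 1"] by (auto simp: hd_conv_nth last_conv_nth)
  have "(hd p, last p) \<notin> parcs ?G ^^ j" if "j < length p - 1" for j
  proof
    assume "(hd p, last p) \<in> parcs ?G ^^ j"
    then have "c 3 j (last p)"
      using reach_sound[OF hd(2,1), of "last p" j] that p(2) by simp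
    moreover have "length p - 1 < m" using p(1,2) by (cases p) auto
    \<comment> \<open>\<open>shortest\<close> constrains every row and hence the last one, so the
      certificate does not have to state the length of the path.\<close>
    ultimately show False using shortest[rule_format, of "length p - 1" j "last p"] last that by simp
  qed
  then have "shortest_vpath ?G p" using walk shortest_vpath_iff[OF pair_wf_graph_on] by blast
  moreover have "closeness_max ?G p < enat \<alpha>"
  proof -
    have "\<exists>v \<in> set p. \<exists>j<\<alpha>. (u, v) \<in> rel_on n E ^^ j" if u: "u < n" for u
    proof -
      obtain k where k: "k < m" "c 1 k u" "c 4 0 k" using close[rule_format, OF u] by blast
      from levels_sound[OF close_levels k(1) u k(2)]
      obtain j s i where "j \<le> k" "s < n" "i < m" "c 2 i s" "(u, s) \<in> rel_on n E ^^ j" by blast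
      then show ?thesis using p(4)[of i s] alpha[OF k(1,3)] le_less_trans by blast
    qed
    moreover have "pverts ?G \<noteq> {}" using nonempty by auto
    ultimately show ?thesis using closeness_max_less_iff[OF G _ p(1)] by simp
  qed
  ultimately show "MCCSP_yes ?G \<alpha>" unfolding MCCSP_yes_def by blast
qed

definition cert_of :: "nat \<Rightarrow> nat \<Rightarrow> (nat \<Rightarrow> nat \<Rightarrow> bool) \<Rightarrow> (nat \<Rightarrow> bool) \<Rightarrow> nat list \<Rightarrow>
    nat \<Rightarrow> nat \<Rightarrow> nat \<Rightarrow> bool" where
  "cert_of n l E A p s i j \<longleftrightarrow>
    (if s = 0 then \<exists>k\<le>i. (j, 0) \<in> (rel_on n E \<union> (rel_on n E)\<inverse>) ^^ k
     else if s = 1 then \<exists>k\<le>i. \<exists>v \<in> set p. (j, v) \<in> rel_on n E ^^ k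
     else if s = 2 then i < length p \<and> p ! i = j
     else if s = 3 then (hd p, j) \<in> rel_on n E ^^ i
     else j < horner_sum of_bool 2 (map A [i..<l]))"

lemma cert_complete:
  assumes inst: "MCCSP_instance (graph_on n E) \<alpha>" and \<alpha>: "\<alpha> = horner_sum of_bool 2 (map A [0..<l])"
    and short: "shortest_vpath (graph_on n E) p" and close: "closeness_max (graph_on n E) p < enat \<alpha>"
    and m: "n * n < m" "l < m"
    and c: "\<And>s i j. s < 5 \<Longrightarrow> i < m \<Longrightarrow> j < m \<Longrightarrow> c s i j = cert_of n l E A p s i j"
  shows "cert m n l E A c"
proof -
  let ?G = "graph_on n E" and ?R = "rel_on n E"
  interpret G: pair_digraph ?G using inst by (simp add: MCCSP_instance_def)
  have "pverts ?G \<noteq> {}" using inst by (auto simp: MCCSP_instance_def connected_conv)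
  then have n: "0 < n" by auto
  have nm: "v < m" if "v < n" for v using that m(1) le_square[of n] by linarith
  have m0: "0 < m" using m(1) by simp
  have walk: "vwalk p (with_proj ?G)" and dist: "distinct p"
    using short by (simp_all add: shortest_vpath_def vpath_def)
  have p: "p \<noteq> []" "set p \<subseteq> {..<n}" "\<And>i. Suc i < length p \<Longrightarrow> (p ! i, p ! Suc i) \<in> ?R"
    using walk unfolding vwalk_iff_nth by simp_all
  have len: "length p \<le> n" using card_mono[OF _ p(2)] distinct_card[OF dist] by simp
  have c0: "c 0 k v \<longleftrightarrow> (\<exists>j\<le>k. (v, 0) \<in> rel_on n (\<lambda>v w. E v w \<or> E w v) ^^ j)" if "k < m" "v < n" for k v
    using c[of 0 k v] that nm unfolding rel_on_sym by (simp add: cert_of_def)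
  have c1: "c 1 k v \<longleftrightarrow> (\<exists>j\<le>k. \<exists>s \<in> set p. (v, s) \<in> ?R ^^ j)" if "k < m" "v < n" for k v
    using c[of 1 k v] that nm by (simp add: cert_of_def)
  have c2: "c 2 i v \<longleftrightarrow> i < length p \<and> p ! i = v" if "i < m" "v < n" for i v
    using c[of 2 i v] that nm by (simp add: cert_of_def)
  have c3: "c 3 i v \<longleftrightarrow> (hd p, v) \<in> ?R ^^ i" if "i < m" "v < n" for i v
    using c[of 3 i v] that nm by (simp add: cert_of_def)
  have c4: "c 4 i k \<longleftrightarrow> k < horner_sum of_bool 2 (map A [i..<l])" if "i < m" "k < m" for i k
    using c[of 4 i k] that by (simp add: cert_of_def)
  have set_p: "v \<in> set p \<longleftrightarrow> (\<exists>i<m. c 2 i v)" if "v < n" for v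
    using c2[OF _ that] len nm by (metis in_set_conv_nth le_less_trans less_le_trans less_or_eq_imp_le linorder_not_less)
  show ?thesis
  proof
    show "\<forall>i<n. \<not> E i i" using G.pair_no_loops by fastforce
    show "0 < n" by (rule n)
    show "levels m n (\<lambda>v w. E v w \<or> E w v) (\<lambda>v. v = 0) (c 0)"
      by (rule levels_complete) (use c0 n in auto)
    show "\<forall>v<n. \<exists>k<m. c 0 k v"
    proof (intro allI impI)
      fix v assume v: "v < n"
      let ?S = "rel_on n (\<lambda>v w. E v w \<or> E w v)"
      have "(v, 0) \<in> ?S\<^sup>*"
        using inst v n connected_iff_root[OF G.pair_wf_digraph, of 0]
        unfolding rel_on_sym by (simp add: MCCSP_instance_def)
      then obtain j where "(v, 0) \<in> ?S ^^ j" using rtrancl_imp_relpow by blast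
      \<comment> \<open>There are at most \<open>n * n\<close> arcs, fewer than \<open>m\<close>, so
        some walk to the root fits into the table.\<close>
      from relpow_shorten[OF card_rel_on(1) le_less_trans[OF card_rel_on(2) m(1)] this]
      show "\<exists>k<m. c 0 k v" using c0 v by blast
    qed
    show "levels m n E (\<lambda>v. \<exists>i<m. c 2 i v) (c 1)"
    proof (rule levels_complete)
      fix k v assume "k < m" "v < n"
      then show "c 1 k v \<longleftrightarrow> (\<exists>j\<le>k. \<exists>s<n. (\<exists>i<m. c 2 i s) \<and> (v, s) \<in> ?R ^^ j)"
        using c1 set_p p(2) by (metis (no_types, lifting) lessThan_iff subsetD)
    qed
    show "\<forall>v<n. \<exists>k<m. c 1 k v \<and> c 4 0 k"
    proof (intro allI impI)
      fix v assume v: "v < n"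
      have "\<forall>u \<in> pverts ?G. \<exists>s \<in> set p. \<exists>j<\<alpha>. (u, s) \<in> parcs ?G ^^ j"
        using close closeness_max_less_iff[OF G.pair_digraph \<open>pverts ?G \<noteq> {}\<close> p(1)] by blast
      from bspec[OF this, of v] obtain s j where sj: "s \<in> set p" "j < \<alpha>" "(v, s) \<in> ?R ^^ j"
        using v by auto
      from relpow_shorten[OF card_rel_on(1) le_less_trans[OF card_rel_on(2) m(1)] sj(3)]
      obtain i where "i \<le> j" "i < m" "(v, s) \<in> ?R ^^ i" by blast
      then show "\<exists>k<m. c 1 k v \<and> c 4 0 k"
        using c1[OF _ v, of i] c4[OF m0, of i] sj(1,2) \<alpha> by (intro exI[of _ i]) auto
    qed
    have "p ! 0 \<in> set p" using p(1) by (intro nth_mem) simp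
    then have "p ! 0 < n" using p(2) by blast
    then show "\<exists>v<n. c 2 0 v"
      using c2[OF m0, of "p ! 0"] p(1) by (intro exI[of _ "p ! 0"]) simp
    show "\<forall>i<m. \<forall>v<n. \<forall>w<n. c 2 i v \<longrightarrow> c 2 i w \<longrightarrow> v = w"
      using c2 by auto
    show "\<forall>i<m. Suc i < m \<longrightarrow> (\<forall>v<n. c 2 (Suc i) v \<longrightarrow> (\<exists>w<n. c 2 i w \<and> E w v))"
    proof (intro allI impI)
      fix i v assume i: "i < m" "Suc i < m" and v: "v < n" "c 2 (Suc i) v"
      then have "Suc i < length p" "p ! Suc i = v" using c2 by auto
      then have "p ! i < n" "E (p ! i) v" using p(3)[of i] by auto
      then show "\<exists>w<n. c 2 i w \<and> E w v" using c2[OF i(1)] \<open>Suc i < length p\<close> by auto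
    qed
    show "\<forall>v<n. c 2 0 v \<longrightarrow> c 3 0 v"
      using c2[OF m0] c3[OF m0] p(1) by (auto simp: hd_conv_nth)
    show "\<forall>k<m. Suc k < m \<longrightarrow> (\<forall>v<n. \<forall>w<n. c 3 k v \<longrightarrow> E v w \<longrightarrow> c 3 (Suc k) w)"
    proof (intro allI impI)
      fix k v w assume k: "k < m" "Suc k < m" and vw: "v < n" "w < n" "c 3 k v" "E v w"
      then have "(hd p, v) \<in> ?R ^^ k" "(v, w) \<in> ?R" using c3 by auto
      then have "(hd p, w) \<in> ?R ^^ Suc k" by (rule relpow_Suc_I)
      then show "c 3 (Suc k) w" using c3[OF k(2) vw(2)] by blast
    qed
    show "\<forall>i<m. \<forall>k<i. \<forall>v<n. c 2 i v \<longrightarrow> \<not> c 3 k v"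
    proof (intro allI impI notI)
      fix i k v assume i: "i < m" "k < i" and v: "v < n" "c 2 i v" "c 3 k v"
      then have iv: "i < length p" "p ! i = v" "(hd p, v) \<in> ?R ^^ k" using c2 c3[of k v] by auto
      \<comment> \<open>Prefixes of a shortest path are shortest: \<open>k\<close> steps to
        \<open>p ! i\<close> and then the rest of \<open>p\<close> would make a shorter
        walk.\<close>
      have "(p ! i, p ! (i + (length p - 1 - i))) \<in> parcs ?G ^^ (length p - 1 - i)"
        using iv(1) by (intro vwalk_nth_relpow[OF walk]) simp
      then have "(v, last p) \<in> ?R ^^ (length p - 1 - i)"
        using iv(1,2) p(1) by (simp add: last_conv_nth)
      with iv(3) have "(hd p, last p) \<in> ?R ^^ (k + (length p - 1 - i))"
        unfolding relpow_add by blast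
      moreover have "k + (length p - 1 - i) < length p - 1" using i(2) iv(1) by simp
      ultimately show False using short shortest_vpath_iff[OF G.pair_wf_digraph] by simp
    qed
    show "\<forall>j<m. \<forall>k<m. c 4 j k \<longrightarrow> j < l \<and> (c 4 (Suc j) (k div 2) \<or>
      k mod 2 = 0 \<and> A j \<and> (k = 0 \<or> c 4 (Suc j) (k div 2 - 1)))"
    proof (intro allI impI)
      fix j k assume j: "j < m" and k: "k < m" and "c 4 j k"
      then have less: "k < horner_sum of_bool 2 (map A [j..<l])" using c4 by blast
      then have jl: "j < l" by (cases "j < l") auto
      then have "map A [j..<l] = A j # map A [Suc j..<l]" by (simp add: upt_conv_Cons)
      with less have "k < of_bool (A j) + 2 * horner_sum of_bool 2 (map A [Suc j..<l])" by simp
      then have "k div 2 < horner_sum of_bool 2 (map A [Suc j..<l]) \<or> k mod 2 = 0 \<and> A j \<and>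
          (k = 0 \<or> k div 2 - 1 < horner_sum of_bool 2 (map A [Suc j..<l]))"
        by (simp only: less_double_add_iff)
      moreover have "Suc j < m" "k div 2 < m" "k div 2 - 1 < m" using jl m(2) k by auto
      ultimately show "j < l \<and> (c 4 (Suc j) (k div 2) \<or>
          k mod 2 = 0 \<and> A j \<and> (k = 0 \<or> c 4 (Suc j) (k div 2 - 1)))"
        using jl c4 by simp
    qed
  qed
qed

section \<open>Certificates as strings, and the verifier\<close>

definition cert_bit :: "nat \<Rightarrow> bool list \<Rightarrow> nat \<Rightarrow> nat \<Rightarrow> nat \<Rightarrow> bool" where
  "cert_bit m u s i j \<longleftrightarrow> bit_at u ((s * m + i) * m + j)"

lemma cert_bit_surj:
  "\<exists>u. length u = 5 * m * m \<and> (\<forall>s i j. s < 5 \<longrightarrow> i < m \<longrightarrow> j < m \<longrightarrow> cert_bit m u s i j = c s i j)"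
proof -
  let ?u = "map (\<lambda>t. c (t div m div m) (t div m mod m) (t mod m)) [0..<5 * m * m]"
  have "cert_bit m ?u s i j = c s i j" if "s < 5" "i < m" "j < m" for s i j
  proof -
    let ?t = "(s * m + i) * m + j"
    have step: "a * m + b < d * m" if "a < d" "b < m" for a b d
      using mult_le_mono1[of "Suc a" d m] that unfolding mult_Suc by linarith
    have "?t < 5 * m * m" by (intro step that)
    moreover have "?t mod m = j" "?t div m mod m = i" "?t div m div m = s" using that by simp_all
    ultimately show ?thesis by (simp add: cert_bit_def bit_at_def)
  qed
  then show ?thesis by (intro exI[of _ ?u]) simp
qed

lemma bound_of_eq:
  assumes "n + 1 + n * n \<le> length x"
  shows "bound_of n x = horner_sum of_bool 2
    (map (\<lambda>k. bit_at x (n + 1 + n * n + k)) [0..<length x - (n + 1 + n * n)])"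
proof -
  have "drop (n + 1 + n * n) x
      = map (\<lambda>k. bit_at x (n + 1 + n * n + k)) [0..<length x - (n + 1 + n * n)]"
    by (rule nth_equalityI) (use assms in \<open>auto simp: bit_at_def\<close>)
  then show ?thesis by (simp add: bound_of_def)
qed

text \<open>All five matrices get the dimension \<open>length x\<close>. It exceeds
  \<open>n * n\<close> and the number of digits, as \<open>cert_complete\<close> and
  \<open>cert_sound\<close> ask, because \<open>x\<close> contains the adjacency matrix and the
  digits.\<close>

lemma MCCSP_D_cert:
  "x \<in> MCCSP_D \<longleftrightarrow> (\<exists>u. length u \<le> 5 * length x * length x \<and>
    (\<exists>n<length x. enc_shape n x \<and>
      cert (length x) n (length x - (n + 1 + n * n)) (\<lambda>i j. bit_at x (n + 1 + i * n + j))
        (\<lambda>k. bit_at x (n + 1 + n * n + k)) (cert_bit (length x) u)))"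
  (is "_ \<longleftrightarrow> (\<exists>u. ?len u \<and> (\<exists>n<?m. enc_shape n x \<and> cert ?m n (?l n) (?E n) (?A n) (cert_bit ?m u)))")
proof
  assume "x \<in> MCCSP_D"
  then obtain n where n: "enc_shape n x" "MCCSP_instance (graph_of n x) (bound_of n x)"
    "MCCSP_yes (graph_of n x) (bound_of n x)"
    unfolding MCCSP_D_iff by blast
  then obtain p where p: "shortest_vpath (graph_of n x) p" "closeness_max (graph_of n x) p < enat (bound_of n x)"
    unfolding MCCSP_yes_def by blast
  have less: "n + 1 + n * n < ?m" using n(1) by (simp add: enc_shape_def)
  obtain u where u: "length u = 5 * ?m * ?m"
    "\<And>s i j. s < 5 \<Longrightarrow> i < ?m \<Longrightarrow> j < ?m \<Longrightarrow> cert_bit ?m u s i j = cert_of n (?l n) (?E n) (?A n) p s i j"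
    using cert_bit_surj[of ?m "cert_of n (?l n) (?E n) (?A n) p"] by auto
  have "cert ?m n (?l n) (?E n) (?A n) (cert_bit ?m u)"
  proof (rule cert_complete)
    show "MCCSP_instance (graph_on n (?E n)) (bound_of n x)" "shortest_vpath (graph_on n (?E n)) p"
      "closeness_max (graph_on n (?E n)) p < enat (bound_of n x)"
      using n(2) p by (simp_all only: graph_of_def)
    show "bound_of n x = horner_sum of_bool 2 (map (?A n) [0..<?l n])"
      using less by (intro bound_of_eq) simp
  qed (use less u(2) in auto)
  then show "\<exists>u. ?len u \<and> (\<exists>n<?m. enc_shape n x \<and> cert ?m n (?l n) (?E n) (?A n) (cert_bit ?m u))"
    using n(1) u(1) less by (intro exI[of _ u] conjI exI[of _ n]) simp_all
next
  assume "\<exists>u. ?len u \<and> (\<exists>n<?m. enc_shape n x \<and> cert ?m n (?l n) (?E n) (?A n) (cert_bit ?m u))"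
  then obtain u n where n: "enc_shape n x" "cert ?m n (?l n) (?E n) (?A n) (cert_bit ?m u)"
    by blast
  have less: "n + 1 + n * n < ?m" using n(1) by (simp add: enc_shape_def)
  then have "?l n < ?m" by simp
  from cert.cert_sound[OF n(2) this]
  have "MCCSP_instance (graph_of n x) (bound_of n x)" "MCCSP_yes (graph_of n x) (bound_of n x)"
    using less by (simp_all only: graph_of_def bound_of_eq[OF less_imp_le])
  then show "x \<in> MCCSP_D" unfolding MCCSP_D_iff using n(1) by blast
qed

text \<open>The length is recovered as the number of doubled bits: the first unequal pair is the
  separator.\<close>

definition fst_length :: "bool list \<Rightarrow> nat \<Rightarrow> bool" where
  "fst_length w m \<longleftrightarrow> (\<forall>j<m. bit_at w (2 * j) = bit_at w (2 * j + 1)) \<and>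
     \<not> bit_at w (2 * m) \<and> bit_at w (2 * m + 1)"

definition fst_bit :: "bool list \<Rightarrow> nat \<Rightarrow> nat \<Rightarrow> bool" where
  "fst_bit w m j \<longleftrightarrow> j < m \<and> bit_at w (2 * j)"

text \<open>The condition of \<open>MCCSP_D_cert\<close> with all bits read directly from the pair.
  Every quantifier is bounded, so the rules \<open>definable_intros\<close> apply to it.\<close>

definition verifier :: "bool list set" where
  "verifier = {w. \<exists>m<length w. fst_length w m \<and>
     (\<exists>n<m. ((\<forall>i<n. fst_bit w m i) \<and> \<not> fst_bit w m n \<and> n + 1 + n * n < m \<and> fst_bit w m (m - 1)) \<and>
       cert m n (m - (n + 1 + n * n)) (\<lambda>i j. fst_bit w m (n + 1 + i * n + j))
         (\<lambda>k. fst_bit w m (n + 1 + n * n + k))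
         (\<lambda>s i j. bit_at w (2 * m + 2 + ((s * m + i) * m + j))))}"

lemma fst_length_pair_enc: "fst_length (pair_enc x u) m \<longleftrightarrow> m = length x"
proof -
  let ?w = "pair_enc x u" and ?m = "length x"
  have even: "bit_at ?w (2 * j) = bit_at ?w (2 * j + 1)" if "j < ?m" for j
    using that by (simp add: bit_at_pair_enc)
  have sep: "\<not> bit_at ?w (2 * ?m)" "bit_at ?w (2 * ?m + 1)" by (simp_all add: bit_at_pair_enc)
  show ?thesis
  proof
    assume "fst_length ?w m"
    then have "\<not> m < ?m" "\<not> ?m < m" using even[of m] sep unfolding fst_length_def by blast+
    then show "m = ?m" by simp
  next
    assume "m = ?m"
    then show "fst_length ?w m" using even sep unfolding fst_length_def by blast
  qed
qed

lemma fst_bit_pair_enc: "fst_bit (pair_enc x u) (length x) = bit_at x"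
proof
  show "fst_bit (pair_enc x u) (length x) j = bit_at x j" for j
    by (cases "j < length x") (simp_all add: fst_bit_def bit_at_pair_enc, simp add: bit_at_def)
qed

lemma verifier_pair_enc:
  "pair_enc x u \<in> verifier \<longleftrightarrow> (\<exists>n<length x. enc_shape n x \<and>
      cert (length x) n (length x - (n + 1 + n * n)) (\<lambda>i j. bit_at x (n + 1 + i * n + j))
        (\<lambda>k. bit_at x (n + 1 + n * n + k)) (cert_bit (length x) u))"
proof -
  have snd: "bit_at (pair_enc x u) (2 * length x + 2 + t) = bit_at u t" for t
    by (simp add: bit_at_pair_enc)
  have less: "length x < length (pair_enc x u)" by (simp add: length_pair_enc)
  have one_point: "(\<exists>m<k. m = l \<and> P m) \<longleftrightarrow> P l" if "l < k" for k l :: nat and P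
    using that by blast
  show ?thesis
    unfolding verifier_def mem_Collect_eq fst_length_pair_enc one_point[OF less] fst_bit_pair_enc snd
      enc_shape_def cert_bit_def[abs_def] ..
qed

lemma verifier_in_P: "verifier \<in> class_P"
  by (rule class_PI) (unfold verifier_def mem_Collect_eq fst_length_def fst_bit_def cert_def levels_def,
    intro definable_intros)

theorem MCCSP_D_in_NP: "MCCSP_D \<in> class_NP"
proof -
  have "poly [:0, 0, 5:] n = 5 * n * n" for n :: nat by simp
  then have "x \<in> MCCSP_D \<longleftrightarrow> (\<exists>u. length u \<le> poly [:0, 0, 5:] (length x) \<and> pair_enc x u \<in> verifier)"
    for x
    unfolding verifier_pair_enc MCCSP_D_cert by (simp only:)
  then show ?thesis unfolding class_NP_def using verifier_in_P by blast
qed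

theorem theorem4:
  shows "NP_complete MCCSP_D"
  unfolding NP_complete_def using MCCSP_D_in_NP np_reducible_MCCSP by blast

end
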